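(* For every $n\ge 3$, the flip graph of (unlabeled) combinatorial 4-PPTs with $n$ vertices and triangular outer face is connected and has diameter $O(n^2)$, i.e., any two such combinatorial 4-PPTs can be transformed into each other by at most $Cn^2$ flips, for an absolute constant $C$.
   Context: An angle is a vertex–face incidence of a plane embedded graph. A combinatorial pseudo-triangulation is a combinatorial embedding in the plane (rotation system with designated outer face) of a connected planar simple graph, with a tag "reflex" or "convex" on each angle, such that every interior face has exactly three convex angles, all angles of the outer face are reflex, and no vertex is incident to more than one reflex angle; it is pointed if every vertex is incident to exactly one reflex angle. A combinatorial 4-PPT is a combinatorial pointed pseudo-triangulation whose interior faces all have size 3 or 4. Combinatorial 4-PPTs are considered up to isomorphism preserving embedding, outer face and tags. Flip: for an interior triangular face $\triangle$, an edge $e$ of $\triangle$ not on the outer face, the other face $F$ at $e$, and the region $R$ obtained by deleting $e$, a flip replaces $e$ by an edge $e'\ne e$ inside $R$ that splits $R$ into a triangular face and a face of the same size as $F$, such that the result (tags outside $R$ unchanged) is again a combinatorial 4-PPT; in particular $e'$ may not join two vertices already adjacent. The flip graph has these combinatorial 4-PPTs as vertices, two being adjacent if one is obtained from the other by a flip. *)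

theory Defs
  imports Complex_Main
begin

text \<open>Combinatorial embeddings.  Vertices are natural numbers.  A structure consists of
a finite vertex set, a symmetric irreflexive adjacency relation, a rotation system
(rot v w = the neighbour of v following w in the cyclic order around v), a designated
outer face (given as a set of darts, i.e. a face), and a tag on each angle.
An angle (corner) is represented by the dart (u,v) entering it: it is the corner at v
between the darts (u,v) and fnext (u,v) of the same face.  reflex d = True means
the angle is tagged reflex, False means convex.\<close>

record cppt =
  verts  :: "nat set"
  adj    :: "nat \<Rightarrow> nat \<Rightarrow> bool"
  rot    :: "nat \<Rightarrow> nat \<Rightarrow> nat"
  outer  :: "(nat \<times> nat) set"
  reflex :: "nat \<times> nat \<Rightarrow> bool"

definition darts :: "(nat \<Rightarrow> nat \<Rightarrow> bool) \<Rightarrow> (nat \<times> nat) set" where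
  "darts A = {(u, v). A u v}"

definition fnext :: "(nat \<Rightarrow> nat \<Rightarrow> nat) \<Rightarrow> nat \<times> nat \<Rightarrow> nat \<times> nat" where
  "fnext r d = (snd d, r (snd d) (fst d))"

definition face_of :: "(nat \<Rightarrow> nat \<Rightarrow> nat) \<Rightarrow> nat \<times> nat \<Rightarrow> (nat \<times> nat) set" where
  "face_of r d = range (\<lambda>k. (fnext r ^^ k) d)"

definition faces :: "(nat \<Rightarrow> nat \<Rightarrow> bool) \<Rightarrow> (nat \<Rightarrow> nat \<Rightarrow> nat) \<Rightarrow> (nat \<times> nat) set set" where
  "faces A r = face_of r ` darts A"

definition simple_graph :: "nat set \<Rightarrow> (nat \<Rightarrow> nat \<Rightarrow> bool) \<Rightarrow> bool" where
  "simple_graph V A \<longleftrightarrow> finite V \<and> (\<forall>u v. A u v \<longrightarrow> u \<in> V \<and> v \<in> V \<and> u \<noteq> v \<and> A v u)"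

definition connected_graph :: "nat set \<Rightarrow> (nat \<Rightarrow> nat \<Rightarrow> bool) \<Rightarrow> bool" where
  "connected_graph V A \<longleftrightarrow> (\<forall>u\<in>V. \<forall>v\<in>V. A\<^sup>*\<^sup>* u v)"

definition rotation_system :: "nat set \<Rightarrow> (nat \<Rightarrow> nat \<Rightarrow> bool) \<Rightarrow> (nat \<Rightarrow> nat \<Rightarrow> nat) \<Rightarrow> bool" where
  "rotation_system V A r \<longleftrightarrow>
     (\<forall>v\<in>V. \<forall>w. A v w \<longrightarrow> A v (r v w)) \<and>
     (\<forall>v\<in>V. \<forall>w w'. A v w \<longrightarrow> A v w' \<longrightarrow> r v w = r v w' \<longrightarrow> w = w') \<and>
     (\<forall>v\<in>V. \<forall>w w'. A v w \<longrightarrow> A v w' \<longrightarrow> (\<exists>k. (r v ^^ k) w = w'))"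

text \<open>Plane embedding of a connected simple graph: a rotation system of genus 0
(Euler's formula V - E + F = 2, E = number of darts / 2).\<close>
definition plane_embedding :: "nat set \<Rightarrow> (nat \<Rightarrow> nat \<Rightarrow> bool) \<Rightarrow> (nat \<Rightarrow> nat \<Rightarrow> nat) \<Rightarrow> bool" where
  "plane_embedding V A r \<longleftrightarrow>
     simple_graph V A \<and> connected_graph V A \<and> rotation_system V A r \<and>
     int (card V) - int (card (darts A) div 2) + int (card (faces A r)) = 2"

definition interior_faces :: "cppt \<Rightarrow> (nat \<times> nat) set set" where
  "interior_faces T = faces (adj T) (rot T) - {outer T}"

definition comb_pt :: "cppt \<Rightarrow> bool" where
  "comb_pt T \<longleftrightarrow>
     plane_embedding (verts T) (adj T) (rot T) \<and>
     outer T \<in> faces (adj T) (rot T) \<and>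
     (\<forall>f\<in>interior_faces T. card {d\<in>f. \<not> reflex T d} = 3) \<and>
     (\<forall>d\<in>outer T. reflex T d) \<and>
     (\<forall>v\<in>verts T. card {d\<in>darts (adj T). snd d = v \<and> reflex T d} \<le> 1)"

definition pointed :: "cppt \<Rightarrow> bool" where
  "pointed T \<longleftrightarrow> (\<forall>v\<in>verts T. card {d\<in>darts (adj T). snd d = v \<and> reflex T d} = 1)"

definition four_ppt :: "cppt \<Rightarrow> bool" where
  "four_ppt T \<longleftrightarrow> comb_pt T \<and> pointed T \<and> (\<forall>f\<in>interior_faces T. card f = 3 \<or> card f = 4)"

definition cppt_iso :: "cppt \<Rightarrow> cppt \<Rightarrow> bool" where
  "cppt_iso T T' \<longleftrightarrow> (\<exists>f. bij_betw f (verts T) (verts T') \<and>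
     (\<forall>u\<in>verts T. \<forall>v\<in>verts T. adj T' (f u) (f v) = adj T u v) \<and>
     (\<forall>v w. adj T v w \<longrightarrow> rot T' (f v) (f w) = f (rot T v w)) \<and>
     (\<forall>u v. adj T u v \<longrightarrow> reflex T' (f u, f v) = reflex T (u, v)) \<and>
     map_prod f f ` outer T = outer T')"

definition rot_remove :: "(nat \<Rightarrow> nat \<Rightarrow> nat) \<Rightarrow> nat \<Rightarrow> nat \<Rightarrow> nat \<Rightarrow> nat \<Rightarrow> nat" where
  "rot_remove r a b = (\<lambda>v w. if v = a \<and> r a w = b then r a b else r v w)"

text \<open>Inserting neighbour d at vertex c into the corner entered by the dart (x,c),
i.e. right after x in the cyclic order at c.\<close>
definition rot_insert :: "(nat \<Rightarrow> nat \<Rightarrow> nat) \<Rightarrow> nat \<Rightarrow> nat \<Rightarrow> nat \<Rightarrow> nat \<Rightarrow> nat \<Rightarrow> nat" where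
  "rot_insert r c x d = (\<lambda>v w. if v = c \<and> w = x then d else if v = c \<and> w = d then r c x else r v w)"

text \<open>A flip: the interior triangular face Tri contains the dart (a,b) of the edge e = ab,
e is not on the outer face, F is the other face at e.  Deleting e merges Tri and F into
the region R (whose darts are those of Tri and F except the two darts of e).  The new
edge e' = cd is inserted into two corners of R (entered by the darts (x,c) and (y,d) of
R), splitting R into a triangle and a face of size |F|.  Angles outside R keep their tags,
and the result is a combinatorial 4-PPT.\<close>
definition flip :: "cppt \<Rightarrow> cppt \<Rightarrow> bool" where
  "flip T T' \<longleftrightarrow> (\<exists>a b c d x y Tri F.
     four_ppt T \<and> four_ppt T' \<and> verts T' = verts T \<and> outer T' = outer T \<and>
     Tri \<in> interior_faces T \<and> card Tri = 3 \<and> (a, b) \<in> Tri \<and>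
     (a, b) \<notin> outer T \<and> (b, a) \<notin> outer T \<and>
     F = face_of (rot T) (b, a) \<and>
     (let A1 = (\<lambda>u v. adj T u v \<and> {u, v} \<noteq> {a, b});
          r1 = rot_remove (rot_remove (rot T) a b) b a;
          r2 = rot_insert (rot_insert r1 c x d) d y c;
          A2 = (\<lambda>u v. A1 u v \<or> {u, v} = {c, d});
          R = (Tri \<union> F) - {(a, b), (b, a)}
      in c \<noteq> d \<and> \<not> adj T c d \<and> {c, d} \<noteq> {a, b} \<and>
         (x, c) \<in> R \<and> (y, d) \<in> R \<and>
         adj T' = A2 \<and> (\<forall>v w. A2 v w \<longrightarrow> rot T' v w = r2 v w) \<and>
         {card (face_of r2 (c, d)), card (face_of r2 (d, c))} = {3, card F} \<and>
         (\<forall>f\<in>faces (adj T) (rot T) - {Tri, F}. \<forall>\<delta>\<in>f. reflex T' \<delta> = reflex T \<delta>)))"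

text \<open>Adjacency in the flip graph on isomorphism classes, lifted to representatives.\<close>
definition flip_step :: "cppt \<Rightarrow> cppt \<Rightarrow> bool" where
  "flip_step T T' \<longleftrightarrow> (\<exists>A B. cppt_iso T A \<and> flip A B \<and> cppt_iso B T')"

end

theory Submission
  imports Defs
begin

text \<open>A 4-PPT with triangular outer face has, by counting, exactly one interior triangle, and every
  other interior face is a quadrilateral with one reflex angle.  A flip exchanges two diagonals of
  the pentagon formed by the triangle and an adjacent quadrilateral.  By a parity argument every
  3-cycle separates the triangle from the outer face, and by a count none of its vertices has its
  reflex angle inside.  Hence the two diagonals of the pentagon at its reflex vertex never join
  adjacent vertices, and the triangle can be moved across any quadrilateral by a single flip, in
  particular to an edge \<open>uw\<close> of the outer face \<open>w u v\<close>.

  Now the triangle is swept around \<open>u\<close> from \<open>uw\<close> to \<open>uv\<close>.  This takes at most \<open>deg u + 1\<close> flips and leaves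
  \<open>u\<close> with a single inner neighbour; one more flip makes \<open>u\<close> a vertex of degree 2, and inside the
  quadrilateral \<open>u w x v\<close> with reflex vertex \<open>x\<close> there is a smaller 4-PPT with outer face \<open>w x v\<close>, whose
  triangle is at \<open>xw\<close> or, after sweeps around \<open>v\<close> and \<open>w\<close>, can be brought there.  Repeating this
  \<open>O(n)\<close> times joins all other vertices to both \<open>w\<close> and \<open>v\<close>, which determines the 4-PPT up to
  isomorphism.  As flips are reversible, any two 4-PPTs are connected through this form.\<close>

section \<open>Parity counting\<close>

text \<open>The only topological input is Euler's formula. It yields that an edge set meeting every
  face in an even number of darts is a cut, and this replaces the Jordan curve theorem: the inside
  of a 3-cycle is defined as the set of faces reachable from the triangle, and parity shows that it
  misses the outer face and never lies on both sides of an edge of the cycle. The obstacle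
  throughout is that a flip must not join adjacent vertices. If the ends of a planned diagonal are
  adjacent, they form a 3-cycle with the vertex between them, so most such cases are refuted by
  facts on insides of 3-cycles, or avoided by another diagonal. The smaller 4-PPT left after peeling
  is never made a structure of its own: its outside is a frozen dart set \<open>K\<close>, and all
  flips happen in the given 4-PPT. 3-cycles whose inside reaches into \<open>K\<close> are excluded
  through the last clause of \<open>enclosed\<close>. The constant is 12 = 2 * (1 + 5): at most n *
  n flips bring the triangle to the outer face, each of at most n layers costs at most 5 * n flips,
  and this is done for both given 4-PPTs.\<close>

abbreviation xor_set :: "'a set \<Rightarrow> 'a set \<Rightarrow> 'a set" where
  "xor_set X Y \<equiv> (X - Y) \<union> (Y - X)"

lemma odd_card_xor:
  assumes "finite X" "finite Y"
  shows "odd (card (xor_set X Y)) \<longleftrightarrow> odd (card X) \<noteq> odd (card Y)"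
proof -
  have 1: "card (xor_set X Y) = card (X - Y) + card (Y - X)"
    using assms by (intro card_Un_disjoint) auto
  have 2: "card X = card (X - Y) + card (X \<inter> Y)"
    using assms by (subst card_Un_disjoint[symmetric]) (auto intro: arg_cong[where f=card])
  have 3: "card Y = card (Y - X) + card (X \<inter> Y)"
    using assms by (subst card_Un_disjoint[symmetric]) (auto intro: arg_cong[where f=card])
  show ?thesis unfolding 1 2 3 by auto
qed

lemma odd_card_Int_xor:
  assumes "finite f"
  shows "odd (card (f \<inter> xor_set X Y)) \<longleftrightarrow> odd (card (f \<inter> X)) \<noteq> odd (card (f \<inter> Y))"
proof -
  have "f \<inter> xor_set X Y = xor_set (f \<inter> X) (f \<inter> Y)" by auto
  then show ?thesis using odd_card_xor[of "f \<inter> X" "f \<inter> Y"] assms by simp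
qed

text \<open>Rank and nullity over the two-element field, stated in cardinalities: adding a fixed
  \<open>X0\<close> with \<open>h X0 = y\<close> is a bijection from the kernel to the fibre over
  \<open>y\<close>.\<close>

lemma card_kernel_mult_card_image:
  fixes h :: "'a set \<Rightarrow> 'b set"
  assumes fin: "finite P"
    and closed: "\<And>X Y. X \<in> P \<Longrightarrow> Y \<in> P \<Longrightarrow> xor_set X Y \<in> P"
    and hom: "\<And>X Y. X \<in> P \<Longrightarrow> Y \<in> P \<Longrightarrow> h (xor_set X Y) = xor_set (h X) (h Y)"
  shows "card P = card {X \<in> P. h X = {}} * card (h ` P)"
proof -
  let ?K = "{X \<in> P. h X = {}}"
  have fib: "card {X \<in> P. h X = y} = card ?K" if y: "y \<in> h ` P" for y
  proof -
    obtain X0 where X0: "X0 \<in> P" "h X0 = y" using y by blast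
    have "bij_betw (\<lambda>X. xor_set X X0) ?K {X \<in> P. h X = y}"
    proof (rule bij_betw_byWitness[where f' = "\<lambda>X. xor_set X X0"])
      show "\<forall>X\<in>?K. xor_set (xor_set X X0) X0 = X" by auto
      show "\<forall>X\<in>{X \<in> P. h X = y}. xor_set (xor_set X X0) X0 = X" by auto
      show "(\<lambda>X. xor_set X X0) ` ?K \<subseteq> {X \<in> P. h X = y}"
      proof (intro subsetI)
        fix Y assume "Y \<in> (\<lambda>X. xor_set X X0) ` ?K"
        then obtain X where X: "X \<in> P" "h X = {}" "Y = xor_set X X0" by auto
        have "h Y = xor_set {} y" unfolding X(3) hom[OF X(1) X0(1)] X(2) X0(2) ..
        then show "Y \<in> {X \<in> P. h X = y}"
          using closed[OF X(1) X0(1)] unfolding X(3) by blast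
      qed
      show "(\<lambda>X. xor_set X X0) ` {X \<in> P. h X = y} \<subseteq> ?K"
      proof (intro subsetI)
        fix Y assume "Y \<in> (\<lambda>X. xor_set X X0) ` {X \<in> P. h X = y}"
        then obtain X where X: "X \<in> P" "h X = y" "Y = xor_set X X0" by auto
        have "h Y = xor_set y y" unfolding X(3) hom[OF X(1) X0(1)] X(2) X0(2) ..
        then show "Y \<in> ?K"
          using closed[OF X(1) X0(1)] unfolding X(3) by blast
      qed
    qed
    then show ?thesis by (rule bij_betw_same_card[symmetric])
  qed
  have "(\<Union>y\<in>h ` P. {X \<in> P. h X = y}) = P" by blast
  then have "card P = card (\<Union>y\<in>h ` P. {X \<in> P. h X = y})" by (rule arg_cong[OF sym])
  also have "\<dots> = (\<Sum>y\<in>h ` P. card {X \<in> P. h X = y})"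
    by (intro card_UN_disjoint) (use fin in auto)
  also have "\<dots> = (\<Sum>y\<in>h ` P. card ?K)" using fib by (intro sum.cong) auto
  finally show ?thesis by simp
qed

lemma sym_card:
  fixes W :: "(nat \<times> nat) set"
  assumes "finite W" "sym W" "\<And>x. (x, x) \<notin> W"
  shows "card W = 2 * card {(u, v) \<in> W. u < v}"
proof -
  let ?L = "{(u, v) \<in> W. u < v}" and ?U = "{(u, v) \<in> W. v < u}"
  have W: "W = ?L \<union> ?U" using assms(3) by (auto) (metis nat_neq_iff)
  have "?U = prod.swap ` ?L"
  proof (intro equalityI subsetI)
    fix d assume "d \<in> ?U"
    then show "d \<in> prod.swap ` ?L"
      using assms(2) by (intro image_eqI[of _ _ "prod.swap d"]) (auto dest: symD)
  qed (use assms(2) in \<open>auto dest: symD\<close>)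
  then have U: "card ?U = card ?L" by (simp add: card_image)
  have "card (?L \<union> ?U) = card ?L + card ?U"
    using assms(1) by (intro card_Un_disjoint) (auto intro: rev_finite_subset[of W])
  moreover have "card W = card (?L \<union> ?U)" using W by (rule arg_cong)
  ultimately show ?thesis using U by linarith
qed

text \<open>Edge sets are encoded as symmetric dart sets. Such a set is determined by its darts
  \<open>(u, v)\<close> with \<open>u < v\<close>, and these can be chosen freely.\<close>

lemma card_sym_subsets:
  fixes W :: "(nat \<times> nat) set"
  assumes "finite W" "sym W" "\<And>x. (x, x) \<notin> W"
  shows "card {X. X \<subseteq> W \<and> sym X} = 2 ^ (card W div 2)"
proof -
  let ?L = "{(u, v) \<in> W. u < v}"
  have "bij_betw (\<lambda>X. X \<inter> ?L) {X. X \<subseteq> W \<and> sym X} (Pow ?L)"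
  proof (rule bij_betw_byWitness[where f' = "\<lambda>Y. Y \<union> prod.swap ` Y"])
    show "\<forall>X\<in>{X. X \<subseteq> W \<and> sym X}. X \<inter> ?L \<union> prod.swap ` (X \<inter> ?L) = X"
    proof (intro ballI equalityI subsetI)
      fix X d assume X: "X \<in> {X. X \<subseteq> W \<and> sym X}" and d: "d \<in> X"
      obtain u v where uv: "d = (u, v)" by (cases d)
      have "u \<noteq> v" using X d uv assms(3) by auto
      then consider "u < v" | "v < u" by linarith
      then show "d \<in> X \<inter> ?L \<union> prod.swap ` (X \<inter> ?L)"
      proof cases
        case 1 then show ?thesis using X d uv by auto
      next
        case 2
        have "(v, u) \<in> X" using X d uv by (auto dest: symD)
        then have "(v, u) \<in> X \<inter> ?L" using 2 X by auto
        then have "prod.swap (v, u) \<in> prod.swap ` (X \<inter> ?L)" by (rule imageI)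
        then show ?thesis using uv by simp
      qed
    qed (auto dest: symD)
    show "\<forall>Y\<in>Pow ?L. (Y \<union> prod.swap ` Y) \<inter> ?L = Y" by auto
    show "(\<lambda>X. X \<inter> ?L) ` {X. X \<subseteq> W \<and> sym X} \<subseteq> Pow ?L" by auto
    show "(\<lambda>Y. Y \<union> prod.swap ` Y) ` Pow ?L \<subseteq> {X. X \<subseteq> W \<and> sym X}"
    proof (intro subsetI)
      fix X assume "X \<in> (\<lambda>Y. Y \<union> prod.swap ` Y) ` Pow ?L"
      then obtain Y where Y: "Y \<subseteq> ?L" "X = Y \<union> prod.swap ` Y" by auto
      have "prod.swap ` Y \<subseteq> W" using Y(1) assms(2) by (auto dest: symD)
      moreover have "sym X" unfolding Y(2) by (force intro!: symI)
      ultimately show "X \<in> {X. X \<subseteq> W \<and> sym X}" using Y by auto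
    qed
  qed
  then have "card {X. X \<subseteq> W \<and> sym X} = card (Pow ?L)" by (rule bij_betw_same_card)
  moreover have "finite ?L" using assms(1) by (rule rev_finite_subset) auto
  ultimately show ?thesis using sym_card[OF assms] by (simp add: card_Pow)
qed

lemma sym_xor: "sym X \<Longrightarrow> sym Y \<Longrightarrow> sym (xor_set X Y)"
  by (auto simp: sym_def)

text \<open>Even parity decides whether \<open>f0\<close> belongs to a set once the rest of the set
  is known, so removing \<open>f0\<close> is injective on even sets.\<close>

lemma card_even_subsets_le:
  assumes "finite F" "f0 \<in> F" "H \<subseteq> {Y. Y \<subseteq> F \<and> even (card Y)}"
  shows "card H \<le> 2 ^ (card F - 1)"
proof -
  have inj: "inj_on (\<lambda>Y. Y - {f0}) H"
  proof (rule inj_onI)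
    fix Y Z assume Y: "Y \<in> H" and Z: "Z \<in> H" and eq: "Y - {f0} = Z - {f0}"
    have fin: "finite Y" "finite Z" using Y Z assms by (auto intro: finite_subset)
    have ev: "even (card Y)" "even (card Z)" using Y Z assms by auto
    have "xor_set Y Z \<subseteq> {f0}" using eq by auto
    then have "xor_set Y Z = {} \<or> xor_set Y Z = {f0}" by blast
    moreover have "even (card (xor_set Y Z))" using odd_card_xor[OF fin] ev by blast
    ultimately have "xor_set Y Z = {}" by (metis card.empty card_insert_disjoint empty_iff finite.emptyI odd_one One_nat_def)
    then show "Y = Z" by blast
  qed
  have "(\<lambda>Y. Y - {f0}) ` H \<subseteq> Pow (F - {f0})" using assms(3) by auto
  then have "card ((\<lambda>Y. Y - {f0}) ` H) \<le> card (Pow (F - {f0}))"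
    using assms(1) by (intro card_mono) auto
  then show ?thesis using inj assms by (simp add: card_image card_Pow)
qed

section \<open>Plane maps\<close>

text \<open>Two iterates coincide by finiteness, and injectivity cancels their common part. Hence
  orbits of \<open>fnext\<close> are cycles, without a preperiod.\<close>

lemma funpow_return:
  assumes "finite D" "f ` D \<subseteq> D" "inj_on f D" "d \<in> D"
  obtains k where "k > 0" "(f ^^ k) d = d"
proof -
  have st: "(f ^^ i) x \<in> D" if "x \<in> D" for i x
    using that assms(2) by (induction i) auto
  have cancel: "(f ^^ i) x = (f ^^ i) y \<Longrightarrow> x = y" if "x \<in> D" "y \<in> D" for i x y
    using that
  proof (induction i)
    case (Suc i)
    then have "(f ^^ i) x = (f ^^ i) y" using assms(3) st by (auto dest: inj_onD)
    then show ?case using Suc by auto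
  qed auto
  have "range (\<lambda>k. (f ^^ k) d) \<subseteq> D" using st assms(4) by auto
  then have "finite (range (\<lambda>k. (f ^^ k) d))" using assms(1) finite_subset by blast
  then have "\<not> inj (\<lambda>k. (f ^^ k) d)" using finite_imageD by fastforce
  then obtain i j where ij: "i < j" "(f ^^ i) d = (f ^^ j) d"
    unfolding inj_def by (metis linorder_neqE_nat)
  have "(f ^^ j) d = (f ^^ i) ((f ^^ (j - i)) d)"
    using ij(1) by (metis add_diff_inverse_nat comp_apply funpow_add less_imp_not_less)
  then have "(f ^^ (j - i)) d = d" using cancel[of d "(f ^^ (j - i)) d" i] st assms(4) ij by auto
  then show ?thesis using ij(1) by (intro that[of "j - i"]) auto
qed

locale emap =
  fixes V :: "nat set" and A :: "nat \<Rightarrow> nat \<Rightarrow> bool" and r :: "nat \<Rightarrow> nat \<Rightarrow> nat"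
  assumes emb: "plane_embedding V A r"
begin

abbreviation "fc \<equiv> face_of r"
abbreviation "FF \<equiv> faces A r"
abbreviation "DA \<equiv> darts A"

lemma finV: "finite V" and A_V: "A u v \<Longrightarrow> u \<in> V" "A u v \<Longrightarrow> v \<in> V"
  and A_neq: "A u v \<Longrightarrow> u \<noteq> v" and A_sym: "A u v \<Longrightarrow> A v u"
  using emb unfolding plane_embedding_def simple_graph_def by blast+

lemma A_irr: "\<not> A u u" using A_neq by blast

lemma A_conn: "u \<in> V \<Longrightarrow> v \<in> V \<Longrightarrow> A\<^sup>*\<^sup>* u v"
  using emb unfolding plane_embedding_def connected_graph_def by blast

lemma rot_A: "A v w \<Longrightarrow> A v (r v w)"
  and rot_inj: "A v w \<Longrightarrow> A v w' \<Longrightarrow> r v w = r v w' \<Longrightarrow> w = w'"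
  and rot_trans: "A v w \<Longrightarrow> A v w' \<Longrightarrow> \<exists>k. (r v ^^ k) w = w'"
  using emb A_V unfolding plane_embedding_def rotation_system_def by blast+

lemma euler: "int (card V) - int (card DA div 2) + int (card FF) = 2"
  using emb unfolding plane_embedding_def by blast

lemma in_DA [simp]: "(u, v) \<in> DA \<longleftrightarrow> A u v" by (simp add: darts_def)

lemma finD: "finite DA"
  by (rule finite_subset[of _ "V \<times> V"]) (use finV A_V in \<open>auto simp: darts_def\<close>)

lemma DA_sym: "sym DA" unfolding sym_def in_DA using A_sym by blast

lemma fn_in: "d \<in> DA \<Longrightarrow> fnext r d \<in> DA"
  by (cases d) (simp add: fnext_def rot_A A_sym)

lemma fn_inj: "inj_on (fnext r) DA"
  by (rule inj_onI) (clarsimp simp: fnext_def darts_def, metis A_sym rot_inj)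

lemma funpow_in: "d \<in> DA \<Longrightarrow> (fnext r ^^ k) d \<in> DA"
  by (induction k) (auto intro: fn_in)

lemma fc_sub: "d \<in> DA \<Longrightarrow> fc d \<subseteq> DA"
  unfolding face_of_def by (intro image_subsetI funpow_in)

lemma fc_self: "d \<in> fc d"
  unfolding face_of_def by (metis funpow_0 rangeI)

lemma fc_funpow: assumes "d \<in> DA" shows "fc ((fnext r ^^ k) d) = fc d"
proof -
  obtain m where m: "m > 0" "(fnext r ^^ m) d = d"
    using funpow_return[OF finD _ fn_inj assms] fn_in by blast
  have per: "(fnext r ^^ (m * j)) d = d" for j
    by (induction j) (auto simp: funpow_add m)
  have "fc d \<subseteq> fc ((fnext r ^^ k) d)"
  proof
    fix e assume "e \<in> fc d"
    then obtain i where i: "e = (fnext r ^^ i) d" by (auto simp: face_of_def)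
    have "e = (fnext r ^^ i) ((fnext r ^^ (m * k)) d)" using per i by simp
    also have "\<dots> = (fnext r ^^ (i + m * k)) d" by (simp add: funpow_add)
    also have "i + m * k = (i + (m * k - k)) + k" using m(1) by (cases m) auto
    also have "(fnext r ^^ \<dots>) d = (fnext r ^^ (i + (m * k - k))) ((fnext r ^^ k) d)"
      by (simp add: funpow_add)
    finally show "e \<in> fc ((fnext r ^^ k) d)" by (auto simp: face_of_def)
  qed
  moreover have "fc ((fnext r ^^ k) d) \<subseteq> fc d"
    by (auto simp: face_of_def) (metis comp_apply funpow_add rangeI)
  ultimately show ?thesis by auto
qed

lemma fc_eq: assumes "d \<in> DA" "e \<in> fc d" shows "fc e = fc d"
proof -
  obtain k where "e = (fnext r ^^ k) d" using assms(2) unfolding face_of_def by (rule rangeE)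
  then show ?thesis using fc_funpow[OF assms(1)] by simp
qed

lemma fc_fn: "d \<in> DA \<Longrightarrow> fc (fnext r d) = fc d"
  using fc_funpow[of d 1] by simp

lemma fc_FF [intro]: "d \<in> DA \<Longrightarrow> fc d \<in> FF" by (auto simp: faces_def)

lemma FF_fc: "f \<in> FF \<Longrightarrow> d \<in> f \<Longrightarrow> f = fc d"
  unfolding faces_def using fc_eq by (elim imageE) simp

lemma FF_sub: "f \<in> FF \<Longrightarrow> f \<subseteq> DA" unfolding faces_def using fc_sub by (elim imageE) simp

lemma FF_mem: "f \<in> FF \<Longrightarrow> d \<in> DA \<Longrightarrow> d \<in> f \<longleftrightarrow> f = fc d"
  by (metis FF_fc fc_self)

lemma FF_fin: "f \<in> FF \<Longrightarrow> finite f" using finite_subset[OF FF_sub finD] .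

lemma FF_fn: assumes "f \<in> FF" "d \<in> f" shows "fnext r d \<in> f"
proof -
  have "d \<in> DA" using FF_sub assms by blast
  then show ?thesis using fc_self[of "fnext r d"] fc_fn FF_fc[OF assms] by simp
qed

lemma finFF: "finite FF" using finD by (simp add: faces_def)

lemma FF_disj: "f \<in> FF \<Longrightarrow> g \<in> FF \<Longrightarrow> f \<noteq> g \<Longrightarrow> f \<inter> g = {}"
  by (metis FF_fc disjoint_iff)

lemma FF_ne: "f \<in> FF \<Longrightarrow> f \<noteq> {}" unfolding faces_def using fc_self by (elim imageE) blast

lemma card_FF_sum: assumes "S \<subseteq> FF" shows "card (\<Union>S \<inter> X) = (\<Sum>f\<in>S. card (f \<inter> X))"
proof -
  have "\<Union>S \<inter> X = (\<Union>f\<in>S. f \<inter> X)" by auto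
  also have "card \<dots> = (\<Sum>f\<in>S. card (f \<inter> X))"
  proof (rule card_UN_disjoint)
    show "finite S" using assms finFF by (rule finite_subset)
    show "\<forall>f\<in>S. finite (f \<inter> X)" using assms FF_fin by auto
    show "\<forall>f\<in>S. \<forall>g\<in>S. f \<noteq> g \<longrightarrow> f \<inter> X \<inter> (g \<inter> X) = {}"
    proof (intro ballI impI)
      fix f g assume "f \<in> S" "g \<in> S" "f \<noteq> g"
      then have "f \<inter> g = {}" using assms by (intro FF_disj) auto
      then show "f \<inter> X \<inter> (g \<inter> X) = {}" by blast
    qed
  qed
  finally show ?thesis .
qed

lemma Union_FF: "\<Union>FF = DA"
proof
  show "\<Union>FF \<subseteq> DA" using FF_sub by (intro Union_least)
  show "DA \<subseteq> \<Union>FF" using fc_self fc_FF by (intro subsetI UnionI)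
qed

lemma fn_bij_face: "f \<in> FF \<Longrightarrow> bij_betw (fnext r) f f"
proof -
  assume f: "f \<in> FF"
  have inj: "inj_on (fnext r) f" using fn_inj FF_sub[OF f] by (rule inj_on_subset)
  have "fnext r ` f \<subseteq> f" using FF_fn[OF f] by (intro image_subsetI)
  then show ?thesis using endo_inj_surj[OF FF_fin[OF f]] inj by (simp add: bij_betw_def)
qed

lemma face_iff: assumes "d \<in> DA" "fnext r d \<in> f" "f \<in> FF" shows "d \<in> f"
  using FF_fc[OF assms(3,2)] fc_fn[OF assms(1)] fc_self[of d] by simp

text \<open>Adjacency in the dual graph when only the edges of \<open>W\<close> may be crossed. With
  \<open>W\<close> the complement of a cycle, its components are the sides of the cycle.\<close>

definition cr :: "(nat \<times> nat) set \<Rightarrow> (nat \<times> nat) set \<Rightarrow> (nat \<times> nat) set \<Rightarrow> bool" where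
  "cr W f g \<longleftrightarrow> (\<exists>x y. (x, y) \<in> W \<and> f = fc (x, y) \<and> g = fc (y, x))"

text \<open>\<open>X\<close> is the sum modulo two of the edges crossed by the dual path: an
  intermediate face is entered and left, so only the two ends keep an odd count. An edge with the
  same face on both sides contributes two darts and changes no parity.\<close>

lemma path_parity:
  assumes "(cr W)\<^sup>*\<^sup>* f g" "W \<subseteq> DA" "sym W"
  shows "\<exists>X\<subseteq>W. sym X \<and> (\<forall>h\<in>FF. odd (card (h \<inter> X)) \<longleftrightarrow> (h = f) \<noteq> (h = g))"
  using assms(1)
proof (induction rule: rtranclp_induct)
  case base
  show ?case by (rule exI[of _ "{}"]) auto
next
  case (step g g')
  obtain X where X: "X \<subseteq> W" "sym X"
    "\<forall>h\<in>FF. odd (card (h \<inter> X)) \<longleftrightarrow> (h = f) \<noteq> (h = g)" using step.IH by auto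
  obtain x y where xy: "(x, y) \<in> W" "g = fc (x, y)" "g' = fc (y, x)"
    using step.hyps(2) by (auto simp: cr_def)
  let ?E = "{(x, y), (y, x)}"
  have W: "?E \<subseteq> W" using xy assms(3) by (auto simp: sym_def)
  have ne: "x \<noteq> y" using xy assms(2) A_irr by auto
  have inE: "(x, y) \<in> DA" "(y, x) \<in> DA" using W assms(2) by auto
  have E: "odd (card (h \<inter> ?E)) \<longleftrightarrow> (h = g) \<noteq> (h = g')" if "h \<in> FF" for h
  proof -
    have "h \<inter> ?E = (if h = g then {(x, y)} else {}) \<union> (if h = g' then {(y, x)} else {})"
      using FF_mem[OF that inE(1)] FF_mem[OF that inE(2)] xy by auto
    then show ?thesis using ne by (auto split: if_splits)
  qed
  have "odd (card (h \<inter> xor_set X ?E)) \<longleftrightarrow> (h = f) \<noteq> (h = g')" if "h \<in> FF" for h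
    using odd_card_Int_xor[OF FF_fin[OF that], of X ?E] X(3) E[OF that] that by auto
  moreover have "xor_set X ?E \<subseteq> W" using X W by auto
  moreover have "sym (xor_set X ?E)" by (rule sym_xor) (use X in \<open>auto simp: sym_def\<close>)
  ultimately show ?case by blast
qed

lemma cr_sym: assumes "sym W" "cr W f g" shows "cr W g f"
proof -
  obtain x y where xy: "(x, y) \<in> W" "f = fc (x, y)" "g = fc (y, x)"
    using assms(2) unfolding cr_def by blast
  have "(y, x) \<in> W" using assms(1) xy(1) by (rule symD)
  then show ?thesis unfolding cr_def using xy by blast
qed

lemma cr_rtr_sym: assumes "sym W" "(cr W)\<^sup>*\<^sup>* f g" shows "(cr W)\<^sup>*\<^sup>* g f"
  using assms(2)
proof (induction rule: rtranclp_induct)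
  case (step g h)
  show ?case using cr_sym[OF assms(1) step.hyps(2)] step.IH by (rule converse_rtranclp_into_rtranclp)
qed simp

lemma cr_rot: assumes "A v x" "(v, r v x) \<in> W" shows "cr W (fc (x, v)) (fc (r v x, v))"
proof -
  have "(x, v) \<in> DA" using A_sym[OF assms(1)] by simp
  then have "fc (x, v) = fc (v, r v x)" using fc_fn[of "(x, v)"] by (simp add: fnext_def)
  then show ?thesis unfolding cr_def using assms(2) by blast
qed

text \<open>Turning around a vertex crosses its edges one after the other and so connects all faces
  at that vertex; connectivity of the graph carries this from vertex to vertex.\<close>

lemma dual_connected:
  assumes "f \<in> FF" "g \<in> FF"
  shows "(cr DA)\<^sup>*\<^sup>* f g"
proof -
  have rotk: "(cr DA)\<^sup>*\<^sup>* (fc (x, v)) (fc ((r v ^^ k) x, v)) \<and> A v ((r v ^^ k) x)" if "A v x" for v x k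
  proof (induction k)
    case (Suc k)
    then show ?case using rot_A[of v "(r v ^^ k) x"] cr_rot[of v "(r v ^^ k) x" DA]
      by (auto intro: rtranclp.rtrancl_into_rtrancl)
  qed (use that in auto)
  have around: "(cr DA)\<^sup>*\<^sup>* (fc (x, v)) (fc (y, v))" if "A v x" "A v y" for v x y
    using rot_trans[OF that] rotk[OF that(1)] by metis
  have main: "\<forall>x y. A v x \<longrightarrow> A u y \<longrightarrow> (cr DA)\<^sup>*\<^sup>* (fc (x, v)) (fc (y, u))" if "A\<^sup>*\<^sup>* v u" for v u
    using that
  proof (induction rule: rtranclp_induct)
    case base then show ?case using around by auto
  next
    case (step u t)
    show ?case
    proof (intro allI impI)
      fix x y assume "A v x" "A t y"
      have 1: "(cr DA)\<^sup>*\<^sup>* (fc (x, v)) (fc (t, u))" using step \<open>A v x\<close> by auto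
      have 2: "cr DA (fc (t, u)) (fc (u, t))" using step A_sym unfolding cr_def in_DA by blast
      have 3: "(cr DA)\<^sup>*\<^sup>* (fc (u, t)) (fc (y, t))" using around step A_sym \<open>A t y\<close> by blast
      show "(cr DA)\<^sup>*\<^sup>* (fc (x, v)) (fc (y, t))" using 1 2 3 by (meson rtranclp.rtrancl_into_rtrancl rtranclp_trans)
    qed
  qed
  obtain x v where 1: "A x v" "f = fc (x, v)" using assms by (auto simp: faces_def darts_def)
  obtain y u where 2: "A y u" "g = fc (y, u)" using assms by (auto simp: faces_def darts_def)
  show ?thesis using main[OF A_conn[of v u]] 1 2 A_V A_sym by blast
qed

section \<open>Cuts and even edge sets\<close>

definition cut :: "nat set \<Rightarrow> (nat \<times> nat) set" where
  "cut p = {(u, v). A u v \<and> (u \<in> p) \<noteq> (v \<in> p)}"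

text \<open>A face is a closed walk and crosses the border of \<open>p\<close> an even number of
  times. In counts: \<open>fnext\<close> maps the darts of the face that end in \<open>p\<close>
  bijectively to those that start in \<open>p\<close>.\<close>

lemma cut_even: assumes f: "f \<in> FF" shows "even (card (f \<inter> cut p))"
proof -
  have fin: "finite f" using FF_fin f by blast
  let ?a = "{d\<in>f. fst d \<in> p \<and> snd d \<notin> p}" and ?b = "{d\<in>f. fst d \<notin> p \<and> snd d \<in> p}"
  let ?c = "{d\<in>f. fst d \<in> p \<and> snd d \<in> p}"
  have "bij_betw (fnext r) {d\<in>f. snd d \<in> p} {d\<in>f. fst d \<in> p}"
  proof -
    have im: "fnext r ` f = f" using fn_bij_face[OF f] by (simp add: bij_betw_def)
    have "fnext r ` {d\<in>f. snd d \<in> p} = {d\<in>f. fst d \<in> p}"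
    proof (intro equalityI subsetI)
      fix e assume e: "e \<in> {d\<in>f. fst d \<in> p}"
      then obtain d where "d \<in> f" "e = fnext r d" using im by (metis (lifting) imageE mem_Collect_eq)
      then show "e \<in> fnext r ` {d\<in>f. snd d \<in> p}" using e by (auto simp: fnext_def)
    qed (use FF_fn[OF f] in \<open>auto simp: fnext_def\<close>)
    moreover have "inj_on (fnext r) {d\<in>f. snd d \<in> p}"
      using fn_bij_face[OF f] by (auto simp: bij_betw_def inj_on_def)
    ultimately show ?thesis by (simp add: bij_betw_def)
  qed
  then have "card {d\<in>f. snd d \<in> p} = card {d\<in>f. fst d \<in> p}" by (rule bij_betw_same_card)
  moreover have "card {d\<in>f. snd d \<in> p} = card ?b + card ?c"
    using fin by (subst card_Un_disjoint[symmetric]) (auto intro: arg_cong[where f=card])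
  moreover have "card {d\<in>f. fst d \<in> p} = card ?a + card ?c"
    using fin by (subst card_Un_disjoint[symmetric]) (auto intro: arg_cong[where f=card])
  moreover have "card (f \<inter> cut p) = card ?a + card ?b"
    using fin FF_sub[OF f] by (subst card_Un_disjoint[symmetric])
      (auto simp: cut_def darts_def intro!: arg_cong[where f=card])
  ultimately show ?thesis by simp
qed

text \<open>By connectivity a cut determines its vertex set up to complement; leaving out
  \<open>v0\<close> selects one of the two.\<close>

lemma cut_inj: assumes "v0 \<in> V" shows "inj_on cut (Pow (V - {v0}))"
proof (rule inj_onI)
  fix p q assume p: "p \<in> Pow (V - {v0})" and q: "q \<in> Pow (V - {v0})" and eq: "cut p = cut q"
  have e: "(u \<in> p) = (u \<in> q) \<longleftrightarrow> (v \<in> p) = (v \<in> q)" if "A u v" for u v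
    using that eq unfolding cut_def set_eq_iff by auto
  have "(v \<in> p) = (v \<in> q)" if "A\<^sup>*\<^sup>* v0 v" for v using that
    by (induction rule: rtranclp_induct) (use e p q in auto)
  then show "p = q" using p q A_conn[OF assms] by blast
qed

text \<open>\<open>H\<^sup>1 = 0\<close> over the two-element field.  The map sending an edge set to the faces it meets in an
  odd number of darts has an image of size \<open>2 ^ (card FF - 1)\<close>, as the dual graph is connected; so
  by Euler's formula its kernel has size \<open>2 ^ (card V - 1)\<close>, which is the number of cuts.\<close>

lemma even_is_cut:
  assumes X: "X \<subseteq> DA" "sym X" and ev: "\<And>f. f \<in> FF \<Longrightarrow> even (card (f \<inter> X))"
  shows "\<exists>p. X = cut p"
proof (cases "DA = {}")
  case True
  then show ?thesis using X by (auto simp: cut_def darts_def intro!: exI[of _ "{}"])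
next
  case False
  then obtain d0 where d0: "d0 \<in> DA" by auto
  define f0 where "f0 = fc d0"
  have f0: "f0 \<in> FF" using d0 by (auto simp: f0_def)
  define v0 where "v0 = fst d0"
  have v0: "v0 \<in> V" using d0 A_V by (cases d0) (auto simp: v0_def)
  let ?P = "{X. X \<subseteq> DA \<and> sym X}"
  let ?h = "\<lambda>X. {f\<in>FF. odd (card (f \<inter> X))}"
  define K where "K = {X\<in>?P. ?h X = {}}"
  have finP: "finite ?P" using finD by (rule_tac finite_subset[of _ "Pow DA"]) auto
  have c1: "card ?P = card K * card (?h ` ?P)" unfolding K_def
  proof (rule card_kernel_mult_card_image[OF finP])
    fix X Y assume XY: "X \<in> ?P" "Y \<in> ?P"
    have "sym (xor_set X Y)" using XY by (intro sym_xor) simp_all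
    then show "xor_set X Y \<in> ?P" using XY by blast
    show "?h (xor_set X Y) = xor_set (?h X) (?h Y)"
      using odd_card_Int_xor[OF FF_fin, of _ X Y] by blast
  qed
  have c2: "card ?P = 2 ^ (card DA div 2)"
    by (rule card_sym_subsets) (use finD DA_sym A_irr in auto)
  \<comment> \<open>Every set of faces without \<open>f0\<close> occurs as an odd set: for each of
    its faces add the edges crossed by a dual path from \<open>f0\<close>. The parity at
    \<open>f0\<close> itself is ignored.\<close>
  have c3: "2 ^ (card FF - 1) \<le> card (?h ` ?P)"
  proof -
    have ex: "\<exists>X\<in>?P. ?h X - {f0} = Y" if "Y \<subseteq> FF - {f0}" for Y
    proof -
      have "finite Y" using that finFF finite_subset by blast
      then show ?thesis using that
      proof (induction Y)
        case empty
        show ?case by (rule bexI[of _ "{}"]) auto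
      next
        case (insert g Y)
        then obtain X where X: "X \<in> ?P" "?h X - {f0} = Y" by auto
        obtain Z where Z: "Z \<subseteq> DA" "sym Z" "\<forall>h\<in>FF. odd (card (h \<inter> Z)) \<longleftrightarrow> (h = f0) \<noteq> (h = g)"
          using path_parity[OF dual_connected[OF f0, of g] _ DA_sym] insert.prems by auto
        have "?h (xor_set X Z) - {f0} = insert g Y"
        proof (intro set_eqI)
          fix f
          show "f \<in> ?h (xor_set X Z) - {f0} \<longleftrightarrow> f \<in> insert g Y"
            using odd_card_Int_xor[OF FF_fin, of f X Z] Z(3) X(2) insert.prems insert.hyps
            by (cases "f \<in> FF") auto
        qed
        moreover have "sym (xor_set X Z)" using X(1) Z(2) by (intro sym_xor) simp_all
        then have "xor_set X Z \<in> ?P" using X(1) Z(1) by blast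
        ultimately show ?case by (intro bexI)
      qed
    qed
    have "Pow (FF - {f0}) \<subseteq> (\<lambda>Z. Z - {f0}) ` ?h ` ?P"
    proof
      fix Y assume "Y \<in> Pow (FF - {f0})"
      then have "Y \<subseteq> FF - {f0}" by (rule PowD)
      from ex[OF this] obtain X where X: "X \<in> ?P" "?h X - {f0} = Y" by (rule bexE)
      show "Y \<in> (\<lambda>Z. Z - {f0}) ` ?h ` ?P" unfolding X(2)[symmetric] by (intro imageI X(1))
    qed
    then have "card (Pow (FF - {f0})) \<le> card ((\<lambda>Z. Z - {f0}) ` ?h ` ?P)"
      by (intro card_mono finite_imageI finP)
    also have "\<dots> \<le> card (?h ` ?P)" by (intro card_image_le finite_imageI finP)
    finally have "card (Pow (FF - {f0})) \<le> card (?h ` ?P)" .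
    moreover have "card (Pow (FF - {f0})) = 2 ^ (card FF - 1)" using f0 finFF by (simp add: card_Pow)
    ultimately show ?thesis by metis
  qed
  have c4: "card DA div 2 = (card V - 1) + (card FF - 1)"
  proof -
    have "card V > 0" "card FF > 0" using v0 f0 finV finFF card_gt_0_iff by blast+
    then show ?thesis using euler by linarith
  qed
  have "card K * 2 ^ (card FF - 1) \<le> card K * card (?h ` ?P)" using c3 by (rule mult_le_mono2)
  also have "\<dots> = 2 ^ (card DA div 2)" using c1 c2 by metis
  also have "\<dots> = 2 ^ (card V - 1) * 2 ^ (card FF - 1)" unfolding c4 by (rule power_add)
  finally have "card K * 2 ^ (card FF - 1) \<le> 2 ^ (card V - 1) * 2 ^ (card FF - 1)" .
  then have "card K \<le> 2 ^ (card V - 1)" by simp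
  also have "\<dots> = card (Pow (V - {v0}))"
    using v0 finV by (simp add: card_Pow)
  also have "\<dots> = card (cut ` Pow (V - {v0}))" using card_image[OF cut_inj[OF v0]] by simp
  finally have "card K \<le> card (cut ` Pow (V - {v0}))" .
  moreover have "cut ` Pow (V - {v0}) \<subseteq> K"
  proof (intro subsetI)
    fix X assume "X \<in> cut ` Pow (V - {v0})"
    then obtain p where X: "X = cut p" by blast
    have "sym (cut p)" 
    proof (rule symI)
      fix u v assume "(u, v) \<in> cut p"
      then have "A u v" "(u \<in> p) \<noteq> (v \<in> p)" by (simp_all add: cut_def)
      then show "(v, u) \<in> cut p" using A_sym[of u v] by (simp add: cut_def)
    qed
    moreover have "cut p \<subseteq> DA" by (auto simp: cut_def)
    ultimately show "X \<in> K" unfolding K_def X using cut_even by simp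
  qed
  moreover have "finite K" unfolding K_def using finP by (rule rev_finite_subset) blast
  ultimately have "cut ` Pow (V - {v0}) = K" using card_seteq by metis
  moreover have "X \<in> K" unfolding K_def using X ev by blast
  ultimately have "X \<in> cut ` Pow (V - {v0})" by metis
  then show ?thesis by blast
qed

end

section \<open>The triangle and the 3-cycles around it\<close>

locale ppt =
  fixes T :: cppt
  assumes four: "four_ppt T" and card_outer: "card (outer T) = 3"

sublocale ppt \<subseteq> emap "verts T" "adj T" "rot T"
  using four by unfold_locales (simp add: four_ppt_def comb_pt_def)

context ppt
begin

abbreviation "A \<equiv> adj T"
abbreviation "r \<equiv> rot T"

lemma outer_FF: "outer T \<in> FF"
  and outer_reflex: "d \<in> outer T \<Longrightarrow> reflex T d"
  and int_convex: "f \<in> FF \<Longrightarrow> f \<noteq> outer T \<Longrightarrow> card {d\<in>f. \<not> reflex T d} = 3"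
  and int_card: "f \<in> FF \<Longrightarrow> f \<noteq> outer T \<Longrightarrow> card f = 3 \<or> card f = 4"
  using four by (auto simp: four_ppt_def comb_pt_def interior_faces_def)

lemma reflex_one: "v \<in> verts T \<Longrightarrow> card {d\<in>DA. snd d = v \<and> reflex T d} = 1"
  using four by (auto simp: four_ppt_def pointed_def)

lemma reflex_set: assumes "v \<in> verts T" obtains e where "{d\<in>DA. snd d = v \<and> reflex T d} = {e}"
  using card_1_singletonE[OF reflex_one[OF assms]] .

lemma reflex_unique:
  assumes "A x v" "A y v" "reflex T (x, v)" "reflex T (y, v)" shows "x = y"
proof -
  obtain e where e: "{d\<in>DA. snd d = v \<and> reflex T d} = {e}"
    using reflex_set A_V(2)[OF assms(1)] .
  have "(x, v) \<in> {d\<in>DA. snd d = v \<and> reflex T d}" "(y, v) \<in> {d\<in>DA. snd d = v \<and> reflex T d}"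
    using assms by auto
  then show ?thesis unfolding e by auto
qed

lemma reflex_ex: assumes "v \<in> verts T" shows "\<exists>x. A x v \<and> reflex T (x, v)"
proof -
  obtain e where "{d\<in>DA. snd d = v \<and> reflex T d} = {e}" using reflex_set[OF assms] .
  then have "e \<in> {d\<in>DA. snd d = v \<and> reflex T d}" by (simp only: singletonI)
  then show ?thesis by (cases e) auto
qed

abbreviation "RR \<equiv> {d. reflex T d}"

lemma int_reflex_card: assumes "f \<in> FF" "f \<noteq> outer T" shows "card f = card (f \<inter> RR) + 3"
proof -
  have "card f = card (f \<inter> RR) + card {d\<in>f. \<not> reflex T d}"
    using FF_fin[OF assms(1)] by (subst card_Un_disjoint[symmetric]) (auto intro: arg_cong[where f=card])
  then show ?thesis using int_convex[OF assms] by simp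
qed

lemma tri_no_reflex: assumes "f \<in> FF" "f \<noteq> outer T" "card f = 3" "d \<in> f" shows "\<not> reflex T d"
  using int_reflex_card[OF assms(1,2)] assms(3,4) FF_fin[OF assms(1)] by auto

lemma quad_reflex: assumes "f \<in> FF" "f \<noteq> outer T" "card f = 4"
  shows "\<exists>d. f \<inter> RR = {d}"
proof -
  have "card (f \<inter> RR) = 1" using int_reflex_card[OF assms(1,2)] assms(3) by simp
  then show ?thesis by (metis card_1_singletonE)
qed

lemma card_reflex: "card (DA \<inter> RR) = card (verts T)"
proof -
  have "inj_on snd (DA \<inter> RR)"
  proof (rule inj_onI)
    fix d e assume "d \<in> DA \<inter> RR" "e \<in> DA \<inter> RR" "snd d = snd e"
    then show "d = e" using reflex_unique[of "fst d" "snd d" "fst e"]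
      by (cases d, cases e) simp
  qed
  moreover have "snd ` (DA \<inter> RR) = verts T"
  proof (intro equalityI subsetI)
    fix v assume "v \<in> verts T"
    then obtain x where "A x v" "reflex T (x, v)" using reflex_ex by blast
    then show "v \<in> snd ` (DA \<inter> RR)" by (intro image_eqI[of _ _ "(x, v)"]) auto
  next
    fix v assume "v \<in> snd ` (DA \<inter> RR)"
    then obtain x where "(x, v) \<in> DA" by auto
    then show "v \<in> verts T" using A_V(2)[of x v] by simp
  qed
  ultimately show ?thesis using card_image by metis
qed

text \<open>Let I be the number of interior faces and t the number of triangles among them. Each
  interior face has three convex angles and all other angles are reflex, one per vertex, so the
  number of darts is n + 3 * I. With Euler's formula n = I + 2. Counting reflex angles by faces
  gives n = 3 + (I - t), hence t = 1.\<close>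

lemma one_triangle: "card {f\<in>FF - {outer T}. card f = 3} = 1"
proof -
  let ?I = "FF - {outer T}" and ?n = "card (verts T)"
  have fin: "finite ?I" using finFF by simp
  have s1: "card DA = (\<Sum>f\<in>FF. card f)" using card_FF_sum[of FF UNIV] Union_FF by simp
  have s2: "?n = (\<Sum>f\<in>FF. card (f \<inter> RR))" using card_FF_sum[of FF RR] Union_FF card_reflex by simp
  have o: "outer T \<inter> RR = outer T" using outer_reflex by auto
  have s1': "card DA = 3 + (\<Sum>f\<in>?I. card f)"
    using s1 sum.remove[OF finFF outer_FF, of card] card_outer by simp
  have s2': "?n = 3 + (\<Sum>f\<in>?I. card (f \<inter> RR))"
    using s2 sum.remove[OF finFF outer_FF, of "\<lambda>f. card (f \<inter> RR)"] card_outer o by simp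
  have "(\<Sum>f\<in>?I. card f) = (\<Sum>f\<in>?I. card (f \<inter> RR) + 3)"
    using int_reflex_card by (intro sum.cong) auto
  then have e1: "card DA = ?n + 3 * card ?I" using s1' s2' by (simp add: sum.distrib)
  have ev: "card DA = 2 * (card DA div 2)" proof -
    have "(a, a) \<notin> DA" for a using A_irr by simp
    then show ?thesis using sym_card[OF finD DA_sym] by presburger
  qed
  have "card FF = card ?I + 1" using card.remove[OF finFF outer_FF] by simp
  then have e2: "int ?n - int (card DA div 2) + int (card ?I) = 1" using euler by linarith
  have e3: "?n = card ?I + 2" using e1 e2 ev by linarith
  have "(\<Sum>f\<in>?I. card (f \<inter> RR)) = (\<Sum>f\<in>?I. if card f \<noteq> 3 then 1 else 0)"
  proof (rule sum.cong)
    fix f assume "f \<in> ?I"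
    then show "card (f \<inter> RR) = (if card f \<noteq> 3 then 1 else 0)"
      using int_reflex_card[of f] int_card[of f] by auto
  qed simp
  also have "\<dots> = (\<Sum>f\<in>{f\<in>?I. card f \<noteq> 3}. 1)" by (rule sum.inter_filter[symmetric, OF fin])
  also have "\<dots> = card {f\<in>?I. card f \<noteq> 3}" by simp
  finally have "?n = 3 + card {f\<in>?I. card f \<noteq> 3}" using s2' by simp
  moreover have "card ?I = card {f\<in>?I. card f = 3} + card {f\<in>?I. card f \<noteq> 3}"
    using fin by (subst card_Un_disjoint[symmetric]) (auto intro: arg_cong[where f=card])
  ultimately show ?thesis using e3 by linarith
qed

definition "Tri = (THE f. f \<in> FF \<and> f \<noteq> outer T \<and> card f = 3)"

lemma Tri_ex1: "\<exists>!f. f \<in> FF \<and> f \<noteq> outer T \<and> card f = 3"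
proof -
  obtain f where f: "{f\<in>FF - {outer T}. card f = 3} = {f}"
    using card_1_singletonE[OF one_triangle] .
  have *: "g \<in> FF \<and> g \<noteq> outer T \<and> card g = 3 \<longleftrightarrow> g = f" for g
  proof -
    have "g \<in> {f\<in>FF - {outer T}. card f = 3} \<longleftrightarrow> g \<in> {f}" unfolding f ..
    then show ?thesis by blast
  qed
  show ?thesis unfolding * by blast
qed

lemma Tri: "Tri \<in> FF" "Tri \<noteq> outer T" "card Tri = 3"
  using theI'[OF Tri_ex1] unfolding Tri_def by auto

lemma TriI: "f \<in> FF \<Longrightarrow> f \<noteq> outer T \<Longrightarrow> card f = 3 \<Longrightarrow> f = Tri"
  using ex1E[OF Tri_ex1] Tri by metis

lemma odd_face: assumes "f \<in> FF" shows "odd (card f) \<longleftrightarrow> f = Tri \<or> f = outer T"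
proof (cases "f = outer T")
  case True
  then show ?thesis using card_outer by simp
next
  case False
  then show ?thesis using int_card[OF assms False] TriI[OF assms False] Tri(3)
    by (cases "card f = 3") auto
qed

section \<open>3-cycles and their insides\<close>

definition cyc :: "nat \<Rightarrow> nat \<Rightarrow> nat \<Rightarrow> (nat \<times> nat) set" where
  "cyc x y z = {(x, y), (y, x), (y, z), (z, y), (z, x), (x, z)}"

definition three_cycle :: "nat \<Rightarrow> nat \<Rightarrow> nat \<Rightarrow> bool" where
  "three_cycle x y z \<longleftrightarrow> A x y \<and> A y z \<and> A z x"

text \<open>The side is singled out by the triangle instead of by an orientation. That it is a
  proper side is not built in; it follows from \<open>outer_not_inside\<close> and
  \<open>one_side\<close>.\<close>

definition inside :: "nat \<Rightarrow> nat \<Rightarrow> nat \<Rightarrow> (nat \<times> nat) set \<Rightarrow> bool" where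
  "inside x y z = (cr (DA - cyc x y z))\<^sup>*\<^sup>* Tri"

lemma sym_off: "sym (DA - cyc x y z)"
proof (rule symI)
  fix a b assume "(a, b) \<in> DA - cyc x y z"
  then show "(b, a) \<in> DA - cyc x y z" using A_sym[of a b] by (auto simp: cyc_def)
qed

lemma three_cycle_neq: "three_cycle x y z \<Longrightarrow> x \<noteq> y \<and> y \<noteq> z \<and> x \<noteq> z" using A_irr by (auto simp: three_cycle_def)
lemma three_cycle_edges: assumes "three_cycle x y z" shows "A x y" "A y x" "A y z" "A z y" "A z x" "A x z"
proof -
  show 1: "A x y" "A y z" "A z x" using assms by (simp_all add: three_cycle_def)
  show "A y x" "A z y" "A x z" using 1[THEN A_sym] by this+
qed

lemma inside_Tri: "inside x y z Tri" by (simp add: inside_def)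

lemma inside_step:
  assumes "inside x y z (fc (a, b))" "A a b" "(a, b) \<notin> cyc x y z"
  shows "inside x y z (fc (b, a))"
proof -
  have "cr (DA - cyc x y z) (fc (a, b)) (fc (b, a))"
    unfolding cr_def using assms(2,3) by (intro exI[of _ a] exI[of _ b]) simp
  then show ?thesis using assms(1) unfolding inside_def by (rule rtranclp.rtrancl_into_rtrancl[rotated])
qed

lemma inside_face: assumes "inside x y z f" shows "f \<in> FF"
  using assms unfolding inside_def
proof (induction rule: rtranclp_induct)
  case (step f g)
  then obtain a b where ab: "A a b" "g = fc (b, a)" by (auto simp: cr_def)
  show ?case unfolding ab(2) by (rule fc_FF) (simp add: A_sym[OF ab(1)])
qed (rule Tri)

lemma tri_cut: assumes "three_cycle x y z"
  shows "(x, y) \<in> cut p \<longleftrightarrow> ((y, z) \<in> cut p) \<noteq> ((z, x) \<in> cut p)"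
  using assms by (auto simp: cut_def three_cycle_def)

text \<open>The triangle and the outer face are the only faces of odd size. A dual path between them
  off the cycle crosses an edge set \<open>X\<close> with the same parities as the set of all edges,
  so \<open>DA - X\<close> is a cut. It contains all three edges of the cycle, whereas a cut
  contains an even number of them.\<close>

lemma outer_not_inside: assumes "three_cycle x y z" shows "\<not> inside x y z (outer T)"
proof
  assume "inside x y z (outer T)"
  then obtain X where X: "X \<subseteq> DA - cyc x y z" "sym X"
    and par: "\<forall>h\<in>FF. odd (card (h \<inter> X)) \<longleftrightarrow> (h = Tri) \<noteq> (h = outer T)"
    using path_parity[OF _ _ sym_off] unfolding inside_def by (metis Diff_subset)
  have ev: "even (card (f \<inter> (DA - X)))" if f: "f \<in> FF" for f
  proof -
    have "card f = card (f \<inter> (DA - X)) + card (f \<inter> X)"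
      using FF_fin[OF f] FF_sub[OF f] by (subst card_Un_disjoint[symmetric]) (auto intro: arg_cong[where f=card])
    then show ?thesis using par f odd_face[OF f] Tri(2) by (metis even_add)
  qed
  have sy: "sym (DA - X)"
  proof (rule symI)
    fix a b assume "(a, b) \<in> DA - X"
    then show "(b, a) \<in> DA - X" using symD[OF DA_sym, of a b] symD[OF X(2), of b a] by blast
  qed
  obtain p where p: "DA - X = cut p" using even_is_cut[OF _ sy ev] by auto
  have "(x, y) \<in> DA - X" "(y, z) \<in> DA - X" "(z, x) \<in> DA - X"
    using X(1) assms by (auto simp: cyc_def three_cycle_def)
  then show False using tri_cut[OF assms, of p] p by simp
qed

text \<open>If both faces at \<open>ab\<close> are inside, a dual path off the cycle joins them. The
  edges it crosses together with \<open>ab\<close> form an even set, hence a cut, that meets the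
  cycle in the single edge \<open>ab\<close>.\<close>

lemma one_side:
  assumes three_cycle: "three_cycle x y z" and ab: "(a, b) \<in> cyc x y z"
    and i: "inside x y z (fc (a, b))" "inside x y z (fc (b, a))"
  shows False
proof -
  have Aab: "A a b" using ab three_cycle_edges[OF three_cycle] by (auto simp: cyc_def)
  then have Aba: "A b a" by (rule A_sym)
  have FF: "fc (a, b) \<in> FF" "fc (b, a) \<in> FF" using Aab Aba by auto
  have "(cr (DA - cyc x y z))\<^sup>*\<^sup>* (fc (a, b)) (fc (b, a))"
    using cr_rtr_sym[OF sym_off] i unfolding inside_def by (meson rtranclp_trans)
  then obtain X where X: "X \<subseteq> DA - cyc x y z" "sym X"
    and par: "\<forall>h\<in>FF. odd (card (h \<inter> X)) \<longleftrightarrow> (h = fc (a, b)) \<noteq> (h = fc (b, a))"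
    using path_parity[OF _ _ sym_off] by (metis Diff_subset)
  let ?E = "{(a, b), (b, a)}"
  have cE: "odd (card (h \<inter> ?E)) \<longleftrightarrow> (h = fc (a, b)) \<noteq> (h = fc (b, a))" if h: "h \<in> FF" for h
  proof -
    have "h \<inter> ?E = (if h = fc (a, b) then {(a, b)} else {}) \<union> (if h = fc (b, a) then {(b, a)} else {})"
      using FF_mem[OF h, of "(a, b)"] FF_mem[OF h, of "(b, a)"] Aab Aba by auto
    then show ?thesis using A_neq[OF Aab] by (auto split: if_splits)
  qed
  have ev: "even (card (f \<inter> xor_set X ?E))" if f: "f \<in> FF" for f
    using odd_card_Int_xor[OF FF_fin[OF f], of X ?E] par f cE[OF f] by simp
  have sy: "sym (xor_set X ?E)" by (rule sym_xor[OF X(2)]) (auto simp: sym_def)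
  have "xor_set X ?E \<subseteq> DA" using X(1) Aab Aba by auto
  then obtain p where p: "xor_set X ?E = cut p" using even_is_cut[OF _ sy ev] by auto
  have m: "d \<in> cut p \<longleftrightarrow> d \<in> ?E" if "d \<in> cyc x y z" for d
    using that X(1) unfolding p[symmetric] by auto
  have "(x, y) \<in> ?E \<longleftrightarrow> ((y, z) \<in> ?E) \<noteq> ((z, x) \<in> ?E)"
    using tri_cut[OF three_cycle, of p] m[of "(x, y)"] m[of "(y, z)"] m[of "(z, x)"] by (simp add: cyc_def)
  then show False using ab three_cycle_neq[OF three_cycle] by (auto simp: cyc_def)
qed

text \<open>Counting: with \<open>F\<close> faces inside, at most three of whose darts are on the cycle, there are at
  least \<open>2 * F - 2\<close> inner edges.  The sets of inner edges meeting all faces evenly are cuts of sets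
  of inner vertices, so there are at least \<open>F - 1\<close> inner vertices, each of which has its reflex
  angle in one of the \<open>F - 1\<close> quadrilaterals.\<close>

lemma reflex_not_on_cycle:
  assumes three_cycle: "three_cycle x y z" and f: "inside x y z (fc (u, c))" "A u c" "reflex T (u, c)"
  shows "c \<notin> {x, y, z}"
proof
  assume c: "c \<in> {x, y, z}"
  let ?C = "cyc x y z"
  define S where "S = {f. inside x y z f}"
  define Sd where "Sd = \<Union>S"
  define W where "W = Sd - ?C"
  define Vin where "Vin = {v. v \<notin> {x, y, z} \<and> (\<exists>u. (u, v) \<in> Sd)}"
  have SFF: "S \<subseteq> FF" using inside_face by (auto simp: S_def)
  have finS: "finite S" using SFF finFF by (rule finite_subset)
  have Sd_DA: "Sd \<subseteq> DA" using SFF Union_FF by (auto simp: Sd_def)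
  have finSd: "finite Sd" using Sd_DA finD by (rule finite_subset)
  have mem: "(a, b) \<in> Sd \<longleftrightarrow> inside x y z (fc (a, b))" if "A a b" for a b
  proof
    assume "(a, b) \<in> Sd"
    then obtain g where "g \<in> S" "(a, b) \<in> g" by (auto simp: Sd_def)
    then show "inside x y z (fc (a, b))" using FF_fc[of g "(a, b)"] SFF by (auto simp: S_def)
  next
    assume "inside x y z (fc (a, b))"
    then show "(a, b) \<in> Sd" using fc_self[of "(a, b)"] by (auto simp: Sd_def S_def)
  qed
  have swp: "(b, a) \<in> Sd" if "(a, b) \<in> Sd" "(a, b) \<notin> ?C" for a b
  proof -
    have ab: "A a b" using that Sd_DA by auto
    then show ?thesis using inside_step[OF _ ab that(2)] mem[OF ab] mem[OF A_sym[OF ab]] that(1) by simp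
  qed
  have nxt: "(b, r b a) \<in> Sd" if "(a, b) \<in> Sd" for a b
  proof -
    have ab: "A a b" using that Sd_DA by auto
    have "fc (b, r b a) = fc (a, b)" using fc_fn[of "(a, b)"] ab by (simp add: fnext_def)
    then show ?thesis using mem[OF ab] mem[OF rot_A[OF A_sym[OF ab]]] that by simp
  qed
  have Csym: "(b, a) \<in> ?C" if "(a, b) \<in> ?C" for a b using that by (auto simp: cyc_def)
  have Wsym: "sym W" by (rule symI) (use swp Csym in \<open>auto simp: W_def\<close>)
  have Wsub: "W \<subseteq> DA" using Sd_DA by (auto simp: W_def)
  have finW: "finite W" using Wsub finD by (rule finite_subset)
  have Wirr: "(a, a) \<notin> W" for a using Wsub A_irr by auto
  have TriS: "Tri \<in> S" by (simp add: S_def inside_Tri)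
  have no_outer: "outer T \<notin> S" using outer_not_inside[OF three_cycle] by (simp add: S_def)
  have cardSd: "card Sd = (\<Sum>f\<in>S. card f)" using card_FF_sum[OF SFF, of UNIV] by (simp add: Sd_def)
  \<comment> \<open>No inside face is the outer one, so each is the triangle, without a reflex
    angle, or a quadrilateral, with exactly one.\<close>
  have R: "card (Sd \<inter> RR) = card S - 1"
  proof -
    have "card (Sd \<inter> RR) = (\<Sum>f\<in>S. card (f \<inter> RR))" using card_FF_sum[OF SFF, of RR] by (simp add: Sd_def)
    also have "\<dots> = (\<Sum>f\<in>S - {Tri}. card (f \<inter> RR))"
      using sum.remove[OF finS TriS, of "\<lambda>f. card (f \<inter> RR)"] int_reflex_card[OF Tri(1,2)] Tri(3) by simp
    also have "\<dots> = (\<Sum>f\<in>S - {Tri}. 1)"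
    proof (rule sum.cong)
      fix g assume g: "g \<in> S - {Tri}"
      then have "g \<in> FF" "g \<noteq> outer T" using SFF no_outer by auto
      then show "card (g \<inter> RR) = 1" using int_reflex_card int_card TriI g by fastforce
    qed simp
    finally show ?thesis using finS TriS by simp
  qed
  have Sd_eq: "card Sd = card (Sd \<inter> RR) + 3 * card S"
  proof -
    have "card (Sd \<inter> RR) = (\<Sum>f\<in>S. card (f \<inter> RR))" using card_FF_sum[OF SFF, of RR] by (simp add: Sd_def)
    moreover have "(\<Sum>f\<in>S. card f) = (\<Sum>f\<in>S. card (f \<inter> RR) + 3)"
    proof (rule sum.cong)
      fix g assume "g \<in> S"
      then have "g \<in> FF" "g \<noteq> outer T" using SFF no_outer by auto
      then show "card g = card (g \<inter> RR) + 3" by (rule int_reflex_card)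
    qed simp
    ultimately show ?thesis using cardSd by (simp add: sum.distrib)
  qed
  have S1: "card S \<ge> 1" using finS TriS by (metis One_nat_def Suc_leI card_gt_0_iff empty_iff)
  \<comment> \<open>By \<open>one_side\<close> each of the three edges of the cycle has at most one
    of its two darts inside.\<close>
  have C3: "card (Sd \<inter> ?C) \<le> 3"
  proof -
    have one: "(a, b) \<notin> Sd \<or> (b, a) \<notin> Sd" if "(a, b) \<in> ?C" for a b
    proof -
      have "A a b" using that three_cycle_edges[OF three_cycle] by (auto simp: cyc_def)
      then show ?thesis using one_side[OF three_cycle that] mem A_sym by blast
    qed
    define pk where "pk a b = (if (a, b) \<in> Sd then (a, b) else (b, a))" for a b
    have "Sd \<inter> ?C \<subseteq> {pk x y, pk y z, pk z x}"
      using one[of x y] one[of y z] one[of z x] by (auto simp: cyc_def pk_def)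
    then have "card (Sd \<inter> ?C) \<le> card {pk x y, pk y z, pk z x}" by (intro card_mono) auto
    also have "\<dots> \<le> 3" by (simp add: card_insert_if)
    finally show ?thesis .
  qed
  have "card Sd = card W + card (Sd \<inter> ?C)"
    unfolding W_def using finSd by (subst card_Un_disjoint[symmetric]) (auto intro: arg_cong[where f=card])
  \<comment> \<open>The inside faces have (card S - 1) + 3 * card S darts. At most three of these
    lie on the cycle, and the remaining ones are paired into edges.\<close>
  then have E: "card W div 2 \<ge> 2 * card S - 2" using Sd_eq R S1 C3 by linarith
  have into: "(w, v) \<in> Sd" if v: "v \<in> Vin" and w: "A w v" for v w
  proof -
    obtain u where u: "(u, v) \<in> Sd" and vn: "v \<notin> {x, y, z}" using v by (auto simp: Vin_def)
    have vu: "A v u" using u Sd_DA A_sym by auto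
    obtain k where k: "(r v ^^ k) u = w" using rot_trans[OF vu A_sym[OF w]] by blast
    have "((r v ^^ j) u, v) \<in> Sd" for j
    proof (induction j)
      case (Suc j)
      have "(v, r v ((r v ^^ j) u)) \<in> Sd" using nxt[OF Suc] .
      moreover have "(v, r v ((r v ^^ j) u)) \<notin> ?C" using vn by (auto simp: cyc_def)
      ultimately show ?case using swp by simp
    qed (use u in simp)
    then show ?thesis using k by metis
  qed
  have VinV: "Vin \<subseteq> verts T" using Sd_DA A_V by (fastforce simp: Vin_def)
  have finVin: "finite Vin" using VinV finV by (rule finite_subset)
  \<comment> \<open>All corners at an inner vertex are inside, hence also its reflex one. The
    supposed reflex angle at \<open>c\<close> on the cycle comes in addition, which gives one more
    vertex than the count allows.\<close>
  have "insert c Vin \<subseteq> snd ` (Sd \<inter> RR)"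
  proof
    fix v assume "v \<in> insert c Vin"
    then consider "v = c" | "v \<in> Vin" by auto
    then show "v \<in> snd ` (Sd \<inter> RR)"
    proof cases
      case 1
      have "(u, c) \<in> Sd \<inter> RR" using mem[OF f(2)] f by simp
      then show ?thesis using 1 by (intro image_eqI[of _ _ "(u, c)"]) auto
    next
      case 2
      then obtain w where w: "A w v" "reflex T (w, v)" using reflex_ex VinV by blast
      then have "(w, v) \<in> Sd \<inter> RR" using into[OF 2] by simp
      then show ?thesis by (intro image_eqI[of _ _ "(w, v)"]) auto
    qed
  qed
  then have "card (insert c Vin) \<le> card (snd ` (Sd \<inter> RR))" using finSd by (intro card_mono) auto
  also have "\<dots> \<le> card (Sd \<inter> RR)" using finSd by (intro card_image_le) auto
  finally have Q: "card Vin + 1 \<le> card S - 1"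
    using R c finVin by (simp add: card_insert_if Vin_def split: if_splits)
  \<comment> \<open>The bound opposite to \<open>E\<close>: an even set of inner edges is the cut of
    a set of inner vertices, and the inside faces met oddly are even in number, because each inner
    edge has both of its darts inside.\<close>
  have "2 ^ (card W div 2) \<le> (2::nat) ^ card Vin * 2 ^ (card S - 1)"
  proof -
    let ?P = "{X. X \<subseteq> W \<and> sym X}"
    let ?h = "\<lambda>X. {f\<in>S. odd (card (f \<inter> X))}"
    define K where "K = {X\<in>?P. ?h X = {}}"
    have finP: "finite ?P" using finW by (intro finite_subset[of ?P "Pow W"]) auto
    have c1: "card ?P = card K * card (?h ` ?P)" unfolding K_def
    proof (rule card_kernel_mult_card_image[OF finP])
      fix X Y assume XY: "X \<in> ?P" "Y \<in> ?P"
      have "sym (xor_set X Y)" using XY by (intro sym_xor) simp_all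
      then show "xor_set X Y \<in> ?P" using XY by blast
      have "finite f" if "f \<in> S" for f using SFF FF_fin that by blast
      then show "?h (xor_set X Y) = xor_set (?h X) (?h Y)"
        using odd_card_Int_xor[of _ X Y] by blast
    qed
    have c2: "card ?P = 2 ^ (card W div 2)" by (rule card_sym_subsets[OF finW Wsym Wirr])
    have c3: "card (?h ` ?P) \<le> 2 ^ (card S - 1)"
    proof (rule card_even_subsets_le[OF finS TriS], intro subsetI)
      fix Y assume "Y \<in> ?h ` ?P"
      then obtain X where X: "X \<subseteq> W" "sym X" and Y: "Y = ?h X" by blast
      have "Sd \<inter> X = X" using X by (auto simp: W_def)
      then have "card X = (\<Sum>f\<in>S. card (f \<inter> X))" using card_FF_sum[OF SFF, of X] by (simp add: Sd_def)
      moreover have "even (card X)"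
        proof -
        have "(a, a) \<notin> X" for a using X(1) Wirr by blast
        then show ?thesis using sym_card[OF finite_subset[OF X(1) finW] X(2)] by presburger
      qed
      ultimately have "even (card Y)" unfolding Y using even_sum_iff[OF finS, of "\<lambda>f. card (f \<inter> X)"] by metis
      then show "Y \<in> {Y. Y \<subseteq> S \<and> even (card Y)}" using Y by blast
    qed
    have "K \<subseteq> cut ` Pow Vin"
    proof
      fix X assume "X \<in> K"
      then have X: "X \<subseteq> W" "sym X" and evS: "\<And>f. f \<in> S \<Longrightarrow> even (card (f \<inter> X))" by (auto simp: K_def)
      have ev: "even (card (f \<inter> X))" if f: "f \<in> FF" for f
      proof (cases "f \<in> S")
        case False
        have "f \<inter> X = {}"
        proof (rule ccontr)
          assume "f \<inter> X \<noteq> {}"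
          then obtain d where d: "d \<in> f" "d \<in> X" by blast
          then have "d \<in> Sd" using X(1) W_def by blast
          then obtain g where g: "d \<in> g" "g \<in> S" unfolding Sd_def by (rule UnionE)
          then have "g = f" using FF_fc[OF f d(1)] FF_fc[of g d] SFF by blast
          then show False using False g by simp
        qed
        then show ?thesis by simp
      qed (rule evS)
      have "X \<subseteq> DA" using X(1) Wsub by (rule subset_trans)
      then obtain p where p: "X = cut p" using even_is_cut[OF _ X(2) ev] by blast
      have noW: "(a \<in> p) = (b \<in> p)" if "A a b" "(a, b) \<notin> W" for a b
      proof -
        have "(a, b) \<notin> cut p" using that(2) X(1) p by blast
        then show ?thesis using that(1) by (simp add: cut_def)
      qed
      \<comment> \<open>The cut uses only edges of \<open>W\<close>. A walk to \<open>x\<close> that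
        starts outside \<open>Vin\<close> can enter \<open>Vin\<close> only after meeting the cycle,
        so membership in \<open>p\<close> is constant on the complement of
        \<open>Vin\<close>.\<close>
      have out: "v \<notin> Vin \<longrightarrow> (v \<in> p) = (x \<in> p)" if "A\<^sup>*\<^sup>* v x" for v
        using that
      proof (induction rule: converse_rtranclp_induct)
        case (step v v')
        show ?case
        proof
          assume v: "v \<notin> Vin"
          show "(v \<in> p) = (x \<in> p)"
          proof (cases "v \<in> {x, y, z}")
            case True
            have "(y, x) \<notin> W" "(z, x) \<notin> W" by (auto simp: W_def cyc_def)
            then show ?thesis using noW[of y x] noW[of z x] three_cycle_edges[OF three_cycle] True by auto
          next
            case False
            then have n: "(w, v) \<notin> Sd" for w using v by (auto simp: Vin_def)
            have "(v, v') \<notin> W" using n[of v'] symD[OF Wsym, of v v'] W_def by blast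
            then have 1: "(v \<in> p) = (v' \<in> p)" using noW step by auto
            have "v' \<notin> Vin"
            proof
              assume "v' \<in> Vin"
              then have "(v, v') \<in> Sd" using into step by auto
              moreover have "(v, v') \<notin> ?C" using False by (auto simp: cyc_def)
              ultimately show False using swp n by blast
            qed
            then show ?thesis using 1 step by simp
          qed
        qed
      qed simp
      have xV: "x \<in> verts T" using three_cycle_edges[OF three_cycle] A_V by blast
      \<comment> \<open>A set and its complement have the same cut; the one without \<open>x\<close>
        consists of inner vertices only.\<close>
      define q where "q = (if x \<in> p then verts T - p else verts T \<inter> p)"
      have "q \<subseteq> Vin" using out A_conn[OF _ xV] by (auto simp: q_def)
      moreover have "cut q = cut p" unfolding cut_def q_def using A_V by auto
      ultimately show "X \<in> cut ` Pow Vin" unfolding p by (metis PowI imageI)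
    qed
    then have "card K \<le> card (cut ` Pow Vin)" using finVin by (intro card_mono) auto
    also have "\<dots> \<le> card (Pow Vin)" using finVin by (intro card_image_le) auto
    also have "\<dots> = 2 ^ card Vin" using finVin by (simp add: card_Pow)
    finally have c4: "card K \<le> 2 ^ card Vin" .
    show ?thesis unfolding c2[symmetric] c1 by (rule mult_le_mono[OF c4 c3])
  qed
  then have "(2::nat) ^ (card W div 2) \<le> 2 ^ (card Vin + (card S - 1))" by (simp add: power_add)
  then have "card W div 2 \<le> card Vin + (card S - 1)" by simp
  then show False using E Q by linarith
qed

text \<open>For consecutive neighbours \<open>s\<close>, \<open>m\<close>, \<open>t\<close> of
  \<open>u\<close>, the inside of \<open>u s t\<close> occupies only the two corners at
  \<open>u\<close> between \<open>s\<close> and \<open>t\<close>. Past \<open>t\<close> the cycle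
  has been crossed, so by \<open>one_side\<close> the corner is not inside, and no further edge of
  the cycle is met before \<open>s\<close>. The lemma serves to exclude unwanted neighbours of
  \<open>u\<close> inside the cycle.\<close>

lemma arc:
  assumes three_cycle: "three_cycle u s t" and rot: "r u s = m" "r u m = t" and m: "A u m" "m \<noteq> s" "m \<noteq> t"
    and i: "inside u s t (fc (s, u))" "inside u s t (fc (m, u))"
    and d: "A u d" "d \<notin> {s, m, t}"
  shows "\<not> inside u s t (fc (d, u))"
proof -
  define good where "good d \<longleftrightarrow> d \<in> {s, m, t} \<or> \<not> inside u s t (fc (d, u))" for d
  have out: "good (r u e)" if e: "A u e" "\<not> inside u s t (fc (e, u))" for e
  proof (cases "r u e \<in> {s, m, t}")
    case False
    have eq: "fc (e, u) = fc (u, r u e)" using fc_fn[of "(e, u)"] A_sym[OF e(1)] by (simp add: fnext_def)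
    have "(r u e, u) \<notin> cyc u s t" using False A_neq[OF rot_A[OF e(1)]] by (auto simp: cyc_def)
    then have "\<not> inside u s t (fc (r u e, u))"
      using inside_step[of u s t "r u e" u] A_sym[OF rot_A[OF e(1)]] eq e(2) by auto
    then show ?thesis by (simp add: good_def)
  qed (simp add: good_def)
  have t: "\<not> inside u s t (fc (t, u))"
  proof -
    have "fc (m, u) = fc (u, t)" using fc_fn[of "(m, u)"] A_sym[OF m(1)] rot by (simp add: fnext_def)
    then show ?thesis using one_side[OF three_cycle, of u t] i(2) by (auto simp: cyc_def)
  qed
  have step: "good (r u e)" if "A u e" "good e" for e
    using that out[OF that(1)] out[OF _ t] t rot three_cycle_edges[OF three_cycle] unfolding good_def by auto
  obtain k where k: "(r u ^^ k) s = d" using rot_trans[OF _ d(1)] three_cycle_edges[OF three_cycle] by blast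
  have "A u ((r u ^^ j) s) \<and> good ((r u ^^ j) s)" for j
  proof (induction j)
    case 0 then show ?case using three_cycle_edges[OF three_cycle] by (auto simp: good_def)
  next
    case (Suc j) then show ?case using rot_A step by simp
  qed
  then show ?thesis using k d(2) unfolding good_def by metis
qed

end

section \<open>Construction of flips\<close>

text \<open>The rotation at a single vertex is one cycle on its neighbours, so deleting or inserting
  an edge can be treated at each end separately.\<close>

definition cycperm :: "nat set \<Rightarrow> (nat \<Rightarrow> nat) \<Rightarrow> bool" where
  "cycperm N p \<longleftrightarrow> (\<forall>w\<in>N. p w \<in> N) \<and> inj_on p N \<and> (\<forall>w\<in>N. \<forall>w'\<in>N. \<exists>k. (p ^^ k) w = w')"

lemma cycpermD:
  assumes "cycperm N p"
  shows "w \<in> N \<Longrightarrow> p w \<in> N" "w \<in> N \<Longrightarrow> w' \<in> N \<Longrightarrow> p w = p w' \<Longrightarrow> w = w'"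
    "w \<in> N \<Longrightarrow> w' \<in> N \<Longrightarrow> \<exists>k. (p ^^ k) w = w'"
  using assms unfolding cycperm_def inj_on_def by simp_all

lemma cycperm_remove:
  assumes N: "cycperm N p" and b: "b \<in> N"
  shows "cycperm (N - {b}) (\<lambda>w. if p w = b then p b else p w)"
    (is "cycperm _ ?q")
  unfolding cycperm_def
proof (intro conjI ballI)
  fix w assume w: "w \<in> N - {b}"
  show "?q w \<in> N - {b}"
  proof (cases "p w = b")
    case True
    have "p b \<noteq> b" using cycpermD(2)[OF N, of w b] w b True by auto
    then show ?thesis using True cycpermD(1)[OF N b] by simp
  qed (use w cycpermD(1)[OF N] in auto)
next
  show "inj_on ?q (N - {b})"
  proof (rule inj_onI)
    fix x y assume x: "x \<in> N - {b}" and y: "y \<in> N - {b}" and eq: "?q x = ?q y"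
    show "x = y"
      using cycpermD(2)[OF N, of x y] cycpermD(2)[OF N, of x b] cycpermD(2)[OF N, of y b] x y b eq
      by (auto split: if_splits)
  qed
next
  fix w w' assume w: "w \<in> N - {b}" and w': "w' \<in> N - {b}"
  \<comment> \<open>The new orbit skips \<open>b\<close>, so when the old orbit stands at
    \<open>b\<close> the new one is compared with it one position ahead, at
    \<open>p b\<close>.\<close>
  have "((p ^^ k) w \<noteq> b \<longrightarrow> (\<exists>j. (?q ^^ j) w = (p ^^ k) w)) \<and>
        ((p ^^ k) w = b \<longrightarrow> (\<exists>j. (?q ^^ j) w = p b))" for k
  proof (induction k)
    case 0
    show ?case using w by (auto intro: exI[of _ 0])
  next
    case (Suc k)
    show ?case
    proof (cases "(p ^^ k) w = b")
      case True
      then show ?thesis using Suc by auto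
    next
      case False
      then obtain j where "(?q ^^ j) w = (p ^^ k) w" using Suc by auto
      then have "(?q ^^ Suc j) w = ?q ((p ^^ k) w)" by simp
      then show ?thesis by (metis comp_apply funpow.simps(2))
    qed
  qed
  moreover obtain k where "(p ^^ k) w = w'" using cycpermD(3)[OF N] w w' by auto
  ultimately show "\<exists>k. (?q ^^ k) w = w'" using w' by auto
qed

lemma cycperm_insert:
  assumes N: "cycperm N p" and x: "x \<in> N" and d: "d \<notin> N"
  shows "cycperm (insert d N) (\<lambda>w. if w = x then d else if w = d then p x else p w)"
    (is "cycperm _ ?q")
proof -
  have reach: "\<exists>j. (?q ^^ j) w = (p ^^ k) w \<and> (p ^^ k) w \<in> N" if w: "w \<in> N" for w k
  proof (induction k)
    case 0
    show ?case using w by (auto intro: exI[of _ 0])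
  next
    case (Suc k)
    then obtain j where j: "(?q ^^ j) w = (p ^^ k) w" "(p ^^ k) w \<in> N" by auto
    show ?case
    proof (cases "(p ^^ k) w = x")
      case True
      have "(?q ^^ Suc (Suc j)) w = p x" using j True d x by auto
      then show ?thesis using True cycpermD(1)[OF N x] by (intro exI[of _ "Suc (Suc j)"]) simp
    next
      case False
      have "(?q ^^ Suc j) w = p ((p ^^ k) w)" using j False d by auto
      then show ?thesis using cycpermD(1)[OF N j(2)] by (intro exI[of _ "Suc j"]) simp
    qed
  qed
  have NN: "\<exists>j. (?q ^^ j) w = w'" if "w \<in> N" "w' \<in> N" for w w'
    using reach[OF that(1)] cycpermD(3)[OF N that] by metis
  have Nd: "\<exists>j. (?q ^^ j) w = d" if w: "w \<in> N" for w
  proof -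
    obtain j where "(?q ^^ j) w = x" using NN[OF w x] by auto
    then have "(?q ^^ Suc j) w = d" by simp
    then show ?thesis ..
  qed
  have dN: "\<exists>j. (?q ^^ j) d = w" if w: "w \<in> N" for w
  proof -
    obtain j where "(?q ^^ j) (p x) = w" using NN[OF cycpermD(1)[OF N x] w] by auto
    moreover have "?q d = p x" using d x by auto
    ultimately have "(?q ^^ Suc j) d = w" by (simp only: funpow_Suc_right comp_apply)
    then show ?thesis ..
  qed
  have dd: "\<exists>j. (?q ^^ j) d = d" by (rule exI[of _ 0]) simp
  show ?thesis unfolding cycperm_def
  proof (intro conjI)
    show "\<forall>w\<in>insert d N. ?q w \<in> insert d N" using cycpermD(1)[OF N] x by auto
    have px: "p w \<noteq> d" if "w \<in> N" for w using cycpermD(1)[OF N that] d by auto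
    show "inj_on ?q (insert d N)"
    proof (rule inj_onI)
      fix u v assume u: "u \<in> insert d N" and v: "v \<in> insert d N" and eq: "?q u = ?q v"
      have qd: "?q w = d \<longleftrightarrow> w = x" if "w \<in> insert d N" for w
        using that px[of w] px[OF x] by (cases "w = x"; cases "w = d") auto
      show "u = v"
      proof (cases "u = x")
        case True
        then show ?thesis using qd[OF u] qd[OF v] eq by metis
      next
        case False
        then have vx: "v \<noteq> x" using qd[OF u] qd[OF v] eq by metis
        \<comment> \<open>\<open>d\<close> has inherited the old successor of \<open>x\<close>.
          Reading \<open>d\<close> as \<open>x\<close> therefore reduces injectivity away from
          \<open>x\<close> to that of \<open>p\<close>.\<close>
        let ?g = "\<lambda>w. if w = d then x else w"
        have "p (?g u) = p (?g v)" using eq False vx by (simp split: if_splits)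
        moreover have "?g u \<in> N" "?g v \<in> N" using u v x by auto
        ultimately have "?g u = ?g v" using cycpermD(2)[OF N] by blast
        then show ?thesis using False vx by (simp split: if_splits)
      qed
    qed
    show "\<forall>w\<in>insert d N. \<forall>w'\<in>insert d N. \<exists>k. (?q ^^ k) w = w'"
      using NN Nd dN dd by auto
  qed
qed

lemma rotation_system_cycperm:
  "rotation_system V A r \<longleftrightarrow> (\<forall>v\<in>V. cycperm {w. A v w} (r v))"
  unfolding rotation_system_def cycperm_def inj_on_def by auto

lemma rotation_system_remove:
  assumes "rotation_system V A r" "A a b"
  shows "rotation_system V (\<lambda>u v. A u v \<and> (u, v) \<noteq> (a, b)) (rot_remove r a b)"
  unfolding rotation_system_cycperm
proof
  fix v assume "v \<in> V"
  then have c: "cycperm {w. A v w} (r v)" using assms(1) by (simp add: rotation_system_cycperm)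
  show "cycperm {w. A v w \<and> (v, w) \<noteq> (a, b)} (rot_remove r a b v)"
  proof (cases "v = a")
    case True
    have "{w. A v w \<and> (v, w) \<noteq> (a, b)} = {w. A v w} - {b}" using True by auto
    moreover have "rot_remove r a b v = (\<lambda>w. if r v w = b then r v b else r v w)"
      unfolding True rot_remove_def by simp
    ultimately show ?thesis using cycperm_remove[OF c, of b] assms(2) True by simp
  next
    case False
    then show ?thesis using c by (simp add: rot_remove_def)
  qed
qed

lemma rotation_system_insert:
  assumes "rotation_system V A r" "A c x" "\<not> A c d"
  shows "rotation_system V (\<lambda>u v. A u v \<or> (u, v) = (c, d)) (rot_insert r c x d)"
  unfolding rotation_system_cycperm
proof
  fix v assume "v \<in> V"
  then have c: "cycperm {w. A v w} (r v)" using assms(1) by (simp add: rotation_system_cycperm)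
  show "cycperm {w. A v w \<or> (v, w) = (c, d)} (rot_insert r c x d v)"
  proof (cases "v = c")
    case True
    have "{w. A v w \<or> (v, w) = (c, d)} = insert d {w. A v w}" using True by auto
    moreover have "rot_insert r c x d v = (\<lambda>w. if w = x then d else if w = d then r v x else r v w)"
      unfolding True rot_insert_def by (auto simp: fun_eq_iff)
    ultimately show ?thesis using cycperm_insert[OF c, of x d] assms True by simp
  next
    case False
    then show ?thesis using c by (simp add: rot_insert_def)
  qed
qed

section \<open>Small faces as equations on the rotation\<close>

lemma face_of_3:
  assumes "fnext r d0 = d1" "fnext r d1 = d2" "fnext r d2 = d0"
  shows "face_of r d0 = {d0, d1, d2}"
proof
  have "(fnext r ^^ k) d0 \<in> {d0, d1, d2}" for k by (induction k) (use assms in auto)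
  then show "face_of r d0 \<subseteq> {d0, d1, d2}" unfolding face_of_def by blast
  have "(fnext r ^^ 0) d0 = d0" "(fnext r ^^ 1) d0 = d1" "(fnext r ^^ 2) d0 = d2"
    using assms by (simp_all add: numeral_2_eq_2)
  then show "{d0, d1, d2} \<subseteq> face_of r d0" unfolding face_of_def by (metis empty_subsetI insert_subset rangeI)
qed

lemma face_of_4:
  assumes "fnext r d0 = d1" "fnext r d1 = d2" "fnext r d2 = d3" "fnext r d3 = d0"
  shows "face_of r d0 = {d0, d1, d2, d3}"
proof
  have "(fnext r ^^ k) d0 \<in> {d0, d1, d2, d3}" for k by (induction k) (use assms in auto)
  then show "face_of r d0 \<subseteq> {d0, d1, d2, d3}" unfolding face_of_def by blast
  have "(fnext r ^^ 0) d0 = d0" "(fnext r ^^ 1) d0 = d1" "(fnext r ^^ 2) d0 = d2" "(fnext r ^^ 3) d0 = d3"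
    using assms by (simp_all add: numeral_2_eq_2 numeral_3_eq_3)
  then show "{d0, d1, d2, d3} \<subseteq> face_of r d0" unfolding face_of_def by (metis empty_subsetI insert_subset rangeI)
qed

lemma face_of_cong:
  assumes "\<And>e. e \<in> face_of r d \<Longrightarrow> fnext r' e = fnext r e"
  shows "face_of r' d = face_of r d"
proof -
  have "(fnext r' ^^ k) d = (fnext r ^^ k) d" for k
  proof (induction k)
    case (Suc k)
    have "(fnext r ^^ k) d \<in> face_of r d" by (auto simp: face_of_def)
    then show ?case using assms Suc by simp
  qed simp
  then show ?thesis by (simp add: face_of_def)
qed

context emap
begin

text \<open>The size of a face is the least period of \<open>fnext\<close> on it. This turns sizes 3
  and 4 into closing equations for the rotation.\<close>

lemma face_card:
  assumes d: "d \<in> DA" and n: "card (fc d) = n"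
  shows "(fnext r ^^ n) d = d" "inj_on (\<lambda>i. (fnext r ^^ i) d) {..<n}"
proof -
  define m where "m = (LEAST k. 0 < k \<and> (fnext r ^^ k) d = d)"
  have ex: "\<exists>k. 0 < k \<and> (fnext r ^^ k) d = d"
    using funpow_return[OF finD _ fn_inj d] fn_in by (metis image_subsetI)
  have m: "0 < m" "(fnext r ^^ m) d = d" using LeastI_ex[OF ex] by (auto simp: m_def)
  have least: "\<not> (0 < k \<and> (fnext r ^^ k) d = d)" if "k < m" for k
    using that not_less_Least unfolding m_def by blast
  have per: "(fnext r ^^ (m * j)) d = d" for j
    by (induction j) (simp_all add: funpow_add m)
  have im: "fc d = (\<lambda>i. (fnext r ^^ i) d) ` {..<m}"
  proof
    show "fc d \<subseteq> (\<lambda>i. (fnext r ^^ i) d) ` {..<m}"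
    proof
      fix e assume "e \<in> fc d"
      then obtain i where i: "e = (fnext r ^^ i) d" by (auto simp: face_of_def)
      have "i = i mod m + m * (i div m)" by simp
      then have "(fnext r ^^ i) d = (fnext r ^^ (i mod m)) ((fnext r ^^ (m * (i div m))) d)"
        by (metis comp_apply funpow_add)
      then have "e = (fnext r ^^ (i mod m)) d" using per i by simp
      then show "e \<in> (\<lambda>i. (fnext r ^^ i) d) ` {..<m}" using m(1) by (intro image_eqI[of _ _ "i mod m"]) auto
    qed
  qed (auto simp: face_of_def)
  have inj: "inj_on (\<lambda>i. (fnext r ^^ i) d) {..<m}"
  proof -
    have "i = j" if ij: "i \<le> j" "j < m" "(fnext r ^^ i) d = (fnext r ^^ j) d" for i j
    proof (rule ccontr)
      assume "i \<noteq> j"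
      have "(fnext r ^^ (m - j + i)) d = (fnext r ^^ (m - j)) ((fnext r ^^ j) d)"
        using ij(3) by (simp add: funpow_add)
      also have "\<dots> = (fnext r ^^ (m - j + j)) d" by (simp only: funpow_add comp_apply)
      also have "\<dots> = d" using ij m by simp
      finally have "(fnext r ^^ (m - j + i)) d = d" .
      moreover have "0 < m - j + i" "m - j + i < m" using ij \<open>i \<noteq> j\<close> by linarith+
      ultimately show False using least by blast
    qed
    then show ?thesis unfolding inj_on_def by (metis lessThan_iff nat_le_linear)
  qed
  have "n = m" using n im inj by (simp add: card_image)
  then show "(fnext r ^^ n) d = d" "inj_on (\<lambda>i. (fnext r ^^ i) d) {..<n}" using m inj by auto
qed

lemma face3_rot:
  assumes "A x y" "card (fc (x, y)) = 3"
  obtains z where "r y x = z" "r z y = x" "r x z = y"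
proof -
  have "(fnext r ^^ 3) (x, y) = (x, y)" using face_card(1)[OF _ assms(2)] assms(1) by simp
  moreover have "(fnext r ^^ 3) (x, y) = (r (r y x) y, r (r (r y x) y) (r y x))"
    by (simp add: numeral_3_eq_3 fnext_def)
  ultimately have "r (r y x) y = x" "r (r (r y x) y) (r y x) = y" by (metis prod.inject)+
  then show ?thesis using that[of "r y x"] by metis
qed

lemma face4_rot:
  assumes "A x y" "card (fc (x, y)) = 4"
  obtains p q where "r y x = p" "r p y = q" "r q p = x" "r x q = y"
proof -
  have "(fnext r ^^ 4) (x, y) = (x, y)" using face_card(1)[OF _ assms(2)] assms(1) by simp
  moreover have "(fnext r ^^ 4) (x, y) =
      (r (r (r y x) y) (r y x), r (r (r (r y x) y) (r y x)) (r (r y x) y))"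
    by (simp add: eval_nat_numeral fnext_def)
  ultimately have "r (r (r y x) y) (r y x) = x" "r (r (r (r y x) y) (r y x)) (r (r y x) y) = y"
    by (metis prod.inject)+
  then show ?thesis using that[OF refl refl] by metis
qed

end

text \<open>The triangle \<open>a b z\<close> and the quadrilateral \<open>b a p q\<close> on the
  two sides of the edge \<open>ab\<close>. They are described by rotation equations because the
  pentagon can be degenerate: \<open>z\<close> may equal \<open>p\<close> or
  \<open>q\<close>.\<close>

locale edge_flip = ppt +
  fixes a b z p q :: nat
  assumes ab: "A a b"
    and rots: "r b a = z" "r z b = a" "r a z = b" "r a b = p" "r p a = q" "r q p = b" "r b q = a"
    and ab_int: "(a, b) \<notin> outer T" "(b, a) \<notin> outer T"
begin

lemma edges: "A b a" "A b z" "A z b" "A z a" "A a z" "A a p" "A p a" "A p q" "A q p" "A q b" "A b q"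
proof -
  show 1: "A b a" by (rule A_sym[OF ab])
  show 2: "A b z" using rot_A[OF 1] rots by simp
  show 3: "A z b" by (rule A_sym[OF 2])
  show 4: "A z a" using rot_A[OF 3] rots by simp
  show 5: "A a z" by (rule A_sym[OF 4])
  show 6: "A a p" using rot_A[OF ab] rots by simp
  show 7: "A p a" by (rule A_sym[OF 6])
  show 8: "A p q" using rot_A[OF 7] rots by simp
  show 9: "A q p" by (rule A_sym[OF 8])
  show 10: "A q b" using rot_A[OF 9] rots by simp
  show 11: "A b q" by (rule A_sym[OF 10])
qed

lemma neqs: "a \<noteq> b" "b \<noteq> z" "z \<noteq> a" "a \<noteq> p" "p \<noteq> q" "q \<noteq> b"
  using A_neq ab edges by blast+

lemma fc_ab: "fc (a, b) = {(a, b), (b, z), (z, a)}"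
  by (rule face_of_3) (simp_all add: fnext_def rots)

lemma Tri_ab: "Tri = {(a, b), (b, z), (z, a)}"
proof -
  have "fc (a, b) = Tri"
  proof (rule TriI)
    show "fc (a, b) \<in> FF" using ab by auto
    show "fc (a, b) \<noteq> outer T" using ab_int(1) fc_self[of "(a, b)"] by metis
    show "card (fc (a, b)) = 3" unfolding fc_ab using neqs by simp
  qed
  then show ?thesis using fc_ab by simp
qed

definition "Fq = {(b, a), (a, p), (p, q), (q, b)}"

lemma fc_ba: "fc (b, a) = Fq"
  unfolding Fq_def by (rule face_of_4) (simp_all add: fnext_def rots)

lemma Fq: "Fq \<in> FF" "Fq \<noteq> outer T" "Fq \<noteq> Tri" "card Fq = 4"
proof -
  have ba: "(b, a) \<in> DA" using edges(1) by simp
  show 1: "Fq \<in> FF" unfolding fc_ba[symmetric] by (rule fc_FF[OF ba])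
  have m: "(b, a) \<in> Fq" by (simp add: Fq_def)
  show 2: "Fq \<noteq> outer T" using ab_int(2) m by metis
  have "(b, a) \<notin> Tri" using neqs by (auto simp: Tri_ab)
  then show 3: "Fq \<noteq> Tri" using m by metis
  show "card Fq = 4" using int_card[OF 1 2] TriI[OF 1 2] 3 by metis
qed

lemma Tri_Fq_disj: "Tri \<inter> Fq = {}" by (rule FF_disj[OF Tri(1) Fq(1)]) (use Fq(3) in metis)

text \<open>Otherwise \<open>(a, b)\<close>, a dart of the triangle, would also be a dart of the
  quadrilateral.\<close>

lemma more_neqs: "p \<noteq> b" "q \<noteq> a"
  using Tri_Fq_disj by (auto simp: Tri_ab Fq_def)

definition "A1 u v \<longleftrightarrow> A u v \<and> {u, v} \<noteq> {a, b}"
definition "r1 = rot_remove (rot_remove r a b) b a"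

lemma A1_sym: "A1 u v \<Longrightarrow> A1 v u" using A_sym[of u v] by (simp add: A1_def insert_commute)

lemma r1_eq: "r1 v w = (if v = b \<and> r b w = a then z else if v = a \<and> r a w = b then p else r v w)"
  using neqs by (simp add: r1_def rot_remove_def rots)

lemma r1_same: assumes "A v w" "(w, v) \<noteq> (z, a)" "(w, v) \<noteq> (q, b)" shows "r1 v w = r v w"
proof -
  have "w = q" if "v = b" "r b w = a" using rot_inj[of b w q] that assms(1) edges(11) rots by simp
  moreover have "w = z" if "v = a" "r a w = b" using rot_inj[of a w z] that assms(1) edges(5) rots by simp
  ultimately show ?thesis unfolding r1_eq using assms(2,3) by auto
qed

lemma rs1: "rotation_system (verts T) A1 r1"
proof -
  have rs: "rotation_system (verts T) A r" using emb by (simp add: plane_embedding_def)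
  have "rotation_system (verts T) (\<lambda>u v. (A u v \<and> (u, v) \<noteq> (a, b)) \<and> (u, v) \<noteq> (b, a)) r1"
    unfolding r1_def
    by (rule rotation_system_remove[OF rotation_system_remove[OF rs ab]]) (use edges(1) neqs in auto)
  moreover have "(\<lambda>u v. (A u v \<and> (u, v) \<noteq> (a, b)) \<and> (u, v) \<noteq> (b, a)) = A1"
    by (intro ext) (auto simp: A1_def doubleton_eq_iff)
  ultimately show ?thesis by simp
qed

text \<open>The vertices of the pentagon obtained by deleting \<open>ab\<close>, in cyclic order.\<close>

definition pentagon :: "nat \<Rightarrow> nat \<Rightarrow> nat \<Rightarrow> nat \<Rightarrow> nat \<Rightarrow> bool" where
  "pentagon p0 p1 p2 p3 p4 \<longleftrightarrow>
     r1 p1 p0 = p2 \<and> r1 p2 p1 = p3 \<and> r1 p3 p2 = p4 \<and> r1 p4 p3 = p0 \<and> r1 p0 p4 = p1 \<and>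
     {(p0, p1), (p1, p2), (p2, p3), (p3, p4), (p4, p0)} = Tri \<union> Fq - {(a, b), (b, a)}"

lemma pentagon_base: "pentagon z a p q b"
proof -
  have "r1 a z = p" "r1 b q = z" using neqs by (simp_all add: r1_eq rots)
  moreover have "r1 p a = q" using r1_same[of p a] edges(7) rots neqs more_neqs by simp
  moreover have "r1 q p = b" using r1_same[of q p] edges(9) rots neqs more_neqs by simp
  moreover have "r1 z b = a" using r1_same[of z b] edges(3) rots neqs more_neqs by simp
  moreover have "Tri \<union> Fq - {(a, b), (b, a)} = {(z, a), (a, p), (p, q), (q, b), (b, z)}"
    using neqs more_neqs by (auto simp: Tri_ab Fq_def)
  ultimately show ?thesis unfolding pentagon_def by simp
qed

lemma pentagon_rot: "pentagon p0 p1 p2 p3 p4 \<Longrightarrow> pentagon p1 p2 p3 p4 p0"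
  unfolding pentagon_def by (auto simp: insert_commute)

text \<open>The five starting points select the five diagonals \<open>p0 p2\<close> and the ear
  \<open>p1\<close> that each cuts off. In order they are \<open>zp\<close>, \<open>aq\<close>,
  \<open>pb\<close>, \<open>qz\<close> with ears \<open>a\<close>, \<open>p\<close>,
  \<open>q\<close>, \<open>b\<close>, and finally the old edge \<open>ba\<close> with ear
  \<open>z\<close>.\<close>

lemmas pentagons = pentagon_base pentagon_base[THEN pentagon_rot]
  pentagon_base[THEN pentagon_rot, THEN pentagon_rot]
  pentagon_base[THEN pentagon_rot, THEN pentagon_rot, THEN pentagon_rot]
  pentagon_base[THEN pentagon_rot, THEN pentagon_rot, THEN pentagon_rot, THEN pentagon_rot]

end

text \<open>The new triangle is \<open>p0 p1 p2\<close>. The reflex vertex \<open>w0\<close> of the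
  old quadrilateral has to reappear as a corner of the new one \<open>p0 p2 p3 p4\<close>, since the
  triangle has only convex angles; this is the condition \<open>w0_in\<close>.\<close>

locale diagonal_flip = edge_flip +
  fixes p0 p1 p2 p3 p4 w0 :: nat
  assumes pent: "pentagon p0 p1 p2 p3 p4"
    and nadj: "\<not> A p0 p2" and neq02: "p0 \<noteq> p2"
    and w0: "\<exists>d\<in>Fq. reflex T d \<and> snd d = w0" and w0_in: "w0 \<in> {p0, p2, p3, p4}"
begin

definition "G = {(p0, p1), (p1, p2), (p2, p3), (p3, p4), (p4, p0)}"

lemma G_eq: "G = Tri \<union> Fq - {(a, b), (b, a)}"
  using pent by (simp add: pentagon_def G_def)

lemma G_rots: "r1 p1 p0 = p2" "r1 p2 p1 = p3" "r1 p3 p2 = p4" "r1 p4 p3 = p0" "r1 p0 p4 = p1"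
  using pent by (simp_all add: pentagon_def)

lemma G_DA: "G \<subseteq> DA" using FF_sub[OF Tri(1)] FF_sub[OF Fq(1)] G_eq by blast

lemma G_A: "A p0 p1" "A p1 p2" "A p2 p3" "A p3 p4" "A p4 p0"
  using G_DA by (auto simp: G_def)

lemma G_A1: assumes "(u, v) \<in> G" shows "A1 u v" "A1 v u"
proof -
  have "A u v" using subsetD[OF G_DA assms] by simp
  moreover have "(u, v) \<noteq> (a, b)" "(u, v) \<noteq> (b, a)" using assms[unfolded G_eq] by blast+
  ultimately show 1: "A1 u v" by (auto simp: A1_def doubleton_eq_iff)
  show "A1 v u" by (rule A1_sym[OF 1])
qed

text \<open>If \<open>p2 = p4\<close> or \<open>p0 = p3\<close>, a side of the pentagon would
  already join \<open>p0\<close> and \<open>p2\<close>. The ear \<open>p1\<close> may coincide with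
  \<open>p3\<close> or \<open>p4\<close> in a degenerate pentagon, so only the inequalities listed
  are available.\<close>

lemma G_neq: "p0 \<noteq> p1" "p1 \<noteq> p2" "p2 \<noteq> p3" "p3 \<noteq> p4" "p4 \<noteq> p0" "p2 \<noteq> p4" "p0 \<noteq> p3"
proof -
  show "p0 \<noteq> p1" "p1 \<noteq> p2" "p2 \<noteq> p3" "p3 \<noteq> p4" "p4 \<noteq> p0" using G_A[THEN A_neq] by this+
  show "p2 \<noteq> p4" using A_sym[OF G_A(5)] nadj by metis
  show "p0 \<noteq> p3" using A_sym[OF G_A(3)] nadj by metis
qed

definition "A2 u v \<longleftrightarrow> A1 u v \<or> {u, v} = {p0, p2}"
definition "r2 = rot_insert (rot_insert r1 p0 p4 p2) p2 p1 p0"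

lemma A2_sym: "A2 u v \<Longrightarrow> A2 v u" using A1_sym[of u v] by (auto simp: A2_def insert_commute)

lemma r2_eq: "r2 v w = (if v = p2 \<and> w = p1 then p0 else if v = p2 \<and> w = p0 then p3
    else if v = p0 \<and> w = p4 then p2 else if v = p0 \<and> w = p2 then p1 else r1 v w)"
  using neq02 by (simp add: r2_def rot_insert_def G_rots)

lemma rs2: "rotation_system (verts T) A2 r2"
proof -
  have "rotation_system (verts T) (\<lambda>u v. (A1 u v \<or> (u, v) = (p0, p2)) \<or> (u, v) = (p2, p0)) r2"
    unfolding r2_def
  proof (rule rotation_system_insert[OF rotation_system_insert[OF rs1]])
    show "A1 p0 p4" by (rule G_A1(2)) (simp add: G_def)
    show "\<not> A1 p0 p2" using nadj by (simp add: A1_def)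
    show "A1 p2 p1 \<or> (p2, p1) = (p0, p2)" by (rule disjI1, rule G_A1(2)) (simp add: G_def)
    show "\<not> (A1 p2 p0 \<or> (p2, p0) = (p0, p2))" using nadj neq02 A1_sym[of p2 p0] by (auto simp: A1_def)
  qed
  moreover have "(\<lambda>u v. (A1 u v \<or> (u, v) = (p0, p2)) \<or> (u, v) = (p2, p0)) = A2"
    by (intro ext) (auto simp: A2_def doubleton_eq_iff)
  ultimately show ?thesis by simp
qed

definition "T3 = {(p2, p0), (p0, p1), (p1, p2)}"
definition "F4 = {(p0, p2), (p2, p3), (p3, p4), (p4, p0)}"

lemma fn2:
  "fnext r2 (p2, p0) = (p0, p1)" "fnext r2 (p0, p1) = (p1, p2)" "fnext r2 (p1, p2) = (p2, p0)"
  "fnext r2 (p0, p2) = (p2, p3)" "fnext r2 (p2, p3) = (p3, p4)" "fnext r2 (p3, p4) = (p4, p0)"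
  "fnext r2 (p4, p0) = (p0, p2)"
  by (simp_all add: fnext_def r2_eq G_rots G_neq G_neq[symmetric] neq02 neq02[symmetric])

lemma face_T3: assumes "d \<in> T3" shows "face_of r2 d = T3"
proof -
  have 1: "face_of r2 (p2, p0) = T3" unfolding T3_def by (rule face_of_3[OF fn2(1-3)])
  have 2: "face_of r2 (p0, p1) = T3" unfolding face_of_3[OF fn2(2,3,1)] T3_def by blast
  have 3: "face_of r2 (p1, p2) = T3" unfolding face_of_3[OF fn2(3,1,2)] T3_def by blast
  from assms consider "d = (p2, p0)" | "d = (p0, p1)" | "d = (p1, p2)" unfolding T3_def by blast
  then show ?thesis by cases (simp_all only: 1 2 3)
qed

lemma face_F4: assumes "d \<in> F4" shows "face_of r2 d = F4"
proof -
  have 1: "face_of r2 (p0, p2) = F4" unfolding F4_def by (rule face_of_4[OF fn2(4-7)])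
  have 2: "face_of r2 (p2, p3) = F4" unfolding face_of_4[OF fn2(5,6,7,4)] F4_def by blast
  have 3: "face_of r2 (p3, p4) = F4" unfolding face_of_4[OF fn2(6,7,4,5)] F4_def by blast
  have 4: "face_of r2 (p4, p0) = F4" unfolding face_of_4[OF fn2(7,4,5,6)] F4_def by blast
  from assms consider "d = (p0, p2)" | "d = (p2, p3)" | "d = (p3, p4)" | "d = (p4, p0)"
    unfolding F4_def by blast
  then show ?thesis by cases (simp_all only: 1 2 3 4)
qed

lemma cards: "card T3 = 3" "card F4 = 4"
  using G_neq neq02 unfolding T3_def F4_def by simp_all

lemma T3F4: "T3 \<union> F4 = G \<union> {(p0, p2), (p2, p0)}"
  by (auto simp: T3_def F4_def G_def)

lemma not_dart: "(p0, p2) \<notin> DA" "(p2, p0) \<notin> DA"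
  using nadj A_sym[of p2 p0] by (simp_all, metis)

lemma darts2: "darts A2 = DA - {(a, b), (b, a)} \<union> {(p0, p2), (p2, p0)}"
  by (auto simp: darts_def A2_def A1_def doubleton_eq_iff)

lemma old_iff: assumes "d \<in> DA" shows "d \<in> T3 \<union> F4 \<longleftrightarrow> d \<in> Tri \<union> Fq - {(a, b), (b, a)}"
  using assms not_dart unfolding T3F4 G_eq by auto

lemma fn_outside:
  assumes "d \<in> DA" "d \<notin> Tri \<union> Fq" shows "fnext r2 d = fnext r d"
proof -
  obtain u v where d: "d = (u, v)" by (cases d)
  have vu: "A v u" using assms(1) d A_sym[of u v] by simp
  have ng: "(u, v) \<notin> G" unfolding G_eq using assms(2) d by blast
  have "(u, v) \<noteq> (p0, p2)" "(u, v) \<noteq> (p2, p0)" using assms(1) d not_dart by auto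
  moreover have "(u, v) \<noteq> (p1, p2)" "(u, v) \<noteq> (p4, p0)" using ng unfolding G_def by blast+
  ultimately have "\<not> (v = p2 \<and> u = p1)" "\<not> (v = p2 \<and> u = p0)" "\<not> (v = p0 \<and> u = p4)"
    "\<not> (v = p0 \<and> u = p2)" by blast+
  then have "r2 v u = r1 v u" unfolding r2_eq by (simp only: if_False)
  also have "\<dots> = r v u"
    by (rule r1_same[OF vu]) (use assms(2) d in \<open>auto simp: Tri_ab Fq_def\<close>)
  finally show ?thesis by (simp add: d fnext_def)
qed

lemma face_outside: assumes d: "d \<in> DA" "d \<notin> Tri \<union> Fq" shows "face_of r2 d = fc d"
proof (rule face_of_cong)
  fix e assume e: "e \<in> fc d"
  have eD: "e \<in> DA" using fc_sub[OF d(1)] e by blast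
  have "e \<notin> Tri \<union> Fq"
  proof
    assume "e \<in> Tri \<union> Fq"
    then have "fc e = Tri \<or> fc e = Fq" using FF_fc[OF Tri(1), of e] FF_fc[OF Fq(1), of e] by auto
    then have "fc d = Tri \<or> fc d = Fq" using fc_eq[OF d(1) e] by simp
    then show False using d(2) fc_self[of d] by blast
  qed
  then show "fnext r2 e = fnext r e" using fn_outside[OF eD] by blast
qed

lemma outside_face: assumes "f \<in> FF" "f \<noteq> Tri" "f \<noteq> Fq" shows "f \<inter> (Tri \<union> Fq) = {}"
  using FF_disj[OF assms(1) Tri(1) assms(2)] FF_disj[OF assms(1) Fq(1) assms(3)] by blast

lemma faces2: "faces A2 r2 = FF - {Tri, Fq} \<union> {T3, F4}"
proof (intro equalityI subsetI)
  fix f assume "f \<in> faces A2 r2"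
  then obtain d where d: "d \<in> darts A2" "f = face_of r2 d" by (auto simp: faces_def)
  show "f \<in> FF - {Tri, Fq} \<union> {T3, F4}"
  proof (cases "d \<in> T3 \<union> F4")
    case True
    then have "f = T3 \<or> f = F4" unfolding d(2) using face_T3[of d] face_F4[of d] by blast
    then show ?thesis by blast
  next
    case False
    have dD: "d \<in> DA" "d \<noteq> (a, b)" "d \<noteq> (b, a)" using d(1) False T3F4 unfolding darts2 by auto
    then have no: "d \<notin> Tri \<union> Fq" using old_iff[OF dD(1)] False by auto
    have "f = fc d" using d(2) face_outside[OF dD(1) no] by simp
    moreover have "fc d \<in> FF" using dD(1) by (rule fc_FF)
    moreover have "fc d \<noteq> Tri" "fc d \<noteq> Fq" using no fc_self[of d] by auto
    ultimately show ?thesis by simp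
  qed
next
  fix f assume f: "f \<in> FF - {Tri, Fq} \<union> {T3, F4}"
  show "f \<in> faces A2 r2"
  proof (cases "f \<in> {T3, F4}")
    case True
    have "(p2, p0) \<in> darts A2" "(p0, p2) \<in> darts A2" by (simp_all add: darts2)
    moreover have "face_of r2 (p2, p0) = T3" "face_of r2 (p0, p2) = F4"
      using face_T3 face_F4 by (simp_all add: T3_def F4_def)
    ultimately show ?thesis using True unfolding faces_def by blast
  next
    case False
    then have f': "f \<in> FF" "f \<noteq> Tri" "f \<noteq> Fq" using f by auto
    then obtain d where d: "d \<in> f" using FF_ne by blast
    have dD: "d \<in> DA" "d \<notin> Tri \<union> Fq" using d FF_sub[OF f'(1)] outside_face[OF f'] by auto
    have "f = face_of r2 d" using FF_fc[OF f'(1) d] face_outside[OF dD] by simp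
    moreover have "d \<in> darts A2" using dD by (auto simp: darts2 Tri_ab Fq_def)
    ultimately show ?thesis unfolding faces_def by blast
  qed
qed

lemma new_not_old: "T3 \<notin> FF" "F4 \<notin> FF"
  using FF_sub[of T3] FF_sub[of F4] not_dart by (auto simp: T3_def F4_def)

lemma T3_neq_F4: "T3 \<noteq> F4" using cards by auto

lemma plane2: "plane_embedding (verts T) A2 r2"
proof -
  have "simple_graph (verts T) A2"
    unfolding simple_graph_def
  proof (intro conjI allI impI)
    show "finite (verts T)" by (rule finV)
    fix u v assume uv: "A2 u v"
    have pV: "p0 \<in> verts T" "p2 \<in> verts T" using A_V[OF G_A(1)] A_V[OF G_A(2)] by simp_all
    show "u \<in> verts T" "v \<in> verts T" "u \<noteq> v"
      using uv pV neq02 A_V[of u v] A_neq[of u v] by (auto simp: A2_def A1_def doubleton_eq_iff)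
    show "A2 v u" by (rule A2_sym[OF uv])
  qed
  moreover have "connected_graph (verts T) A2"
  proof -
    have "(a, p) \<in> G" "(p, q) \<in> G" "(q, b) \<in> G"
    proof -
      have "(a, p) \<in> Fq" "(p, q) \<in> Fq" "(q, b) \<in> Fq" by (simp_all add: Fq_def)
      then show "(a, p) \<in> G" "(p, q) \<in> G" "(q, b) \<in> G"
        unfolding G_eq using neqs more_neqs by blast+
    qed
    then have "A1 a p" "A1 p q" "A1 q b" using G_A1(1) by metis+
    then have st: "A2 a p" "A2 p q" "A2 q b" by (simp_all add: A2_def)
    have abp: "A2\<^sup>*\<^sup>* a b" using st by (meson converse_rtranclp_into_rtranclp r_into_rtranclp)
    have bap: "A2\<^sup>*\<^sup>* b a" using st[THEN A2_sym] by (meson converse_rtranclp_into_rtranclp r_into_rtranclp)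
    have one: "A2\<^sup>*\<^sup>* u v" if "A u v" for u v
    proof (cases "{u, v} = {a, b}")
      case True
      then show ?thesis using abp bap by (auto simp: doubleton_eq_iff)
    next
      case False
      then have "A2 u v" using that by (simp add: A2_def A1_def)
      then show ?thesis by (rule r_into_rtranclp)
    qed
    have "A2\<^sup>*\<^sup>* u v" if "A\<^sup>*\<^sup>* u v" for u v
      using that by (induction rule: rtranclp_induct) (auto intro: rtranclp_trans one)
    then show ?thesis using A_conn unfolding connected_graph_def by blast
  qed
  moreover have "card (darts A2) = card DA"
  proof -
    have "{(a, b), (b, a)} \<subseteq> DA" using ab edges(1) by simp
    moreover have "card {(a, b), (b, a)} = 2" "card {(p0, p2), (p2, p0)} = 2"
      using neqs(1) neq02 by auto
    moreover have "card DA \<ge> card {(a, b), (b, a)}" using finD \<open>{(a, b), (b, a)} \<subseteq> DA\<close> by (rule card_mono)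
    moreover have "card (darts A2) = card (DA - {(a, b), (b, a)}) + card {(p0, p2), (p2, p0)}"
      unfolding darts2 by (rule card_Un_disjoint) (use finD not_dart in auto)
    ultimately show ?thesis using card_Diff_subset[of "{(a, b), (b, a)}" DA] by simp
  qed
  moreover have "card (faces A2 r2) = card FF"
  proof -
    have "card {Tri, Fq} = 2" "card {T3, F4} = 2" using Fq(3) T3_neq_F4 by auto
    moreover have "{Tri, Fq} \<subseteq> FF" using Tri(1) Fq(1) by simp
    moreover have "card FF \<ge> card {Tri, Fq}" using finFF \<open>{Tri, Fq} \<subseteq> FF\<close> by (rule card_mono)
    moreover have "card (faces A2 r2) = card (FF - {Tri, Fq}) + card {T3, F4}"
      unfolding faces2 by (rule card_Un_disjoint) (use finFF new_not_old in auto)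
    ultimately show ?thesis using card_Diff_subset[of "{Tri, Fq}" FF] by simp
  qed
  ultimately show ?thesis using rs2 euler by (simp add: plane_embedding_def)
qed

definition "refl2 d \<longleftrightarrow> (if d \<in> T3 \<union> F4 then d \<in> F4 \<and> snd d = w0 else reflex T d)"

definition "T2 = T\<lparr>adj := A2, rot := r2, reflex := refl2\<rparr>"

lemma T2_sel: "verts T2 = verts T" "adj T2 = A2" "rot T2 = r2" "outer T2 = outer T" "reflex T2 = refl2"
  by (simp_all add: T2_def)

lemma Fq_reflex: "d \<in> Fq \<Longrightarrow> reflex T d \<Longrightarrow> snd d = w0"
proof -
  assume d: "d \<in> Fq" "reflex T d"
  obtain e where e: "Fq \<inter> RR = {e}" using quad_reflex[OF Fq(1,2,4)] ..
  obtain d' where d': "d' \<in> Fq" "reflex T d'" "snd d' = w0" using w0 by blast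
  have "d \<in> Fq \<inter> RR" "d' \<in> Fq \<inter> RR" using d d' by simp_all
  then show ?thesis unfolding e using d'(3) by simp
qed

lemma F4_refl2: "\<exists>d\<in>F4. {e\<in>F4. refl2 e} = {d} \<and> snd d = w0"
proof -
  have F4r: "{e\<in>F4. refl2 e} = {e\<in>F4. snd e = w0}" by (auto simp: refl2_def)
  have "\<exists>d\<in>F4. {e\<in>F4. snd e = w0} = {d} \<and> snd d = w0"
  proof -
    have "distinct (map snd [(p0, p2), (p2, p3), (p3, p4), (p4, p0)])"
      by (simp add: G_neq G_neq[symmetric] neq02 neq02[symmetric])
    then have "inj_on snd F4" by (simp only: distinct_map F4_def list.set)
    moreover have "(p4, p0) \<in> F4" "(p0, p2) \<in> F4" "(p2, p3) \<in> F4" "(p3, p4) \<in> F4"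
      by (simp_all add: F4_def)
    then have "\<exists>d\<in>F4. snd d = w0" using w0_in by (metis insertE empty_iff snd_conv)
    ultimately show ?thesis unfolding inj_on_def by blast
  qed
  then show ?thesis unfolding F4r .
qed

lemma disj_T3_F4: "T3 \<inter> F4 = {}"
  unfolding T3_def F4_def by (simp add: G_neq G_neq[symmetric] neq02 neq02[symmetric])

lemma refl2_T3: "d \<in> T3 \<Longrightarrow> \<not> refl2 d"
  using disj_T3_F4 by (auto simp: refl2_def)

lemma refl2_out: assumes "d \<in> DA" "d \<notin> Tri \<union> Fq" shows "refl2 d = reflex T d"
  using old_iff[OF assms(1)] assms(2) by (auto simp: refl2_def)

lemma outer2: "outer T \<in> faces A2 r2" "outer T \<noteq> T3" "outer T \<noteq> F4"
  using outer_FF Tri(2) Fq(2) new_not_old unfolding faces2 by (blast, metis, metis)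

text \<open>The flip destroys one reflex angle, that of the old quadrilateral, and creates one, that
  of the new quadrilateral. Both are at \<open>w0\<close>, so the number at every vertex stays
  one.\<close>

lemma pointed2:
  assumes v: "v \<in> verts T" shows "card {d\<in>darts A2. snd d = v \<and> refl2 d} = 1"
proof -
  obtain x where x: "A x v" "reflex T (x, v)" using reflex_ex[OF v] by auto
  have un: "d = (x, v)" if "d \<in> DA" "snd d = v" "reflex T d" for d
    using that reflex_unique[OF _ x(1) _ x(2)] by (cases d) auto
  have xnT: "(x, v) \<notin> Tri" using tri_no_reflex[OF Tri] x(2) by auto
  obtain f where f: "f \<in> F4" "{e\<in>F4. refl2 e} = {f}" "snd f = w0" using F4_refl2 by blast
  have new: "d \<in> darts A2 \<and> refl2 d \<longleftrightarrow> d = f \<or> (d \<in> DA \<and> d \<notin> Tri \<union> Fq \<and> reflex T d)" for d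
  proof (cases "d \<in> T3 \<union> F4")
    case True
    have "d \<in> darts A2" using True G_DA unfolding T3F4 darts2 G_eq by auto
    moreover have "refl2 d \<longleftrightarrow> d = f" using True f(1,2) refl2_T3 by blast
    moreover have "d \<in> DA \<Longrightarrow> d \<in> Tri \<union> Fq" using True old_iff by blast
    ultimately show ?thesis by blast
  next
    case False
    then have "d \<noteq> f" using f(1) by auto
    moreover have "d \<in> darts A2 \<longleftrightarrow> d \<in> DA \<and> d \<notin> Tri \<union> Fq"
      using False old_iff[of d] unfolding darts2 T3F4 by (auto simp: Tri_ab Fq_def)
    moreover have "refl2 d = reflex T d" using False by (simp add: refl2_def)
    ultimately show ?thesis by blast
  qed
  show ?thesis
  proof (cases "v = w0")
    case True
    have "(x, v) \<in> Fq"
    proof -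
      obtain d where d: "d \<in> Fq" "reflex T d" "snd d = w0" using w0 by blast
      have "d \<in> DA" using d(1) FF_sub[OF Fq(1)] by blast
      then show ?thesis using un[of d] True d by simp
    qed
    have "d \<in> darts A2 \<and> snd d = v \<and> refl2 d \<longleftrightarrow> d = f" for d
      using new[of d] un[of d] True f(3) \<open>(x, v) \<in> Fq\<close> by auto
    then have "{d\<in>darts A2. snd d = v \<and> refl2 d} = {f}" by blast
    then show ?thesis by simp
  next
    case False
    have "(x, v) \<notin> Fq" using Fq_reflex[of "(x, v)"] x(2) False by auto
    then have xv: "(x, v) \<in> DA \<and> (x, v) \<notin> Tri \<union> Fq \<and> reflex T (x, v)" using xnT x by simp
    have "d \<in> darts A2 \<and> snd d = v \<and> refl2 d \<longleftrightarrow> d = (x, v)" for d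
      using new[of d] un[of d] False f(3) xv by auto
    then have "{d\<in>darts A2. snd d = v \<and> refl2 d} = {(x, v)}" by blast
    then show ?thesis by simp
  qed
qed

lemma four2: "four_ppt T2"
proof -
  have conv: "card {d\<in>f. \<not> refl2 d} = 3 \<and> (card f = 3 \<or> card f = 4)"
    if f: "f \<in> faces A2 r2" "f \<noteq> outer T" for f
  proof -
    consider "f = T3" | "f = F4" | "f \<in> FF" "f \<noteq> Tri" "f \<noteq> Fq" using f(1) faces2 by auto
    then show ?thesis
    proof cases
      case 1
      then have "{d\<in>f. \<not> refl2 d} = T3" using refl2_T3 by auto
      then show ?thesis using 1 cards by simp
    next
      case 2
      obtain e where e: "e \<in> F4" "{d\<in>F4. refl2 d} = {e}" using F4_refl2 by blast
      have "{d\<in>f. \<not> refl2 d} = F4 - {e}" using 2 e(2) by blast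
      then show ?thesis using 2 cards e(1) by (simp add: card_Diff_singleton)
    next
      case 3
      have "refl2 d = reflex T d" if "d \<in> f" for d
        using refl2_out outside_face[OF 3] FF_sub[OF 3(1)] that by blast
      then have "{d\<in>f. \<not> refl2 d} = {d\<in>f. \<not> reflex T d}" by auto
      then show ?thesis using int_convex[OF 3(1) f(2)] int_card[OF 3(1) f(2)] by simp
    qed
  qed
  have "\<forall>d\<in>outer T. refl2 d"
    using outer_reflex refl2_out outside_face[OF outer_FF Tri(2)[symmetric] Fq(2)[symmetric]]
      FF_sub[OF outer_FF] by blast
  then show ?thesis unfolding four_ppt_def comb_pt_def pointed_def interior_faces_def T2_sel
    using plane2 outer2(1) conv pointed2 by simp
qed

lemma ppt2: "ppt T2" using four2 card_outer by unfold_locales (simp_all add: T2_sel)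

lemma flip_to: "flip T T2"
  unfolding flip_def
proof (intro exI conjI)
  show "four_ppt T" by (rule four)
  show "four_ppt T2" by (rule four2)
  show "verts T2 = verts T" "outer T2 = outer T" by (simp_all add: T2_sel)
  show "Tri \<in> interior_faces T" using Tri by (simp add: interior_faces_def)
  show "card Tri = 3" by (rule Tri(3))
  show "(a, b) \<in> Tri" by (simp add: Tri_ab)
  show "(a, b) \<notin> outer T" "(b, a) \<notin> outer T" by (rule ab_int)+
  show "Fq = fc (b, a)" by (rule fc_ba[symmetric])
  have a1: "(\<lambda>u v. A u v \<and> {u, v} \<noteq> {a, b}) = A1" by (intro ext) (simp add: A1_def)
  have a2: "(\<lambda>u v. A1 u v \<or> {u, v} = {p0, p2}) = A2" by (intro ext) (simp add: A2_def)
  have c: "card (face_of r2 (p0, p2)) = 4" "card (face_of r2 (p2, p0)) = 3"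
    using face_T3[of "(p2, p0)"] face_F4[of "(p0, p2)"] cards by (simp_all add: T3_def F4_def)
  have G: "(p4, p0) \<in> Tri \<union> Fq - {(a, b), (b, a)}" "(p1, p2) \<in> Tri \<union> Fq - {(a, b), (b, a)}"
    unfolding G_eq[symmetric] by (simp_all add: G_def)
  have keep: "\<forall>f\<in>faces A r - {Tri, Fq}. \<forall>d\<in>f. reflex T2 d = reflex T d"
    using refl2_out outside_face FF_sub unfolding T2_sel by blast
  show "let A1 = (\<lambda>u v. A u v \<and> {u, v} \<noteq> {a, b});
          r1 = rot_remove (rot_remove r a b) b a;
          r2 = rot_insert (rot_insert r1 p0 p4 p2) p2 p1 p0;
          A2 = (\<lambda>u v. A1 u v \<or> {u, v} = {p0, p2});
          R = (Tri \<union> Fq) - {(a, b), (b, a)}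
      in p0 \<noteq> p2 \<and> \<not> A p0 p2 \<and> {p0, p2} \<noteq> {a, b} \<and>
         (p4, p0) \<in> R \<and> (p1, p2) \<in> R \<and>
         adj T2 = A2 \<and> (\<forall>v w. A2 v w \<longrightarrow> rot T2 v w = r2 v w) \<and>
         {card (face_of r2 (p0, p2)), card (face_of r2 (p2, p0))} = {3, card Fq} \<and>
         (\<forall>f\<in>faces A r - {Tri, Fq}. \<forall>\<delta>\<in>f. reflex T2 \<delta> = reflex T \<delta>)"
    unfolding Let_def a1 r1_def[symmetric] r2_def[symmetric] a2
    using neq02 nadj ab edges(1) G keep c Fq(4) by (auto simp: T2_sel doubleton_eq_iff)
qed

text \<open>The inverse flip deletes \<open>p0 p2\<close> and reinserts \<open>ab\<close> into the
  corners entered by \<open>(z, a)\<close> and \<open>(q, b)\<close>. Off the actual edges the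
  resulting rotation function need not be the old one, so all comparisons with \<open>r1\<close> and
  \<open>r\<close> are made under adjacency, which is what \<open>flip\<close> asks for.\<close>

lemma flip_back: "flip T2 T"
  unfolding flip_def
proof (intro exI conjI)
  show "four_ppt T" by (rule four)
  show "four_ppt T2" by (rule four2)
  show "verts T = verts T2" "outer T = outer T2" by (simp_all add: T2_sel)
  show "T3 \<in> interior_faces T2" using outer2 by (simp add: interior_faces_def T2_sel faces2)
  show "card T3 = 3" by (rule cards)
  show "(p2, p0) \<in> T3" by (simp add: T3_def)
  show "(p2, p0) \<notin> outer T2" "(p0, p2) \<notin> outer T2"
    using not_dart FF_sub[OF outer_FF] by (auto simp: T2_sel)
  show "F4 = face_of (rot T2) (p0, p2)" using face_F4[of "(p0, p2)"] by (simp add: T2_sel F4_def)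
  have a1: "(\<lambda>u v. A2 u v \<and> {u, v} \<noteq> {p2, p0}) = A1"
    using nadj A_sym[of p2 p0] by (intro ext) (auto simp: A2_def A1_def doubleton_eq_iff)
  have a2: "(\<lambda>u v. A1 u v \<or> {u, v} = {a, b}) = A"
    using ab edges(1) by (intro ext) (auto simp: A1_def doubleton_eq_iff)
  define r1' where "r1' = rot_remove (rot_remove r2 p2 p0) p0 p2"
  define r0 where "r0 = rot_insert (rot_insert r1' a z b) b q a"
  have r1': "r1' v w = r1 v w" if "A1 v w" for v w
  proof -
    have "v \<in> verts T" using that A_V[of v w] by (simp add: A1_def)
    then have cl: "A1 v (r1 v w)" using rs1 that unfolding rotation_system_def by blast
    then have n: "\<not> (v = p0 \<and> r1 v w = p2)" "\<not> (v = p2 \<and> r1 v w = p0)"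
      and n': "\<not> (v = p0 \<and> w = p2)" "\<not> (v = p2 \<and> w = p0)"
      using that not_dart by (auto simp: A1_def)
    have v2: "r2 p2 p0 = p3" "r2 p0 p2 = p1" "r2 p2 p1 = p0" "r2 p0 p4 = p2"
      by (simp_all add: r2_eq neq02 neq02[symmetric] G_neq G_neq[symmetric])
    show ?thesis
    proof (cases "v = p0")
      case True
      have e: "r1' v w = (if r2 p0 w = p2 then p1 else r2 p0 w)"
        using True neq02 v2(2) by (simp add: r1'_def rot_remove_def)
      show ?thesis
      proof (cases "w = p4")
        case True
        then show ?thesis using e v2(4) G_rots(5) \<open>v = p0\<close> by simp
      next
        case False
        then have "r2 p0 w = r1 p0 w" using n'(1) True neq02 by (simp add: r2_eq)
        then show ?thesis using e n(1) True by simp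
      qed
    next
      case False
      show ?thesis
      proof (cases "v = p2")
        case True
        have e: "r1' v w = (if r2 p2 w = p0 then p3 else r2 p2 w)"
          using True neq02 v2(1) by (simp add: r1'_def rot_remove_def)
        show ?thesis
        proof (cases "w = p1")
          case True
          then show ?thesis using e v2(3) G_rots(2) \<open>v = p2\<close> by simp
        next
          case False
          then have "r2 p2 w = r1 p2 w" using n'(2) True neq02 by (simp add: r2_eq)
          then show ?thesis using e n(2) True by simp
        qed
      next
        case False
        then show ?thesis using \<open>v \<noteq> p0\<close> by (simp add: r1'_def rot_remove_def r2_eq)
      qed
    qed
  qed
  have A1s: "A1 a z" "A1 b q"
    by (simp_all add: A1_def doubleton_eq_iff edges neqs neqs[symmetric] more_neqs more_neqs[symmetric])
  have r0: "r0 v w = r v w" if vw: "A v w" for v w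
  proof -
    have ra: "r1' a z = p" using r1'[OF A1s(1)] neqs by (simp add: r1_eq rots)
    have rb: "r1' b q = z" using r1'[OF A1s(2)] neqs by (simp add: r1_eq rots)
    have e: "r0 v w = (if v = b \<and> w = q then a else if v = b \<and> w = a then z
      else if v = a \<and> w = z then b else if v = a \<and> w = b then p else r1' v w)"
      using neqs ra rb by (simp add: r0_def rot_insert_def)
    show ?thesis
    proof (cases "{v, w} = {a, b} \<or> (v = b \<and> w = q) \<or> (v = a \<and> w = z)")
      case True
      then consider "v = a" "w = b" | "v = b" "w = a" | "v = b" "w = q" | "v = a" "w = z"
        by (auto simp: doubleton_eq_iff)
      then show ?thesis unfolding e
        by cases (simp_all add: rots neqs neqs[symmetric] more_neqs more_neqs[symmetric])
    next
      case False
      then have "A1 v w" using vw by (simp add: A1_def)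
      moreover have "\<not> (v = b \<and> w = q)" "\<not> (v = b \<and> w = a)" "\<not> (v = a \<and> w = z)" "\<not> (v = a \<and> w = b)"
        using False by (auto simp: doubleton_eq_iff)
      then have "r0 v w = r1' v w" unfolding e by (simp only: if_False)
      ultimately have "r0 v w = r1 v w" using r1' by simp
      also have "\<dots> = r v w" by (rule r1_same[OF vw]) (use False in auto)
      finally show ?thesis .
    qed
  qed
  have r0': "\<forall>v w. A1 v w \<or> {v, w} = {a, b} \<longrightarrow> r v w = r0 v w"
    using r0 fun_cong[OF fun_cong[OF a2]] by metis
  have fr: "face_of r0 d = fc d" if "d \<in> DA" for d
  proof (rule face_of_cong)
    fix e assume "e \<in> fc d"
    then have "e \<in> DA" using fc_sub[OF that] by blast
    then show "fnext r0 e = fnext r e" using r0[of "snd e" "fst e"] A_sym[of "fst e" "snd e"]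
      by (cases e) (auto simp: fnext_def)
  qed
  have c: "card (face_of r0 (a, b)) = 3" "card (face_of r0 (b, a)) = 4"
    using fr[of "(a, b)"] fr[of "(b, a)"] ab edges(1) fc_ab Tri_ab Tri(3) fc_ba Fq(4) by auto
  have G: "(z, a) \<in> T3 \<union> F4 - {(p2, p0), (p0, p2)}" "(q, b) \<in> T3 \<union> F4 - {(p2, p0), (p0, p2)}"
  proof -
    have "(z, a) \<in> Tri" "(q, b) \<in> Fq" by (simp_all add: Tri_ab Fq_def)
    moreover have "(z, a) \<in> DA" "(q, b) \<in> DA" using edges by simp_all
    moreover from this(1,2) have "(z, a) \<notin> {(p2, p0), (p0, p2)}" "(q, b) \<notin> {(p2, p0), (p0, p2)}"
      using not_dart by (metis insertE empty_iff)+
    moreover have "(z, a) \<notin> {(a, b), (b, a)}" "(q, b) \<notin> {(a, b), (b, a)}"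
      using neqs more_neqs by simp_all
    ultimately show "(z, a) \<in> T3 \<union> F4 - {(p2, p0), (p0, p2)}" "(q, b) \<in> T3 \<union> F4 - {(p2, p0), (p0, p2)}"
      unfolding T3F4 G_eq by blast+
  qed
  have nab: "\<not> A2 a b"
    using ab nadj not_dart by (auto simp: A2_def A1_def doubleton_eq_iff)
  have keep: "\<forall>f\<in>faces A2 r2 - {T3, F4}. \<forall>d\<in>f. reflex T d = reflex T2 d"
    using refl2_out outside_face FF_sub unfolding T2_sel faces2 by blast
  have ne: "{a, b} \<noteq> {p2, p0}" using ab edges(1) not_dart by (auto simp: doubleton_eq_iff)
  show "let A1 = (\<lambda>u v. adj T2 u v \<and> {u, v} \<noteq> {p2, p0});
          r1 = rot_remove (rot_remove (rot T2) p2 p0) p0 p2;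
          r2 = rot_insert (rot_insert r1 a z b) b q a;
          A2 = (\<lambda>u v. A1 u v \<or> {u, v} = {a, b});
          R = (T3 \<union> F4) - {(p2, p0), (p0, p2)}
      in a \<noteq> b \<and> \<not> adj T2 a b \<and> {a, b} \<noteq> {p2, p0} \<and>
         (z, a) \<in> R \<and> (q, b) \<in> R \<and>
         adj T = A2 \<and> (\<forall>v w. A2 v w \<longrightarrow> rot T v w = r2 v w) \<and>
         {card (face_of r2 (a, b)), card (face_of r2 (b, a))} = {3, card F4} \<and>
         (\<forall>f\<in>faces (adj T2) (rot T2) - {T3, F4}. \<forall>\<delta>\<in>f. reflex T \<delta> = reflex T2 \<delta>)"
    unfolding Let_def T2_sel(2,3) a1 r1'_def[symmetric] r0_def[symmetric] a2
    by (intro conjI neqs(1) nab ne G refl r0' keep) (simp add: c cards(2))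
qed

end

section \<open>Sweeping the triangle around a corner\<close>

text \<open>A vertex all of whose corners are frozen. New edges are inserted into corners outside
  \<open>K\<close>, so it cannot acquire one.\<close>

definition internal :: "cppt \<Rightarrow> (nat \<times> nat) set \<Rightarrow> nat \<Rightarrow> bool" where
  "internal T K t \<longleftrightarrow> (\<forall>x. adj T x t \<longrightarrow> (x, t) \<in> K)"

text \<open>A flip that leaves the outside \<open>K\<close> untouched, together with all that is
  needed to iterate: the result is again a \<open>ppt\<close>, internal vertices stay internal, and
  the triangle stays off \<open>K\<close>. Both directions of the flip are recorded for the reversal
  at the very end.\<close>

definition frozen_flip :: "(nat \<times> nat) set \<Rightarrow> cppt \<Rightarrow> cppt \<Rightarrow> bool" where
  "frozen_flip K T T' \<longleftrightarrow> ppt T' \<and> flip T T' \<and> flip T' T \<and> verts T' = verts T \<and> outer T' = outer T \<and>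
     (\<forall>x y. (x, y) \<in> K \<longrightarrow> adj T' x y \<and> rot T' y x = rot T y x \<and> (reflex T' (x, y) \<longleftrightarrow> reflex T (x, y))) \<and>
     (\<forall>t. internal T K t \<longrightarrow> internal T' K t) \<and> ppt.Tri T' \<inter> K = {}"

lemma frozen_flipD:
  assumes "frozen_flip K T T'"
  shows "ppt T'" "flip T T'" "flip T' T" "verts T' = verts T" "outer T' = outer T"
    "\<And>x y. (x, y) \<in> K \<Longrightarrow> adj T' x y" "\<And>x y. (x, y) \<in> K \<Longrightarrow> rot T' y x = rot T y x"
    "\<And>x y. (x, y) \<in> K \<Longrightarrow> reflex T' (x, y) \<longleftrightarrow> reflex T (x, y)"
    "\<And>t. internal T K t \<Longrightarrow> internal T' K t" "ppt.Tri T' \<inter> K = {}"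
  using assms unfolding frozen_flip_def by simp_all

lemma (in diagonal_flip) Tri_T2: "ppt.Tri T2 = T3"
proof -
  have "T3 \<in> faces (adj T2) (rot T2)" by (simp add: T2_sel faces2)
  moreover have "T3 \<noteq> outer T2" using outer2(2) by (simp add: T2_sel)
  ultimately show ?thesis using ppt.TriI[OF ppt2 _ _ cards(1)] by simp
qed

lemma (in diagonal_flip) frozen_flip_T2:
  assumes K: "K \<subseteq> DA" "K \<inter> (Tri \<union> Fq) = {}"
  shows "frozen_flip K T T2"
  unfolding frozen_flip_def
proof (intro conjI allI impI)
  show "ppt T2" by (rule ppt2)
  show "flip T T2" by (rule flip_to)
  show "flip T2 T" by (rule flip_back)
  show "verts T2 = verts T" "outer T2 = outer T" by (simp_all add: T2_sel)
  {
    fix x y assume xy: "(x, y) \<in> K"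
    then have d: "(x, y) \<in> DA" "(x, y) \<notin> Tri \<union> Fq" using K by blast+
    have "(a, b) \<in> Tri" "(b, a) \<in> Fq" by (simp_all add: Tri_ab Fq_def)
    then have "(x, y) \<noteq> (a, b)" "(x, y) \<noteq> (b, a)" using d(2) by blast+
    then have "(x, y) \<in> darts A2" unfolding darts2 using d(1) by blast
    then show "adj T2 x y" by (simp add: T2_sel darts_def)
    show "rot T2 y x = r y x" using fn_outside[OF d] by (simp add: fnext_def T2_sel)
    show "reflex T2 (x, y) \<longleftrightarrow> reflex T (x, y)" using refl2_out[OF d] by (simp add: T2_sel)
  }
  have "T3 \<subseteq> G \<union> {(p0, p2), (p2, p0)}" using T3F4 by blast
  then have "T3 \<inter> K = {}" using K not_dart unfolding G_eq by blast
  then show "ppt.Tri T2 \<inter> K = {}" by (simp add: Tri_T2)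
  fix t assume t: "internal T K t"
  \<comment> \<open>The ends of the new edge have an incoming dart on the pentagon, hence outside
    \<open>K\<close>, so neither of them is internal.\<close>
  have "(p4, p0) \<in> G" "(p1, p2) \<in> G" by (simp_all add: G_def)
  then have "(p4, p0) \<in> DA" "(p1, p2) \<in> DA" "(p4, p0) \<notin> K" "(p1, p2) \<notin> K"
    using G_DA K(2) unfolding G_eq by blast+
  then have "t \<noteq> p0" "t \<noteq> p2" using t unfolding internal_def by auto
  then show "internal T2 K t"
    using t unfolding internal_def T2_sel A2_def A1_def by (auto simp: doubleton_eq_iff)
qed

text \<open>The inside of the 3-cycle \<open>w u v\<close> is still free, the outside \<open>K\<close> is frozen.  The last clause
  says that from \<open>K\<close> one reaches the outer face by crossing edges at internal vertices only, so no
  3-cycle through vertices that are not internal can block the way.\<close>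

definition enclosed :: "cppt \<Rightarrow> (nat \<times> nat) set \<Rightarrow> nat \<Rightarrow> nat \<Rightarrow> nat \<Rightarrow> bool" where
  "enclosed T K w u v \<longleftrightarrow>
     K \<subseteq> darts (adj T) \<and> (\<forall>x y. (x, y) \<in> K \<longrightarrow> (y, rot T y x) \<in> K) \<and>
     (w, u) \<in> K \<and> (u, v) \<in> K \<and> (v, w) \<in> K \<and> (u, w) \<notin> K \<and> (v, u) \<notin> K \<and> (w, v) \<notin> K \<and>
     (\<forall>x y. (x, y) \<in> K \<longrightarrow> (y, x) \<notin> K \<longrightarrow> (x, y) = (w, u) \<or> (x, y) = (u, v) \<or> (x, y) = (v, w)) \<and>
     (\<forall>x y. adj T x y \<longrightarrow> reflex T (x, y) \<longrightarrow> y = w \<or> y = u \<or> y = v \<longrightarrow> (x, y) \<in> K) \<and>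
     outer T \<subseteq> K \<and>
     (\<forall>P. (\<forall>x y. (x, y) \<in> K \<longrightarrow> (x, y) \<in> P \<longrightarrow> (y, rot T y x) \<in> P) \<longrightarrow>
          (\<forall>x y. (x, y) \<in> K \<longrightarrow> (y, x) \<in> K \<longrightarrow> (x, y) \<in> P \<longrightarrow>
             internal T K x \<or> internal T K y \<longrightarrow> (y, x) \<in> P) \<longrightarrow>
          (\<exists>d\<in>K. d \<in> P) \<longrightarrow> (\<exists>d\<in>outer T. d \<in> P))"

lemma enclosedD:
  assumes "enclosed T K w u v"
  shows "K \<subseteq> darts (adj T)" "\<forall>x y. (x, y) \<in> K \<longrightarrow> (y, rot T y x) \<in> K"
    "(w, u) \<in> K" "(u, v) \<in> K" "(v, w) \<in> K" "(u, w) \<notin> K" "(v, u) \<notin> K" "(w, v) \<notin> K"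
    "\<forall>x y. (x, y) \<in> K \<longrightarrow> (y, x) \<notin> K \<longrightarrow> (x, y) = (w, u) \<or> (x, y) = (u, v) \<or> (x, y) = (v, w)"
    "\<forall>x y. adj T x y \<longrightarrow> reflex T (x, y) \<longrightarrow> y = w \<or> y = u \<or> y = v \<longrightarrow> (x, y) \<in> K"
    "outer T \<subseteq> K"
    "\<forall>P. (\<forall>x y. (x, y) \<in> K \<longrightarrow> (x, y) \<in> P \<longrightarrow> (y, rot T y x) \<in> P) \<longrightarrow>
          (\<forall>x y. (x, y) \<in> K \<longrightarrow> (y, x) \<in> K \<longrightarrow> (x, y) \<in> P \<longrightarrow>
             internal T K x \<or> internal T K y \<longrightarrow> (y, x) \<in> P) \<longrightarrow>
          (\<exists>d\<in>K. d \<in> P) \<longrightarrow> (\<exists>d\<in>outer T. d \<in> P)"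
  by ((insert assms, unfold enclosed_def, elim conjE, assumption)+)

text \<open>The three corners play equal roles, so a sweep proved for \<open>u\<close> is also
  available around \<open>v\<close> and \<open>w\<close>.\<close>

lemma enclosed_rotate: "enclosed T K w u v \<Longrightarrow> enclosed T K u v w"
  unfolding enclosed_def by (elim conjE, intro conjI) (assumption | blast)+

lemma enclosed_frozen_flip:
  assumes "ppt T" and R: "enclosed T K w u v" and S: "frozen_flip K T T'"
  shows "enclosed T' K w u v"
proof -
  interpret T: ppt T by (rule assms(1))
  interpret T': ppt T' using S by (simp add: frozen_flip_def)
  have K: "K \<subseteq> darts (adj T)" "\<And>x y. (x, y) \<in> K \<Longrightarrow> (y, rot T y x) \<in> K"
    "(w, u) \<in> K" "(u, v) \<in> K" "(v, w) \<in> K" "(u, w) \<notin> K" "(v, u) \<notin> K" "(w, v) \<notin> K"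
    "\<forall>x y. (x, y) \<in> K \<longrightarrow> (y, x) \<notin> K \<longrightarrow> (x, y) = (w, u) \<or> (x, y) = (u, v) \<or> (x, y) = (v, w)"
    "outer T \<subseteq> K"
    using enclosedD(1-9,11)[OF R] by simp_all
  have K10: "\<And>x y. adj T x y \<Longrightarrow> reflex T (x, y) \<Longrightarrow> y = w \<or> y = u \<or> y = v \<Longrightarrow> (x, y) \<in> K"
    using enclosedD(10)[OF R] by blast
  have S': "\<And>x y. (x, y) \<in> K \<Longrightarrow> adj T' x y" "\<And>x y. (x, y) \<in> K \<Longrightarrow> rot T' y x = rot T y x"
    "\<And>x y. (x, y) \<in> K \<Longrightarrow> reflex T' (x, y) \<longleftrightarrow> reflex T (x, y)"
    "\<And>t. internal T K t \<Longrightarrow> internal T' K t" "outer T' = outer T" "verts T' = verts T"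
    using frozen_flipD[OF S] by simp_all
  \<comment> \<open>The reflex angle at a corner vertex is frozen, so it is still present after the
    flip, and pointedness leaves no room for another one.\<close>
  have refl': "(x, y) \<in> K" if xy: "adj T' x y" "reflex T' (x, y)" "y = w \<or> y = u \<or> y = v" for x y
  proof -
    have "y \<in> verts T" using T'.A_V(2)[OF xy(1)] S'(6) by simp
    then obtain x0 where x0: "adj T x0 y" "reflex T (x0, y)" using T.reflex_ex by blast
    then have k: "(x0, y) \<in> K" using K10 xy(3) by blast
    then have "x = x0" using T'.reflex_unique[OF xy(1) S'(1)[OF k] xy(2)] S'(3)[OF k] x0(2) by blast
    then show ?thesis using k by simp
  qed
  show ?thesis unfolding enclosed_def
  proof (intro conjI allI impI)
    show "K \<subseteq> darts (adj T')" using S'(1) by (auto simp: darts_def)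
    fix x y assume "(x, y) \<in> K"
    then show "(y, rot T' y x) \<in> K" using K(2) S'(2) by simp
  next
    fix P
    assume 1: "\<forall>x y. (x, y) \<in> K \<longrightarrow> (x, y) \<in> P \<longrightarrow> (y, rot T' y x) \<in> P"
      and 2: "\<forall>x y. (x, y) \<in> K \<longrightarrow> (y, x) \<in> K \<longrightarrow> (x, y) \<in> P \<longrightarrow>
             internal T' K x \<or> internal T' K y \<longrightarrow> (y, x) \<in> P"
      and 3: "\<exists>d\<in>K. d \<in> P"
    have "\<exists>d\<in>outer T. d \<in> P"
    proof (rule enclosedD(12)[OF R, THEN spec[where x = P], THEN mp, THEN mp, THEN mp, OF _ _ 3])
      show "\<forall>x y. (x, y) \<in> K \<longrightarrow> (x, y) \<in> P \<longrightarrow> (y, rot T y x) \<in> P" using 1 S'(2) by metis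
      show "\<forall>x y. (x, y) \<in> K \<longrightarrow> (y, x) \<in> K \<longrightarrow> (x, y) \<in> P \<longrightarrow>
             internal T K x \<or> internal T K y \<longrightarrow> (y, x) \<in> P" using 2 S'(4) by metis
    qed
    then show "\<exists>d\<in>outer T'. d \<in> P" using S'(5) by simp
  qed (use K(3-10) S'(5) refl' in auto)
qed

locale region = ppt +
  fixes K :: "(nat \<times> nat) set" and w u v :: nat
  assumes enclosed: "enclosed T K w u v"
begin

lemma K_DA: "K \<subseteq> DA" and K_next: "(x, y) \<in> K \<Longrightarrow> (y, r y x) \<in> K"
  and K_in: "(w, u) \<in> K" "(u, v) \<in> K" "(v, w) \<in> K" and K_out: "(u, w) \<notin> K" "(v, u) \<notin> K" "(w, v) \<notin> K"
  and K_bd: "(x, y) \<in> K \<Longrightarrow> (y, x) \<notin> K \<Longrightarrow> (x, y) = (w, u) \<or> (x, y) = (u, v) \<or> (x, y) = (v, w)"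
  and K_outer: "outer T \<subseteq> K"
  using enclosedD(1-9,11)[OF enclosed] by simp_all

lemma K_reflex: "A x y \<Longrightarrow> reflex T (x, y) \<Longrightarrow> y = w \<or> y = u \<or> y = v \<Longrightarrow> (x, y) \<in> K"
  using enclosedD(10)[OF enclosed] by blast

lemma K_A: "(x, y) \<in> K \<Longrightarrow> A x y" using K_DA by auto

lemma A_corner: "A w u" "A u w" "A u v" "A v u" "A v w" "A w v"
proof -
  show 1: "A w u" "A u v" "A v w" using K_in[THEN K_A] by this+
  show "A u w" "A v u" "A w v" using 1[THEN A_sym] by this+
qed

lemma corner_neq: "w \<noteq> u" "u \<noteq> v" "v \<noteq> w" using A_corner A_neq by blast+

lemma K_face: assumes "(x, y) \<in> K" shows "fc (x, y) \<subseteq> K"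
proof -
  have "(fnext r ^^ k) (x, y) \<in> K" for k
    by (induction k) (use assms K_next in \<open>auto simp: fnext_def split: prod.split\<close>)
  then show ?thesis unfolding face_of_def by blast
qed

lemma notK_face: assumes "A x y" "(x, y) \<notin> K" shows "fc (x, y) \<inter> K = {}"
proof (rule ccontr)
  assume "fc (x, y) \<inter> K \<noteq> {}"
  then obtain d where d: "d \<in> fc (x, y)" "d \<in> K" by blast
  have "fc d = fc (x, y)" by (rule fc_eq[OF _ d(1)]) (use assms in simp)
  then have "fc (x, y) \<subseteq> K" using K_face[of "fst d" "snd d"] d(2) by simp
  then show False using fc_self[of "(x, y)"] assms(2) by blast
qed

text \<open>No edge of the cycle ends at an internal vertex, so the escape route of the last clause
  of \<open>enclosed\<close>, applied to the set of darts whose faces are inside, never crosses the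
  cycle. It would lead from a frozen inside dart to the outer face, against
  \<open>outer_not_inside\<close>.\<close>

lemma exit_K:
  assumes D: "three_cycle x y z" and I: "\<not> internal T K x" "\<not> internal T K y" "\<not> internal T K z"
    and d: "(s, t) \<in> K" "inside x y z (fc (s, t))"
  shows False
proof -
  let ?P = "{d. inside x y z (fc d)}"
  have "\<exists>d\<in>outer T. d \<in> ?P"
  proof -
    have 1: "\<forall>x' y'. (x', y') \<in> K \<longrightarrow> (x', y') \<in> ?P \<longrightarrow> (y', r y' x') \<in> ?P"
    proof (intro allI impI)
      fix x' y' assume "(x', y') \<in> K" "(x', y') \<in> ?P"
      then show "(y', r y' x') \<in> ?P" using fc_fn[of "(x', y')"] K_A by (simp add: fnext_def)
    qed
    have 2: "\<forall>x' y'. (x', y') \<in> K \<longrightarrow> (y', x') \<in> K \<longrightarrow> (x', y') \<in> ?P \<longrightarrow>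
             internal T K x' \<or> internal T K y' \<longrightarrow> (y', x') \<in> ?P"
    proof (intro allI impI)
      fix x' y' assume a: "(x', y') \<in> K" "(x', y') \<in> ?P" "internal T K x' \<or> internal T K y'"
      have "(x', y') \<notin> cyc x y z" using a(3) I by (auto simp: cyc_def)
      then show "(y', x') \<in> ?P" using inside_step[of x y z x' y'] a K_A by simp
    qed
    have 3: "\<exists>d\<in>K. d \<in> ?P" using d by blast
    show ?thesis using enclosedD(12)[OF enclosed, rule_format, OF 1[rule_format] 2[rule_format] 3] by blast
  qed
  then obtain e where e: "e \<in> outer T" "inside x y z (fc e)" by blast
  have "fc e = outer T" using FF_fc[OF outer_FF e(1)] by simp
  then show False using outer_not_inside[OF D] e(2) by simp
qed

lemma not_internal: "A x y \<Longrightarrow> (x, y) \<notin> K \<Longrightarrow> \<not> internal T K y"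
  by (auto simp: internal_def)

end

text \<open>None of the edges at a vertex off the cycle belongs to the cycle, so turning around it
  never leaves the inside.\<close>

lemma (in ppt) inside_around:
  assumes "c \<notin> {x, y, z}" "A s c" "inside x y z (fc (s, c))" "A t c"
  shows "inside x y z (fc (t, c))"
proof -
  obtain k where k: "(r c ^^ k) s = t" using rot_trans[of c s t] A_sym assms(2,4) by blast
  have "A c ((r c ^^ j) s) \<and> inside x y z (fc ((r c ^^ j) s, c))" for j
  proof (induction j)
    case 0 then show ?case using assms A_sym[OF assms(2)] by simp
  next
    case (Suc j)
    let ?e = "(r c ^^ j) s"
    have e: "A c ?e" "inside x y z (fc (?e, c))" using Suc by auto
    have "fc (c, r c ?e) = fc (?e, c)" using fc_fn[of "(?e, c)"] A_sym[OF e(1)] by (simp add: fnext_def)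
    moreover have "(c, r c ?e) \<notin> cyc x y z" using assms(1) by (auto simp: cyc_def)
    ultimately have "inside x y z (fc (r c ?e, c))" using inside_step rot_A[OF e(1)] e(2) by metis
    then show ?case using rot_A[OF e(1)] by simp
  qed
  then show ?thesis using k by metis
qed

lemma (in diagonal_flip) rot2:
  "rot T2 p0 p2 = p1" "rot T2 p1 p0 = p2" "rot T2 p2 p1 = p0"
  "rot T2 p2 p0 = p3" "rot T2 p3 p2 = p4" "rot T2 p4 p3 = p0" "rot T2 p0 p4 = p2"
  using fn2 by (simp_all add: fnext_def T2_sel)

lemma (in diagonal_flip) rot_outside:
  "A x y \<Longrightarrow> (x, y) \<notin> Tri \<Longrightarrow> (x, y) \<notin> Fq \<Longrightarrow> rot T2 y x = r y x"
  using fn_outside[of "(x, y)"] by (simp add: fnext_def T2_sel)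

lemma (in diagonal_flip) adj2:
  "adj T2 x y \<longleftrightarrow> A x y \<and> \<not> (x = a \<and> y = b) \<and> \<not> (x = b \<and> y = a) \<or> x = p0 \<and> y = p2 \<or> x = p2 \<and> y = p0"
  by (auto simp: T2_sel A2_def A1_def doubleton_eq_iff)

lemma (in edge_flip) w0_ex:
  obtains w0 where "\<exists>d\<in>Fq. reflex T d \<and> snd d = w0" "w0 \<in> {a, p, q, b}"
proof -
  obtain d where d: "Fq \<inter> RR = {d}" using quad_reflex[OF Fq(1,2,4)] ..
  then have "d \<in> Fq" "reflex T d" by blast+
  moreover from this(1) have "snd d \<in> {a, p, q, b}" unfolding Fq_def by auto
  ultimately show ?thesis using that[of "snd d"] by blast
qed

lemma (in ppt) fc_other: assumes "f \<in> FF" "d \<notin> f" "A x y" "fc (x, y) = fc d" shows "(x, y) \<notin> f"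
proof
  assume "(x, y) \<in> f"
  then have "f = fc d" using FF_fc[OF assms(1)] assms(4) by simp
  then show False using assms(2) fc_self[of d] by simp
qed

lemma (in ppt) nbrs_fin: "finite {e. A x e}"
  by (rule finite_subset[OF _ finV]) (use A_V in auto)

text \<open>After the triangle has left the edge \<open>uw\<close>: it is \<open>u a c\<close>, with the quadrilateral \<open>u w p a\<close>
  on its other side, and \<open>c\<close> is the only common neighbour of \<open>u\<close> and \<open>a\<close>.\<close>

definition swept :: "cppt \<Rightarrow> nat \<Rightarrow> nat \<Rightarrow> nat \<Rightarrow> nat \<Rightarrow> bool" where
  "swept T u w a p \<longleftrightarrow> adj T u a \<and> rot T u a = w \<and> rot T w u = p \<and> rot T p w = a \<and> rot T a p = u \<and>
     (u, a) \<in> ppt.Tri T \<and> (\<forall>e. adj T u e \<longrightarrow> adj T a e \<longrightarrow> rot T u e = a)"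

context region
begin

text \<open>The reflex angles at the three corners are frozen. Hence \<open>u\<close> is never the
  reflex vertex of a free quadrilateral and may be cut off as an ear.\<close>

lemma corner_not_reflex:
  assumes "f \<in> FF" "f \<inter> K = {}" "\<exists>d\<in>f. reflex T d \<and> snd d = w0"
  shows "w0 \<noteq> w" "w0 \<noteq> u" "w0 \<noteq> v"
proof -
  obtain x where x: "(x, w0) \<in> f" "reflex T (x, w0)" using assms(3) by auto
  have "A x w0" "(x, w0) \<notin> K" using x(1) FF_sub[OF assms(1)] assms(2) in_DA by blast+
  then show "w0 \<noteq> w" "w0 \<noteq> u" "w0 \<noteq> v" using K_reflex x(2) by blast+
qed

text \<open>The face behind \<open>uc\<close> is free, because the only frozen dart leaving
  \<open>u\<close> with a free reverse goes to \<open>v\<close>. It is not the triangle, since a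
  3-gon cannot contain both darts of an edge in a simple graph.\<close>

lemma next_quad:
  assumes TK: "Tri \<inter> K = {}" and c: "A u c" "(c, u) \<in> Tri" "c \<noteq> v"
  obtains p' d where "r c u = p'" "r p' c = d" "r d p' = u" "r u d = c"
    "(u, c) \<notin> K" "fc (u, c) \<inter> K = {}" "A u d" "(d, u) \<notin> K"
proof -
  have cuK: "(c, u) \<notin> K" using TK c(2) by blast
  have ucK: "(u, c) \<notin> K" using K_bd[of u c] cuK c(3) corner_neq by auto
  have FF: "fc (u, c) \<in> FF" using c(1) by auto
  have no: "fc (u, c) \<noteq> outer T" using ucK K_outer fc_self[of "(u, c)"] by blast
  have nT: "fc (u, c) \<noteq> Tri"
  proof
    assume eq: "fc (u, c) = Tri"
    then obtain z where z: "r c u = z" "r z c = u" "r u z = c" using face3_rot[OF c(1)] Tri(3) by metis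
    have "fc (u, c) = {(u, c), (c, z), (z, u)}" by (rule face_of_3) (simp_all add: fnext_def z)
    then have "(c, u) \<in> {(u, c), (c, z), (z, u)}" using eq c(2) by simp
    then have "z = u \<or> c = z" using A_neq[OF c(1)] by auto
    moreover have "A c z" using rot_A[OF A_sym[OF c(1)]] z by simp
    moreover have "A z u" using rot_A[OF A_sym[OF \<open>A c z\<close>]] z by simp
    ultimately show False using A_irr by blast
  qed
  have "card (fc (u, c)) = 4" using int_card[OF FF no] TriI[OF FF no] nT by blast
  then obtain p' d where pd: "r c u = p'" "r p' c = d" "r d p' = u" "r u d = c"
    using face4_rot[OF c(1)] by metis
  have K: "fc (u, c) \<inter> K = {}" by (rule notK_face[OF c(1) ucK])
  have "A c p'" using rot_A[OF A_sym[OF c(1)]] pd by simp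
  then have "A p' d" using rot_A[OF A_sym] pd by metis
  then have du: "A d u" using rot_A[OF A_sym] pd by metis
  have "fc (d, u) = fc (u, c)" using fc_fn[of "(d, u)"] du pd by (simp add: fnext_def)
  then have "(d, u) \<notin> K" using K fc_self[of "(d, u)"] by auto
  then show ?thesis using that pd ucK K A_sym[OF du] by blast
qed

text \<open>The flip replaces \<open>uc\<close> by \<open>ad\<close>, where \<open>d\<close>
  precedes \<open>c\<close> around \<open>u\<close>. By \<open>swept\<close> every common neighbour
  of \<open>u\<close> and \<open>a\<close> directly precedes \<open>a\<close> around
  \<open>u\<close>; since \<open>d\<close> precedes \<open>c\<close> and not \<open>a\<close>, it is
  not adjacent to \<open>a\<close>. Afterwards \<open>d\<close> plays the role of \<open>c\<close>,
  and \<open>u\<close> has lost a neighbour.\<close>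

lemma sweep2_step:
  assumes TK: "Tri \<inter> K = {}" and st: "swept T u w a p" and nv: "r u v \<noteq> a"
  shows "\<exists>T'. frozen_flip K T T' \<and> swept T' u w a p \<and> card {e. adj T' u e} < card {e. A u e}"
proof -
  have ua: "A u a" and quad: "r u a = w" "r w u = p" "r p w = a" "r a p = u" and uaT: "(u, a) \<in> Tri"
    and com: "\<And>e. A u e \<Longrightarrow> A a e \<Longrightarrow> r u e = a"
    using st by (simp_all add: swept_def)
  have fcT: "fc (u, a) = Tri" using FF_fc[OF Tri(1) uaT] by simp
  obtain c where c: "r a u = c" "r c a = u" "r u c = a" using face3_rot[OF ua] fcT Tri(3) by metis
  have ac: "A a c" using rot_A[OF A_sym[OF ua]] c by simp
  then have cu: "A c u" using rot_A[OF A_sym] c by metis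
  have TriE: "Tri = {(u, a), (a, c), (c, u)}"
    unfolding fcT[symmetric] by (rule face_of_3) (simp_all add: fnext_def c)
  have cv: "c \<noteq> v" using c nv by auto
  obtain p' d where pd: "r c u = p'" "r p' c = d" "r d p' = u" "r u d = c"
    and ucK: "(u, c) \<notin> K" and FK: "fc (u, c) \<inter> K = {}" and ud: "A u d" and duK: "(d, u) \<notin> K"
    using next_quad[OF TK A_sym[OF cu] _ cv] TriE by blast
  have cuK: "(c, u) \<notin> K" using TK TriE by blast
  interpret E: edge_flip T c u a p' d
    by unfold_locales (use cu c pd K_outer ucK cuK in auto)
  obtain w0 where w0: "\<exists>e\<in>E.Fq. reflex T e \<and> snd e = w0" "w0 \<in> {c, p', d, u}" by (rule E.w0_ex)
  have FqK: "E.Fq \<inter> K = {}" using FK E.fc_ba by simp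
  have w0u: "w0 \<noteq> u" using corner_not_reflex[OF E.Fq(1) FqK w0(1)] by simp
  have ne: "a \<noteq> c" "u \<noteq> a" "c \<noteq> u" "u \<noteq> d" using A_neq ac ua cu ud by blast+
  have da: "d \<noteq> a"
  proof
    assume "d = a"
    then have "c = w" using pd quad by simp
    then show False using cuK K_in by simp
  qed
  have nad: "\<not> A d a"
  proof
    assume "A d a"
    then have "r u d = a" using com[OF ud A_sym] by simp
    then show False using pd ne by simp
  qed
  interpret X: diagonal_flip T c u a p' d d u a c p' w0
    by unfold_locales (use E.pentagons(4) nad da w0 w0u in auto)
  have S: "frozen_flip K T X.T2" by (rule X.frozen_flip_T2[OF K_DA]) (use TK FqK in blast)
  have L: "A a u" "A u w" "A w p" "A p a"
  proof -
    show 1: "A a u" by (rule A_sym[OF ua])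
    show 2: "A u w" using rot_A[OF ua] quad by simp
    show 3: "A w p" using rot_A[OF A_sym[OF 2]] quad by simp
    show 4: "A p a" using rot_A[OF A_sym[OF 3]] quad by simp
  qed
  have Lf: "fc (u, w) = fc (a, u)" "fc (w, p) = fc (a, u)" "fc (p, a) = fc (a, u)"
    using fc_fn[of "(a, u)"] fc_fn[of "(u, w)"] fc_fn[of "(w, p)"] L quad by (simp_all add: fnext_def)
  have nT: "(a, u) \<notin> Tri" using ne by (simp add: TriE)
  have nF: "(a, u) \<notin> E.Fq" using ne da by (auto simp: E.Fq_def)
  have o: "rot X.T2 u a = w" "rot X.T2 w u = p" "rot X.T2 p w = a" "rot X.T2 a p = u"
  proof -
    note T' = fc_other[OF Tri(1) nT] and F' = fc_other[OF E.Fq(1) nF]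
    show "rot X.T2 u a = w" using X.rot_outside[OF L(1) nT nF] quad by simp
    show "rot X.T2 w u = p" using X.rot_outside[OF L(2) T'[OF L(2) Lf(1)] F'[OF L(2) Lf(1)]] quad by simp
    show "rot X.T2 p w = a" using X.rot_outside[OF L(3) T'[OF L(3) Lf(2)] F'[OF L(3) Lf(2)]] quad by simp
    show "rot X.T2 a p = u" using X.rot_outside[OF L(4) T'[OF L(4) Lf(3)] F'[OF L(4) Lf(3)]] quad by simp
  qed
  have "swept X.T2 u w a p" unfolding swept_def
  proof (intro conjI allI impI)
    show "adj X.T2 u a" using ua ne by (simp add: X.adj2)
    show "(u, a) \<in> ppt.Tri X.T2" by (simp add: X.Tri_T2 X.T3_def)
    fix e assume e: "adj X.T2 u e" "adj X.T2 a e"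
    show "rot X.T2 u e = a"
    proof (cases "e = d")
      case True
      then show ?thesis using X.rot2 by simp
    next
      case False
      then have "A u e" "e \<noteq> c" "A a e" using e ne da by (auto simp: X.adj2)
      then have "r u e = a" using com by simp
      then show ?thesis using rot_inj[OF \<open>A u e\<close> A_sym[OF cu]] c \<open>e \<noteq> c\<close> by simp
    qed
  qed (rule o)+
  moreover have "card {e. adj X.T2 u e} < card {e. A u e}"
  proof (rule psubset_card_mono[OF nbrs_fin])
    have "{e. adj X.T2 u e} \<subseteq> {e. A u e}" using ne by (auto simp: X.adj2)
    moreover have "c \<in> {e. A u e} - {e. adj X.T2 u e}" using A_sym[OF cu] ne by (auto simp: X.adj2)
    ultimately show "{e. adj X.T2 u e} \<subset> {e. A u e}" by blast
  qed
  ultimately show ?thesis using S by blast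
qed

text \<open>A 3-cycle that avoids \<open>u\<close> contains no edge at \<open>u\<close>. If its
  inside contains the free side of a frozen edge at \<open>u\<close>, it continues across that edge
  into \<open>K\<close>, and \<open>exit_K\<close> applies.\<close>

lemma corner_cycle:
  assumes TK: "Tri \<inter> K = {}" and d: "(s, t) \<in> K"
    and D: "three_cycle x y z" "u \<notin> {x, y, z}" and i: "inside x y z (fc (t, s))" "s = u \<or> t = u"
    and nI: "A x' x" "(x', x) \<notin> K" "A y' y" "(y', y) \<notin> K" "A z' z" "(z', z) \<notin> K"
  shows False
proof (rule exit_K[OF D(1) _ _ _ d])
  show "\<not> internal T K x" "\<not> internal T K y" "\<not> internal T K z" using nI not_internal by blast+
  have "(t, s) \<notin> cyc x y z" using D(2) i(2) by (auto simp: cyc_def)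
  then show "inside x y z (fc (s, t))" using inside_step[OF i(1)] A_sym[OF K_A[OF d]] by simp
qed

text \<open>With the triangle \<open>u w b\<close> and the quadrilateral \<open>u b q c\<close>
  behind \<open>ub\<close>, the flip of \<open>ub\<close> to \<open>cw\<close> keeps the triangle at
  \<open>uw\<close> and lowers the degree of \<open>u\<close>. Only an existing edge
  \<open>cw\<close> prevents it; then a flip at unchanged or smaller degree starts the
  \<open>swept\<close> phase, from which the sweep does not return.\<close>

lemma sweep1_step:
  assumes TK: "Tri \<inter> K = {}" and uwT: "(u, w) \<in> Tri" and nv: "r u v \<noteq> w"
  shows "\<exists>T'. frozen_flip K T T' \<and>
    ((u, w) \<in> ppt.Tri T' \<and> card {e. adj T' u e} < card {e. A u e} \<or>
     (\<exists>a p. swept T' u w a p) \<and> card {e. adj T' u e} \<le> card {e. A u e})"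
proof -
  have fcT: "fc (u, w) = Tri" using FF_fc[OF Tri(1) uwT] by simp
  obtain b where b: "r w u = b" "r b w = u" "r u b = w" using face3_rot[OF A_corner(2)] fcT Tri(3) by metis
  have wb: "A w b" using rot_A[OF A_corner(1)] b by simp
  have bu: "A b u" using rot_A[OF A_sym[OF wb]] b by simp
  have TriE: "Tri = {(u, w), (w, b), (b, u)}"
    unfolding fcT[symmetric] by (rule face_of_3) (simp_all add: fnext_def b)
  have bv: "b \<noteq> v" using b nv by auto
  obtain q c where qc: "r b u = q" "r q b = c" "r c q = u" "r u c = b"
    and ubK: "(u, b) \<notin> K" and FK: "fc (u, b) \<inter> K = {}" and uc: "A u c" and cuK: "(c, u) \<notin> K"
    using next_quad[OF TK A_sym[OF bu] _ bv] TriE by blast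
  have TK': "(u, w) \<notin> K" "(w, b) \<notin> K" "(b, u) \<notin> K" using TK TriE by blast+
  interpret E: edge_flip T b u w q c
    by unfold_locales (use bu b qc K_outer ubK TK' in auto)
  obtain w0 where w0: "\<exists>e\<in>E.Fq. reflex T e \<and> snd e = w0" "w0 \<in> {b, q, c, u}" by (rule E.w0_ex)
  have FqK: "E.Fq \<inter> K = {}" using FK E.fc_ba by simp
  have w0u: "w0 \<noteq> u" using corner_not_reflex[OF E.Fq(1) FqK w0(1)] by simp
  have ne: "w \<noteq> b" "b \<noteq> u" "w \<noteq> u" "u \<noteq> c" using A_neq wb bu A_corner uc by blast+
  have bq: "A b q" using E.edges by simp
  have qc': "A q c" using E.edges by simp
  have cw: "c \<noteq> w" using cuK K_in by auto
  have cb: "c \<noteq> b" using qc b ne by auto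
  have FqE: "E.Fq = {(u, b), (b, q), (q, c), (c, u)}" by (simp add: E.Fq_def)
  have FqK': "(b, q) \<notin> K" "(q, c) \<notin> K" using FqK FqE by blast+
  show ?thesis
  proof (cases "A c w")
    case False
    interpret X: diagonal_flip T b u w q c c u w b q w0
      by unfold_locales (use E.pentagons(4) False cw w0 w0u in auto)
    have S: "frozen_flip K T X.T2" by (rule X.frozen_flip_T2[OF K_DA]) (use TK FqK in blast)
    have "(u, w) \<in> ppt.Tri X.T2" by (simp add: X.Tri_T2 X.T3_def)
    moreover have "card {e. adj X.T2 u e} < card {e. A u e}"
    proof (rule psubset_card_mono[OF nbrs_fin])
      have "{e. adj X.T2 u e} \<subseteq> {e. A u e}" using ne by (auto simp: X.adj2)
      moreover have "b \<in> {e. A u e} - {e. adj X.T2 u e}" using A_sym[OF bu] ne by (auto simp: X.adj2)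
      ultimately show "{e. adj X.T2 u e} \<subset> {e. A u e}" by blast
    qed
    ultimately show ?thesis using S by blast
  next
    case cw_adj: True
    show ?thesis
    proof (cases "q = w")
      case True
      have r2: "r b u = w" "r w b = c" "r c w = u" using qc True by simp_all
      have bwK: "(b, w) \<notin> K" using FqK' True by simp
      interpret E': edge_flip T w b u c u
        by unfold_locales (use wb b r2 qc K_outer TK' bwK in auto)
      \<comment> \<open>The rotation at \<open>b\<close> exchanges \<open>u\<close> and
        \<open>w\<close>, so \<open>b\<close> has degree two. The triangle and the quadrilateral
        share both edges at \<open>b\<close>, and \<open>wb\<close> is flipped to \<open>cb\<close>
        instead of \<open>ub\<close>.\<close>
      have nb: "e = u \<or> e = w" if be: "A b e" for e
      proof -
        obtain k where k: "(r b ^^ k) u = e" using rot_trans[OF bu be] by blast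
        have "(r b ^^ k) u = u \<or> (r b ^^ k) u = w" for k
          by (induction k) (use r2 b in auto)
        then show ?thesis using k by metis
      qed
      have ncb: "\<not> A c b" using nb[of c] A_sym[of c b] ne cw by auto
      have Fq': "E'.Fq = E.Fq" unfolding True E'.Fq_def FqE[unfolded True] by blast
      interpret X: diagonal_flip T w b u c u c u b u w w0
        by unfold_locales (use E'.pentagons(3) ncb cb w0 w0u Fq' True in auto)
      have S: "frozen_flip K T X.T2" by (rule X.frozen_flip_T2[OF K_DA]) (use TK FqK Fq' in blast)
      have "swept X.T2 u w b c" unfolding swept_def
      proof (intro conjI allI impI)
        show "adj X.T2 u b" using A_sym[OF bu] ne by (simp add: X.adj2)
        show "(u, b) \<in> ppt.Tri X.T2" by (simp add: X.Tri_T2 X.T3_def)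
        fix e assume e: "adj X.T2 u e" "adj X.T2 b e"
        have "e \<noteq> u" using e(1) A_irr ne cb by (auto simp: X.adj2)
        moreover have "e \<noteq> w" using e(2) ne cw by (auto simp: X.adj2)
        ultimately have "e = c" using e(2) nb ne cb by (auto simp: X.adj2)
        then show "rot X.T2 u e = b" using X.rot2 by simp
      qed (use X.rot2 in simp_all)
      moreover have "card {e. adj X.T2 u e} \<le> card {e. A u e}"
        by (rule card_mono[OF nbrs_fin]) (use ne in \<open>auto simp: X.adj2\<close>)
      ultimately show ?thesis using S by blast
    next
      case False
      have uw_nc: "(u, w) \<notin> cyc x y z" "(w, u) \<notin> cyc x y z" if "u \<notin> {x, y, z} \<or> w \<notin> {x, y, z}" for x y z
        using that by (auto simp: cyc_def)
      have qu: "q \<noteq> u" using E.more_neqs E.neqs by blast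
      \<comment> \<open>An edge \<open>uq\<close> would close the 3-cycle \<open>u b q\<close>,
        whose inside extends from the triangle across \<open>uw\<close> into \<open>K\<close>,
        although none of its vertices is internal.\<close>
      have nuq: "\<not> A u q"
      proof
        assume uq: "A u q"
        have D: "three_cycle u b q" using uq bu bq A_sym by (simp add: three_cycle_def)
        have "inside u b q (fc (u, w))" using inside_Tri fcT by simp
        moreover have "(u, w) \<notin> cyc u b q" using False ne by (auto simp: cyc_def)
        ultimately have i: "inside u b q (fc (w, u))" using inside_step A_corner by blast
        have "\<not> internal T K u" "\<not> internal T K b" "\<not> internal T K q"
          using not_internal bu wb bq TK' FqK' by blast+
        then show False using exit_K[OF D _ _ _ K_in(1) i] by blast
      qed
      \<comment> \<open>The edge \<open>cw\<close> that blocked the first flip is put to use: the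
        triangle and the quadrilateral lie inside \<open>u c w\<close>, so the quadrilateral cannot
        have its reflex angle at \<open>c\<close>. Together with \<open>w0u\<close> this allows the
        ear \<open>c\<close> to be cut off by \<open>qu\<close>.\<close>
      have D: "three_cycle u c w" using uc cw_adj A_corner by (simp add: three_cycle_def)
      have iT: "inside u c w (fc (b, u))" using inside_Tri FF_fc[OF Tri(1), of "(b, u)"] TriE by simp
      have bu_nc: "(b, u) \<notin> cyc u c w" using cb ne by (auto simp: cyc_def)
      have iF: "inside u c w (fc (u, b))" by (rule inside_step[OF iT bu bu_nc])
      have FqFc: "fc d = fc (u, b)" if "d \<in> E.Fq" for d
        using FF_fc[OF E.Fq(1) that] E.fc_ba by simp
      have w0c: "w0 \<noteq> c"
      proof
        assume "w0 = c"
        then obtain x where x: "(x, c) \<in> E.Fq" "reflex T (x, c)" using w0(1) by auto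
        have "A x c" using x(1) FF_sub[OF E.Fq(1)] by auto
        moreover have "inside u c w (fc (x, c))" using FqFc[OF x(1)] iF by simp
        ultimately show False using reflex_not_on_cycle[OF D] x(2) by blast
      qed
      \<comment> \<open>\<open>q\<close> lies strictly inside \<open>u c w\<close>, so a common
        neighbour of \<open>u\<close> and \<open>q\<close> off this cycle would lie inside as well.
        By \<open>arc\<close> the only edge at \<open>u\<close> inside the cycle is
        \<open>ub\<close>.\<close>
      have com: "e = c \<or> e = b \<or> e = w" if e: "A u e" "A q e" for e
      proof (rule ccontr)
        assume ne': "\<not> ?thesis"
        have "inside u c w (fc (c, u))" using FqFc[of "(c, u)"] iF FqE by simp
        then have out: "\<not> inside u c w (fc (e, u))"
          using arc[OF D qc(4) b(3) A_sym[OF bu] _ _ _ iT e(1)] cb ne ne' by auto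
        have qD: "q \<notin> {u, c, w}" using qu False A_neq[OF qc'] by auto
        have "inside u c w (fc (b, q))" using FqFc[of "(b, q)"] iF FqE by simp
        then have "inside u c w (fc (e, q))" by (rule inside_around[OF qD bq _ A_sym[OF e(2)]])
        moreover have "(e, q) \<notin> cyc u c w" using qD by (auto simp: cyc_def)
        ultimately have "inside u c w (fc (q, e))" using inside_step A_sym[OF e(2)] by blast
        moreover have "e \<notin> {u, c, w}" using ne' A_neq[OF e(1)] by auto
        ultimately have "inside u c w (fc (u, e))" using inside_around[OF _ e(2) _ e(1)] by blast
        moreover have "(u, e) \<notin> cyc u c w" using ne' A_neq[OF e(1)] by (auto simp: cyc_def)
        ultimately show False using inside_step[OF _ e(1)] out by blast
      qed
      have nqw: "\<not> A q w"
      proof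
        assume qw: "A q w"
        have D: "three_cycle w b q" using qw wb bq by (simp add: three_cycle_def)
        have "inside w b q (fc (u, w))" using inside_Tri fcT by simp
        then show False
          using corner_cycle[OF TK K_in(1) D _ _ _ A_corner(2) TK'(1) wb TK'(2) bq FqK'(1)] ne qu by auto
      qed
      interpret X: diagonal_flip T b u w q c q c u w b w0
        by unfold_locales (use E.pentagons(3) nuq A_sym[of q u] qu w0 w0c in auto)
      have S: "frozen_flip K T X.T2" by (rule X.frozen_flip_T2[OF K_DA]) (use TK FqK in blast)
      have "swept X.T2 u w q b" unfolding swept_def
      proof (intro conjI allI impI)
        show "adj X.T2 u q" by (simp add: X.adj2)
        show "(u, q) \<in> ppt.Tri X.T2" by (simp add: X.Tri_T2 X.T3_def)
        fix e assume e: "adj X.T2 u e" "adj X.T2 q e"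
        have "e \<noteq> q" using e(2) A_irr qu by (auto simp: X.adj2)
        then have 1: "A u e" "e \<noteq> b" using e(1) ne by (auto simp: X.adj2)
        then have "A q e" using e(2) A_irr by (auto simp: X.adj2)
        then have "e = c" using com[OF 1(1)] 1(2) nqw by auto
        then show "rot X.T2 u e = q" using X.rot2 by simp
      qed (use X.rot2 in simp_all)
      moreover have "card {e. adj X.T2 u e} \<le> card {e. A u e}"
      proof -
        have "{e. adj X.T2 u e} \<subseteq> insert q ({e. A u e} - {b})" using ne by (auto simp: X.adj2)
        then have "card {e. adj X.T2 u e} \<le> card (insert q ({e. A u e} - {b}))"
          using nbrs_fin by (intro card_mono) auto
        also have "\<dots> \<le> Suc (card ({e. A u e} - {b}))" by (rule card_insert_le_m1) simp_all
        also have "\<dots> = card {e. A u e}" using A_sym[OF bu] nbrs_fin by (subst card_Suc_Diff1) auto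
        finally show ?thesis .
      qed
      ultimately show ?thesis using S by blast
    qed
  qed
qed

end

section \<open>Complete sweeps\<close>

lemma frozen_flips_inv:
  assumes "(frozen_flip K ^^ k) T T'" "ppt T" "enclosed T K w u v" "ppt.Tri T \<inter> K = {}"
  shows "ppt T' \<and> enclosed T' K w u v \<and> ppt.Tri T' \<inter> K = {} \<and> verts T' = verts T"
  using assms(1)
proof (induction k arbitrary: T')
  case (Suc k)
  then obtain S where S: "(frozen_flip K ^^ k) T S" "frozen_flip K S T'" by auto
  have "ppt S \<and> enclosed S K w u v \<and> ppt.Tri S \<inter> K = {} \<and> verts S = verts T" using Suc.IH[OF S(1)] .
  then show ?case using enclosed_frozen_flip[OF _ _ S(2)] frozen_flipD(1,4,10)[OF S(2)] by simp
qed (use assms in simp)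

lemma sweep2:
  assumes "ppt T" "enclosed T K w u v" "ppt.Tri T \<inter> K = {}" "swept T u w a p"
  shows "\<exists>k T'. k \<le> card {e. adj T u e} \<and> (frozen_flip K ^^ k) T T' \<and> swept T' u w a p \<and> rot T' u v = a"
  using assms
proof (induction "card {e. adj T u e}" arbitrary: T rule: less_induct)
  case less
  interpret ppt T by (rule less.prems(1))
  interpret region T K w u v by unfold_locales (rule less.prems(2))
  show ?case
  proof (cases "rot T u v = a")
    case True
    then show ?thesis using less.prems(4) by (intro exI[of _ 0] exI[of _ T]) simp
  next
    case False
    then obtain S where S: "frozen_flip K T S" "swept S u w a p" "card {e. adj S u e} < card {e. adj T u e}"
      using sweep2_step[OF less.prems(3,4)] by blast
    have "enclosed S K w u v" by (rule enclosed_frozen_flip[OF less.prems(1,2) S(1)])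
    then obtain k T' where k: "k \<le> card {e. adj S u e}" "(frozen_flip K ^^ k) S T'" "swept T' u w a p" "rot T' u v = a"
      using less.hyps[OF S(3) frozen_flipD(1)[OF S(1)] _ frozen_flipD(10)[OF S(1)] S(2)] by blast
    have "(frozen_flip K ^^ Suc k) T T'" using S(1) k(2) by (rule relpowp_Suc_I2)
    moreover have "Suc k \<le> card {e. adj T u e}" using k(1) S(3) by simp
    ultimately show ?thesis using k(3,4) by blast
  qed
qed

lemma swept_Tri: assumes "ppt T" "adj T u v" "swept T u w a p" "rot T u v = a" shows "(v, u) \<in> ppt.Tri T"
proof -
  interpret ppt T by (rule assms(1))
  have "fnext r (v, u) \<in> Tri" using assms(3,4) by (simp add: fnext_def swept_def)
  then show ?thesis using face_iff[OF _ _ Tri(1)] A_sym[OF assms(2)] by simp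
qed

text \<open>Each flip lowers the degree of \<open>u\<close>, except possibly the one that enters the
  \<open>swept\<close> phase, which accounts for the summand 1. If that phase is never entered, the
  triangle ends as \<open>u w v\<close> and fills the whole region.\<close>

lemma sweep:
  assumes "ppt T" "enclosed T K w u v" "ppt.Tri T \<inter> K = {}" "(u, w) \<in> ppt.Tri T"
  shows "\<exists>k T'. k \<le> card {e. adj T u e} + 1 \<and> (frozen_flip K ^^ k) T T' \<and> (v, u) \<in> ppt.Tri T' \<and>
    ((u, w) \<in> ppt.Tri T' \<or> (\<exists>a p. swept T' u w a p \<and> rot T' u v = a))"
  using assms
proof (induction "card {e. adj T u e}" arbitrary: T rule: less_induct)
  case less
  interpret ppt T by (rule less.prems(1))
  interpret region T K w u v by unfold_locales (rule less.prems(2))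
  show ?case
  proof (cases "rot T u v = w")
    case True
    then have "fnext r (v, u) \<in> Tri" using less.prems(4) by (simp add: fnext_def)
    then have "(v, u) \<in> Tri" using face_iff[OF _ _ Tri(1)] A_corner by simp
    then show ?thesis using less.prems(4) by (intro exI[of _ 0] exI[of _ T]) simp
  next
    case False
    then obtain S where S: "frozen_flip K T S" and
      alt: "((u, w) \<in> ppt.Tri S \<and> card {e. adj S u e} < card {e. A u e}) \<or>
        ((\<exists>a p. swept S u w a p) \<and> card {e. adj S u e} \<le> card {e. A u e})"
      using sweep1_step[OF less.prems(3,4)] by blast
    have regS: "enclosed S K w u v" by (rule enclosed_frozen_flip[OF less.prems(1,2) S])
    note S' = frozen_flipD(1)[OF S] regS frozen_flipD(10)[OF S]
    from alt show ?thesis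
    proof
      assume h: "(u, w) \<in> ppt.Tri S \<and> card {e. adj S u e} < card {e. A u e}"
      then obtain k T' where k: "k \<le> card {e. adj S u e} + 1" "(frozen_flip K ^^ k) S T'"
        "(v, u) \<in> ppt.Tri T'" "(u, w) \<in> ppt.Tri T' \<or> (\<exists>a p. swept T' u w a p \<and> rot T' u v = a)"
        using less.hyps[OF _ S'] by blast
      have "(frozen_flip K ^^ Suc k) T T'" using S k(2) by (rule relpowp_Suc_I2)
      moreover have "Suc k \<le> card {e. A u e} + 1" using k(1) h by simp
      ultimately show ?thesis using k(3,4) by blast
    next
      assume h: "(\<exists>a p. swept S u w a p) \<and> card {e. adj S u e} \<le> card {e. A u e}"
      then obtain a p where "swept S u w a p" by blast
      then obtain k T' where k: "k \<le> card {e. adj S u e}" "(frozen_flip K ^^ k) S T'"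
        "swept T' u w a p" "rot T' u v = a"
        using sweep2[OF S'] by blast
      have kk: "(frozen_flip K ^^ Suc k) T T'" using S k(2) by (rule relpowp_Suc_I2)
      have inv: "ppt T'" "enclosed T' K w u v" using frozen_flips_inv[OF kk less.prems(1-3)] by simp_all
      then have "adj T' u v" using enclosedD(1,4)[OF inv(2)] by (auto simp: darts_def)
      then have "(v, u) \<in> ppt.Tri T'" using swept_Tri[OF inv(1) _ k(3,4)] by simp
      moreover have "Suc k \<le> card {e. A u e} + 1" using k(1) h by simp
      ultimately show ?thesis using kk k(3,4) by blast
    qed
  qed
qed

context region
begin

text \<open>Flips the only inner edge at \<open>u\<close>, which makes \<open>u\<close> a vertex of degree 2 inside.\<close>

lemma peel_step:
  assumes TK: "Tri \<inter> K = {}" and st: "swept T u w a p" and ruv: "r u v = a"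
  shows "\<exists>T' x. frozen_flip K T T' \<and> x \<notin> {w, v, u} \<and> \<not> internal T K x \<and>
    adj T' u w \<and> adj T' w x \<and> adj T' x v \<and> adj T' v u \<and>
    rot T' w u = x \<and> rot T' x w = v \<and> rot T' v x = u \<and> rot T' u v = w \<and> reflex T' (w, x) \<and>
    ppt.Tri T' \<inter> {(u, w), (w, x), (x, v), (v, u)} = {} \<and>
    ((x, w) \<in> ppt.Tri T' \<or> (v, x) \<in> ppt.Tri T')"
proof -
  have ua: "A u a" and quad: "r u a = w" "r w u = p" "r p w = a" "r a p = u" and uaT: "(u, a) \<in> Tri"
    using st by (simp_all add: swept_def)
  have fcT: "fc (u, a) = Tri" using FF_fc[OF Tri(1) uaT] by simp
  obtain c where c: "r a u = c" "r c a = u" "r u c = a" using face3_rot[OF ua] fcT Tri(3) by metis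
  have "A a c" using rot_A[OF A_sym[OF ua]] c by simp
  then have "A c u" using rot_A[OF A_sym] c by metis
  then have cv: "c = v" using rot_inj[OF A_sym A_corner(3)] c ruv by metis
  have TriE: "Tri = {(u, a), (a, v), (v, u)}"
    unfolding fcT[symmetric] by (rule face_of_3) (simp_all add: fnext_def c ruv cv[symmetric])
  have auK: "(a, u) \<notin> K" using K_next[of a u] quad K_out by auto
  have TK': "(u, a) \<notin> K" "(a, v) \<notin> K" "(v, u) \<notin> K" using TK TriE by blast+
  have oo: "(u, a) \<notin> outer T" "(a, u) \<notin> outer T" using K_outer TK' auK by blast+
  interpret E: edge_flip T u a v w p
    by unfold_locales (simp_all add: ua c[unfolded cv] quad oo)
  obtain w0 where w0: "\<exists>e\<in>E.Fq. reflex T e \<and> snd e = w0" "w0 \<in> {u, w, p, a}" by (rule E.w0_ex)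
  have FqK: "E.Fq \<inter> K = {}" using notK_face[OF A_sym[OF ua] auK] E.fc_ba by simp
  have w0n: "w0 \<noteq> w" "w0 \<noteq> u" "w0 \<noteq> v" using corner_not_reflex[OF E.Fq(1) FqK w0(1)] by simp_all
  have FqE: "E.Fq = {(a, u), (u, w), (w, p), (p, a)}" by (simp add: E.Fq_def)
  have FqK': "(u, w) \<notin> K" "(w, p) \<notin> K" "(p, a) \<notin> K" using FqK FqE by blast+
  have ne: "u \<noteq> a" "a \<noteq> v" "v \<noteq> u" "u \<noteq> w" "w \<noteq> p" "p \<noteq> a" "w \<noteq> a" "p \<noteq> u" "v \<noteq> w"
    using E.neqs E.more_neqs corner_neq by auto
  have es: "A w p" "A p a" "A a v" using E.edges by simp_all
  \<comment> \<open>Crossing \<open>ua\<close> from the triangle, the quadrilateral with its dart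
    \<open>(u, w)\<close> is inside every 3-cycle that avoids \<open>u\<close>. By
    \<open>corner_cycle\<close>, a diagonal that closes such a 3-cycle through free corners
    therefore never joins adjacent vertices.\<close>
  have i: "inside x y z (fc (u, w))" if "u \<notin> {x, y, z}" for x y z
  proof -
    have "(u, a) \<notin> cyc x y z" using that by (auto simp: cyc_def)
    then have "inside x y z (fc (a, u))" using inside_step[of x y z u a] inside_Tri fcT ua by simp
    moreover have "fc (u, w) = fc (a, u)" using fc_fn[of "(a, u)"] A_sym[OF ua] quad by (simp add: fnext_def)
    ultimately show ?thesis by simp
  qed
  \<comment> \<open>The quadrilateral cut off at \<open>u\<close> has its reflex angle at the new
    corner \<open>x\<close>, so \<open>x\<close> is the old reflex vertex \<open>w0\<close>. The
    corners \<open>w\<close> and \<open>u\<close> are excluded, which leaves the diagonal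
    \<open>wa\<close> or \<open>pv\<close>.\<close>
  from w0(2) w0n consider "w0 = a" | "w0 = p" by blast
  then show ?thesis
  proof cases
    case 1
    have nwa: "\<not> A w a"
    proof
      assume "A w a"
      then have D: "three_cycle w p a" using es A_sym by (simp add: three_cycle_def)
      show False
        using corner_cycle[OF TK K_in(1) D _ i _ A_corner(2) FqK'(1) es(1) FqK'(2) es(2) FqK'(3)] ne by auto
    qed
    interpret X: diagonal_flip T u a v w p w p a v u w0
    proof unfold_locales
      show "E.pentagon w p a v u" by (rule E.pentagons(3))
      show "\<not> A w a" by (rule nwa)
      show "w \<noteq> a" by (rule ne(7))
      show "\<exists>d\<in>E.Fq. reflex T d \<and> snd d = w0" by (rule w0(1))
      show "w0 \<in> {w, a, v, u}" using 1 by simp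
    qed
    have "frozen_flip K T X.T2" by (rule X.frozen_flip_T2[OF K_DA]) (use TK FqK in blast)
    moreover have "a \<notin> {w, v, u}" "\<not> internal T K a" using ne not_internal[OF ua TK'(1)] by auto
    moreover have "adj X.T2 u w" "adj X.T2 w a" "adj X.T2 a v" "adj X.T2 v u"
      using A_corner es ne by (auto simp: X.adj2)
    moreover have "rot X.T2 w u = a" "rot X.T2 a w = v" "rot X.T2 v a = u" "rot X.T2 u v = w"
      by (rule X.rot2)+
    moreover have "reflex X.T2 (w, a)" unfolding X.T2_sel X.refl2_def X.F4_def using 1 by simp
    moreover have "ppt.Tri X.T2 \<inter> {(u, w), (w, a), (a, v), (v, u)} = {}"
      using X.disj_T3_F4 unfolding X.Tri_T2 X.F4_def by blast
    moreover have "(a, w) \<in> ppt.Tri X.T2" by (simp add: X.Tri_T2 X.T3_def)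
    ultimately show ?thesis by blast
  next
    case 2
    have npv: "\<not> A p v"
    proof
      assume "A p v"
      then have D: "three_cycle p a v" using es A_sym by (simp add: three_cycle_def)
      show False
        using corner_cycle[OF TK K_in(1) D _ i _ es(1) FqK'(2) es(2) FqK'(3) es(3) TK'(2)] ne by auto
    qed
    interpret X: diagonal_flip T u a v w p p a v u w w0
    proof unfold_locales
      show "E.pentagon p a v u w" by (rule E.pentagons(4))
      show "\<not> A p v" by (rule npv)
      show "p \<noteq> v" using w0n(3) 2 by simp
      show "\<exists>d\<in>E.Fq. reflex T d \<and> snd d = w0" by (rule w0(1))
      show "w0 \<in> {p, v, u, w}" using 2 by simp
    qed
    have "frozen_flip K T X.T2" by (rule X.frozen_flip_T2[OF K_DA]) (use TK FqK in blast)
    moreover have "p \<notin> {w, v, u}" "\<not> internal T K p" using ne w0n 2 not_internal[OF es(1) FqK'(2)] by auto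
    moreover have "adj X.T2 u w" "adj X.T2 w p" "adj X.T2 p v" "adj X.T2 v u"
      using A_corner es ne by (auto simp: X.adj2)
    moreover have "rot X.T2 w u = p" "rot X.T2 p w = v" "rot X.T2 v p = u" "rot X.T2 u v = w"
      by (rule X.rot2)+
    moreover have "reflex X.T2 (w, p)" unfolding X.T2_sel X.refl2_def X.F4_def using 2 by simp
    moreover have "ppt.Tri X.T2 \<inter> {(u, w), (w, p), (p, v), (v, u)} = {}"
      using X.disj_T3_F4 unfolding X.Tri_T2 X.F4_def by blast
    moreover have "(v, p) \<in> ppt.Tri X.T2" by (simp add: X.Tri_T2 X.T3_def)
    ultimately show ?thesis by blast
  qed
qed

end

section \<open>Layers\<close>

text \<open>The darts of the outer face and of the quadrilaterals between consecutive layers. The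
  inner darts \<open>(last ts, w)\<close>, \<open>(v, last ts)\<close> and \<open>(w, v)\<close> are
  left out: they belong to the free region, whence the use of \<open>butlast\<close>.\<close>

definition KL :: "nat \<Rightarrow> nat \<Rightarrow> nat list \<Rightarrow> (nat \<times> nat) set" where
  "KL w v ts = {(v, w)} \<union> {w} \<times> set ts \<union> set ts \<times> {v} \<union> set (butlast ts) \<times> {w} \<union> {v} \<times> set (butlast ts)"

text \<open>The vertices \<open>ts\<close>, from the outer face inwards, are joined to \<open>w\<close> and \<open>v\<close>, and consecutive
  ones bound a quadrilateral with its reflex angle at the inner one.\<close>

definition layered :: "cppt \<Rightarrow> nat \<Rightarrow> nat \<Rightarrow> nat list \<Rightarrow> bool" where
  "layered T w v ts \<longleftrightarrow> ts \<noteq> [] \<and> distinct (w # v # ts) \<and> outer T = {(w, ts ! 0), (ts ! 0, v), (v, w)} \<and>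
     KL w v ts \<subseteq> darts (adj T) \<and>
     rot T (ts ! 0) w = v \<and> rot T v (ts ! 0) = w \<and> rot T w v = ts ! 0 \<and>
     (\<forall>i. Suc i < length ts \<longrightarrow> rot T w (ts ! i) = ts ! Suc i \<and> rot T (ts ! Suc i) w = v \<and>
        rot T v (ts ! Suc i) = ts ! i \<and> rot T (ts ! i) v = w \<and> reflex T (w, ts ! Suc i))"

lemma set_butlast_last: "ts \<noteq> [] \<Longrightarrow> set ts = insert (last ts) (set (butlast ts))"
  by (metis append_butlast_last_id list.set(1,2) set_append Un_insert_right sup_bot_right)

lemma nth_butlast_mem: "Suc i < length ts \<Longrightarrow> ts ! i \<in> set (butlast ts)"
  by (metis Suc_lessE diff_Suc_1 in_set_conv_nth length_butlast nth_butlast less_Suc_eq Suc_less_eq)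

lemma mem_butlast_nth: "t \<in> set (butlast ts) \<Longrightarrow> \<exists>i. Suc i < length ts \<and> t = ts ! i"
  by (metis in_set_conv_nth length_butlast less_diff_conv nth_butlast Suc_eq_plus1)

lemma layered_frozen_flip:
  assumes L: "layered T w v ts" and S: "frozen_flip (KL w v ts) T T'"
  shows "layered T' w v ts"
proof -
  have ne: "ts \<noteq> []" using L by (simp add: layered_def)
  have Li: "rot T w (ts ! i) = ts ! Suc i \<and> rot T (ts ! Suc i) w = v \<and>
        rot T v (ts ! Suc i) = ts ! i \<and> rot T (ts ! i) v = w \<and> reflex T (w, ts ! Suc i)"
    if "Suc i < length ts" for i using L that unfolding layered_def by blast
  have m0: "(w, ts ! 0) \<in> KL w v ts" "(ts ! 0, v) \<in> KL w v ts" "(v, w) \<in> KL w v ts"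
    using ne by (simp_all add: KL_def)
  have mi: "(ts ! i, w) \<in> KL w v ts" "(w, ts ! Suc i) \<in> KL w v ts" "(ts ! Suc i, v) \<in> KL w v ts"
    "(v, ts ! i) \<in> KL w v ts" if "Suc i < length ts" for i
    using that nth_butlast_mem[OF that] by (simp_all add: KL_def)
  note rt = frozen_flipD(7)[OF S] and rf = frozen_flipD(8)[OF S]
  have "KL w v ts \<subseteq> darts (adj T')" using frozen_flipD(6)[OF S] by (auto simp: darts_def)
  moreover have "outer T' = {(w, ts ! 0), (ts ! 0, v), (v, w)}" using L frozen_flipD(5)[OF S] by (simp add: layered_def)
  moreover have "rot T' (ts ! 0) w = v" "rot T' v (ts ! 0) = w" "rot T' w v = ts ! 0"
    using L unfolding rt[OF m0(1)] rt[OF m0(2)] rt[OF m0(3)] by (simp_all add: layered_def)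
  moreover have "rot T' w (ts ! i) = ts ! Suc i \<and> rot T' (ts ! Suc i) w = v \<and>
        rot T' v (ts ! Suc i) = ts ! i \<and> rot T' (ts ! i) v = w \<and> reflex T' (w, ts ! Suc i)"
    if i: "Suc i < length ts" for i
    using Li[OF i] unfolding rt[OF mi(1)[OF i]] rt[OF mi(2)[OF i]] rt[OF mi(3)[OF i]] rt[OF mi(4)[OF i]]
      rf[OF mi(2)[OF i]] .
  ultimately show ?thesis using ne L unfolding layered_def by blast
qed

text \<open>The rotation at such a vertex exchanges \<open>w\<close> and \<open>v\<close>, so these
  are its only neighbours.\<close>

lemma layered_internal:
  assumes "ppt T" and L: "layered T w v ts" and t: "t \<in> set (butlast ts)"
  shows "internal T (KL w v ts) t"
  unfolding internal_def
proof (intro allI impI)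
  interpret ppt T by (rule assms(1))
  obtain i where i: "Suc i < length ts" "t = ts ! i" using mem_butlast_nth[OF t] by blast
  have t': "t \<in> set ts" using t by (rule in_set_butlastD)
  have r: "r t v = w" "r t w = v" using L i by (cases i; simp add: layered_def)+
  fix x assume "A x t"
  have "KL w v ts \<subseteq> DA" using L by (simp add: layered_def)
  then have "A t w" using t by (auto simp: KL_def)
  then obtain k where k: "(r t ^^ k) w = x" using rot_trans A_sym[OF \<open>A x t\<close>] by blast
  have "(r t ^^ k) w = w \<or> (r t ^^ k) w = v" for k
    by (induction k) (use r in auto)
  then have "x = w \<or> x = v" using k by metis
  then show "(x, t) \<in> KL w v ts" using t t' by (auto simp: KL_def)
qed

lemma layered_enclosed:
  assumes "ppt T" and L: "layered T w v ts"
  shows "enclosed T (KL w v ts) w (last ts) v"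
proof -
  interpret ppt T by (rule assms(1))
  let ?K = "KL w v ts"
  have ne: "ts \<noteq> []" and dist: "distinct ts" "w \<notin> set ts" "v \<notin> set ts" "w \<noteq> v"
    and out: "outer T = {(w, ts ! 0), (ts ! 0, v), (v, w)}" and KD: "?K \<subseteq> DA"
    and r0: "r (ts ! 0) w = v" "r v (ts ! 0) = w" "r w v = ts ! 0"
    and ri: "\<And>i. Suc i < length ts \<Longrightarrow> r w (ts ! i) = ts ! Suc i"
      "\<And>i. Suc i < length ts \<Longrightarrow> r (ts ! Suc i) w = v"
      "\<And>i. Suc i < length ts \<Longrightarrow> r v (ts ! Suc i) = ts ! i"
      "\<And>i. Suc i < length ts \<Longrightarrow> r (ts ! i) v = w"
      "\<And>i. Suc i < length ts \<Longrightarrow> reflex T (w, ts ! Suc i)"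
    using L by (simp_all add: layered_def)
  note sp = set_butlast_last[OF ne]
  have lastn: "last ts \<notin> set (butlast ts)"
    using dist(1) ne by (metis append_butlast_last_id distinct_append disjoint_insert(1) list.set(2))
  have bl: "t \<in> set ts" if "t \<in> set (butlast ts)" for t using sp that by simp
  have t0: "ts ! 0 \<in> set ts" using ne by simp
  have KA: "A x y" if "(x, y) \<in> ?K" for x y using that KD by auto
  have rt: "r t w = v" if t: "t \<in> set ts" for t
  proof -
    obtain i where i: "i < length ts" "t = ts ! i" using t by (metis in_set_conv_nth)
    then show ?thesis using r0(1) ri(2) by (cases i) auto
  qed
  have rw: "(w, r w t) \<in> ?K" if t: "t \<in> set (butlast ts)" for t
  proof -
    obtain i where i: "Suc i < length ts" "t = ts ! i" using mem_butlast_nth[OF t] by blast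
    then show ?thesis using ri(1)[OF i(1)] by (simp add: KL_def)
  qed
  have rv: "(v, r v t) \<in> ?K" if "t \<in> set ts" for t
  proof -
    obtain i where i: "i < length ts" "t = ts ! i" using \<open>t \<in> set ts\<close> by (metis in_set_conv_nth)
    show ?thesis
    proof (cases i)
      case 0
      then show ?thesis using r0(2) i by (simp add: KL_def)
    next
      case (Suc j)
      then show ?thesis using ri(3)[of j] i nth_butlast_mem[of j ts] by (simp add: KL_def)
    qed
  qed
  have rtv: "r t v = w" if "t \<in> set (butlast ts)" for t
    using mem_butlast_nth[OF that] ri(4) by auto
  have int: "internal T ?K t" if "t \<in> set (butlast ts)" for t by (rule layered_internal[OF assms that])
  \<comment> \<open>For a single layer the angle belongs to the outer face; otherwise it is the
    reflex angle of the innermost quadrilateral.\<close>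
  have refw: "reflex T (w, last ts)"
  proof (cases "length ts = 1")
    case True
    then have "last ts = ts ! 0" using ne by (simp add: last_conv_nth)
    then show ?thesis using outer_reflex out by simp
  next
    case False
    then obtain j where j: "length ts = Suc (Suc j)" using ne by (metis One_nat_def length_0_conv not0_implies_Suc)
    then have "last ts = ts ! Suc j" using ne by (simp add: last_conv_nth)
    then show ?thesis using ri(5)[of j] j by simp
  qed
  show ?thesis unfolding enclosed_def
  proof (intro conjI allI impI)
    show "?K \<subseteq> DA" by (rule KD)
    show "(w, last ts) \<in> ?K" "(last ts, v) \<in> ?K" "(v, w) \<in> ?K" using ne by (simp_all add: KL_def)
    show "(last ts, w) \<notin> ?K" "(v, last ts) \<notin> ?K" "(w, v) \<notin> ?K"
      using dist lastn sp bl by (auto simp: KL_def)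
    show "outer T \<subseteq> ?K" using out t0 by (auto simp: KL_def)
    fix x y
    {
      assume "(x, y) \<in> ?K"
      then consider "x = v" "y = w" | "x = w" "y \<in> set ts" | "x \<in> set ts" "y = v"
        | "x \<in> set (butlast ts)" "y = w" | "x = v" "y \<in> set (butlast ts)" by (auto simp: KL_def)
      then show "(y, r y x) \<in> ?K"
      proof cases
        case 1 then show ?thesis using r0(3) t0 by (simp add: KL_def)
      next
        case 2 then show ?thesis using rt by (simp add: KL_def)
      next
        case 3 then show ?thesis using rv by simp
      next
        case 4 then show ?thesis using rw by simp
      next
        case 5 then show ?thesis using rtv by (simp add: KL_def)
      qed
    next
      assume "(x, y) \<in> ?K" "(y, x) \<notin> ?K"
      then show "(x, y) = (w, last ts) \<or> (x, y) = (last ts, v) \<or> (x, y) = (v, w)"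
        using sp bl by (auto simp: KL_def)
    next
      assume xy: "A x y" "reflex T (x, y)" "y = w \<or> y = last ts \<or> y = v"
      have o: "reflex T (v, w)" "reflex T (ts ! 0, v)" using outer_reflex out by simp_all
      have k: "(v, w) \<in> ?K" "(ts ! 0, v) \<in> ?K" "(w, last ts) \<in> ?K" using ne by (simp_all add: KL_def)
      from xy(3) show "(x, y) \<in> ?K"
      proof (elim disjE)
        assume "y = w" then show ?thesis using reflex_unique[OF xy(1) _ xy(2)] KA[OF k(1)] o k by metis
      next
        assume "y = last ts" then show ?thesis using reflex_unique[OF xy(1) _ xy(2)] KA[OF k(3)] refw k by metis
      next
        assume "y = v" then show ?thesis using reflex_unique[OF xy(1) _ xy(2)] KA[OF k(2)] o k by metis
      qed
    }
  next
    fix P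
    assume nx: "\<forall>x y. (x, y) \<in> ?K \<longrightarrow> (x, y) \<in> P \<longrightarrow> (y, r y x) \<in> P"
      and cx: "\<forall>x y. (x, y) \<in> ?K \<longrightarrow> (y, x) \<in> ?K \<longrightarrow> (x, y) \<in> P \<longrightarrow>
          internal T ?K x \<or> internal T ?K y \<longrightarrow> (y, x) \<in> P"
      and ex: "\<exists>d\<in>?K. d \<in> P"
    have nx': "(y, r y x) \<in> P" if "(x, y) \<in> ?K" "(x, y) \<in> P" for x y using nx that by blast
    have st1: "(v, ts ! i) \<in> P" if "Suc i < length ts" "(ts ! Suc i, v) \<in> P" for i
      using nx'[OF _ that(2)] ri(3)[OF that(1)] that(1) by (simp add: KL_def)
    have swept: "(ts ! i, w) \<in> P" if "Suc i < length ts" "(v, ts ! i) \<in> P" for i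
      using nx'[OF _ that(2)] ri(4)[OF that(1)] nth_butlast_mem[OF that(1)] by (simp add: KL_def)
    have st3: "(w, ts ! Suc i) \<in> P" if "Suc i < length ts" "(ts ! i, w) \<in> P" for i
      using nx'[OF _ that(2)] ri(1)[OF that(1)] nth_butlast_mem[OF that(1)] by (simp add: KL_def)
    have st4: "(t, v) \<in> P" if "t \<in> set ts" "(w, t) \<in> P" for t
      using nx'[OF _ that(2)] rt[OF that(1)] that(1) by (simp add: KL_def)
    \<comment> \<open>One layer outwards: from \<open>(w, ts ! Suc i)\<close> around the
      quadrilateral to \<open>(ts ! i, w)\<close>, then across this edge, which is permitted because
      \<open>ts ! i\<close> is internal.\<close>
    have down: "(w, ts ! 0) \<in> P" if "i < length ts" "(w, ts ! i) \<in> P" for i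
      using that
    proof (induction i)
      case (Suc i)
      have "(ts ! i, w) \<in> P" using swept[OF Suc.prems(1) st1[OF Suc.prems(1) st4[OF _ Suc.prems(2)]]] Suc.prems(1)
        by simp
      moreover have m: "ts ! i \<in> set (butlast ts)" using nth_butlast_mem[OF Suc.prems(1)] .
      moreover have "(ts ! i, w) \<in> ?K" "(w, ts ! i) \<in> ?K" using m bl[OF m] by (simp_all add: KL_def)
      ultimately have "(w, ts ! i) \<in> P" using cx int[OF m] by blast
      then show ?case using Suc by simp
    qed simp
    have w0: "(w, ts ! 0) \<in> P \<or> (ts ! 0, v) \<in> P"
    proof -
      obtain x y where xy: "(x, y) \<in> ?K" "(x, y) \<in> P" using ex by auto
      have up: ?thesis if "(t, w) \<in> P" "t \<in> set (butlast ts)" for t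
        using mem_butlast_nth[OF that(2)] st3 down that(1) by metis
      have up2: ?thesis if "(v, t) \<in> P" "t \<in> set (butlast ts)" for t
        using up[OF _ that(2)] mem_butlast_nth[OF that(2)] swept that(1) by metis
      from xy(1) consider "x = v" "y = w" | "x = w" "y \<in> set ts" | "x \<in> set ts" "y = v"
        | "x \<in> set (butlast ts)" "y = w" | "x = v" "y \<in> set (butlast ts)" by (auto simp: KL_def)
      then show ?thesis
      proof cases
        case 1
        then show ?thesis using nx'[OF xy] r0(3) by simp
      next
        case 2
        then obtain i where "i < length ts" "y = ts ! i" by (metis in_set_conv_nth)
        then show ?thesis using down xy(2) 2 by blast
      next
        case 3
        then obtain i where i: "i < length ts" "x = ts ! i" by (metis in_set_conv_nth)
        show ?thesis
        proof (cases i)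
          case 0 then show ?thesis using xy(2) 3 i by simp
        next
          case (Suc j)
          then have "(v, ts ! j) \<in> P" using st1[of j] i xy(2) 3 by simp
          then show ?thesis using up2[of "ts ! j"] nth_butlast_mem[of j ts] i Suc by simp
        qed
      next
        case 4 then show ?thesis using up xy(2) by simp
      next
        case 5 then show ?thesis using up2 xy(2) by simp
      qed
    qed
    then show "\<exists>d\<in>outer T. d \<in> P" using out by blast
  qed
qed

lemma KL_snoc: assumes "ts \<noteq> []"
  shows "KL w v (ts @ [x]) = KL w v ts \<union> {(last ts, w), (w, x), (x, v), (v, last ts)}"
proof -
  show ?thesis using set_butlast_last[OF assms] by (auto simp: KL_def)
qed

lemma layered_snoc:
  assumes "layered T w v ts" "x \<notin> set (w # v # ts)"
    and "adj T (last ts) w" "adj T w x" "adj T x v" "adj T v (last ts)"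
    and "rot T w (last ts) = x" "rot T x w = v" "rot T v x = last ts" "rot T (last ts) v = w" "reflex T (w, x)"
  shows "layered T w v (ts @ [x])"
proof -
  have ne: "ts \<noteq> []" using assms(1) by (simp add: layered_def)
  have 0: "(ts @ [x]) ! 0 = ts ! 0" using ne by (simp add: nth_append)
  have KD: "KL w v (ts @ [x]) \<subseteq> darts (adj T)"
    unfolding KL_snoc[OF ne] using assms(1,3-6) by (simp add: layered_def darts_def)
  have "rot T w ((ts @ [x]) ! i) = (ts @ [x]) ! Suc i \<and> rot T ((ts @ [x]) ! Suc i) w = v \<and>
        rot T v ((ts @ [x]) ! Suc i) = (ts @ [x]) ! i \<and> rot T ((ts @ [x]) ! i) v = w \<and>
        reflex T (w, (ts @ [x]) ! Suc i)" if i: "Suc i < length (ts @ [x])" for i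
  proof (cases "Suc i < length ts")
    case True
    then show ?thesis using assms(1) by (simp add: layered_def nth_append)
  next
    case False
    then have i': "Suc i = length ts" using i by simp
    then have "(ts @ [x]) ! Suc i = x" "(ts @ [x]) ! i = last ts"
      using ne by (simp_all add: nth_append last_conv_nth flip: i')
    then show ?thesis using assms(7-11) by simp
  qed
  then show ?thesis using assms(1,2) KD ne 0 unfolding layered_def by simp
qed

lemma layered_peel:
  assumes P: "ppt T" and L: "layered T w v ts" and TK: "ppt.Tri T \<inter> KL w v ts = {}"
    and st: "swept T (last ts) w a p" "rot T (last ts) v = a"
  shows "\<exists>T' x. frozen_flip (KL w v ts) T T' \<and> layered T' w v (ts @ [x]) \<and> ppt.Tri T' \<inter> KL w v (ts @ [x]) = {} \<and>
    ((x, w) \<in> ppt.Tri T' \<or> (v, x) \<in> ppt.Tri T')"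
proof -
  let ?K = "KL w v ts" and ?u = "last ts"
  interpret ppt T by (rule P)
  have R: "enclosed T ?K w ?u v" by (rule layered_enclosed[OF P L])
  interpret region T ?K w ?u v by unfold_locales (rule R)
  have ne: "ts \<noteq> []" using L by (simp add: layered_def)
  obtain T' x where S: "frozen_flip ?K T T'" and x: "x \<notin> {w, v, ?u}" "\<not> internal T ?K x"
    and T': "adj T' ?u w" "adj T' w x" "adj T' x v" "adj T' v ?u"
      "rot T' w ?u = x" "rot T' x w = v" "rot T' v x = ?u" "rot T' ?u v = w" "reflex T' (w, x)"
    and dis: "ppt.Tri T' \<inter> {(?u, w), (w, x), (x, v), (v, ?u)} = {}"
    and alt: "(x, w) \<in> ppt.Tri T' \<or> (v, x) \<in> ppt.Tri T'"
    using peel_step[OF TK st] by blast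
  \<comment> \<open>Earlier vertices of the list are internal and \<open>x\<close> is not; the last
    one is excluded by \<open>peel_step\<close>.\<close>
  have "x \<notin> set ts"
  proof
    assume "x \<in> set ts"
    then have "x \<in> set (butlast ts)"
      using x(1) ne by (metis append_butlast_last_id insert_iff rotate1.simps(2) set_ConsD set_rotate1)
    then show False using x(2) layered_internal[OF P L] by blast
  qed
  then have "layered T' w v (ts @ [x])"
    using layered_snoc[OF layered_frozen_flip[OF L S] _ T'] x(1) by simp
  moreover have "ppt.Tri T' \<inter> KL w v (ts @ [x]) = {}"
    unfolding KL_snoc[OF ne] using frozen_flipD(10)[OF S] dis by blast
  ultimately show ?thesis using S alt by blast
qed

text \<open>Both directions are kept because the path from the second 4-PPT to the canonical form is
  traversed backwards at the end.\<close>

definition flip_both :: "cppt \<Rightarrow> cppt \<Rightarrow> bool" where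
  "flip_both T T' \<longleftrightarrow> ppt T' \<and> flip T T' \<and> flip T' T \<and> verts T' = verts T"

lemma frozen_flip_imp_flip_both: "frozen_flip K T T' \<Longrightarrow> flip_both T T'"
  using frozen_flipD(1-4)[of K T T'] by (simp add: flip_both_def)

lemma frozen_flips_flip_both: "(frozen_flip K ^^ k) T T' \<Longrightarrow> (flip_both ^^ k) T T'"
  by (erule relpowp_mono[rotated]) (rule frozen_flip_imp_flip_both)

text \<open>The corners \<open>w'\<close>, \<open>u'\<close>, \<open>v'\<close> are independent of
  the names in \<open>layered\<close>, since with the same frozen set the sweep also runs around
  \<open>v\<close> and \<open>w\<close>. Degrees are bounded by the number of vertices.\<close>

lemma layered_sweep:
  assumes P: "ppt T" and L: "layered T w v ts" and TK: "ppt.Tri T \<inter> KL w v ts = {}"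
    and C: "enclosed T (KL w v ts) w' u' v'" and T: "(u', w') \<in> ppt.Tri T"
  shows "\<exists>k T'. k \<le> card (verts T) + 1 \<and> (flip_both ^^ k) T T' \<and> ppt T' \<and> verts T' = verts T \<and> layered T' w v ts \<and>
    ppt.Tri T' \<inter> KL w v ts = {} \<and> (v', u') \<in> ppt.Tri T' \<and>
    ((u', w') \<in> ppt.Tri T' \<or> (\<exists>a p. swept T' u' w' a p \<and> rot T' u' v' = a))"
proof -
  interpret ppt T by (rule P)
  obtain k T' where k: "k \<le> card {e. adj T u' e} + 1" "(frozen_flip (KL w v ts) ^^ k) T T'" "(v', u') \<in> ppt.Tri T'"
    "(u', w') \<in> ppt.Tri T' \<or> (\<exists>a p. swept T' u' w' a p \<and> rot T' u' v' = a)"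
    using sweep[OF P C TK T] by blast
  have "layered S w v ts" if "(frozen_flip (KL w v ts) ^^ j) T S" for j S
    using that
  proof (induction j arbitrary: S)
    case (Suc j)
    then obtain S' where "(frozen_flip (KL w v ts) ^^ j) T S'" "frozen_flip (KL w v ts) S' S" by auto
    then show ?case using Suc.IH layered_frozen_flip by blast
  qed (use L in simp)
  then have "layered T' w v ts" using k(2) by blast
  moreover have "card {e. adj T u' e} \<le> card (verts T)"
    by (rule card_mono[OF finV]) (auto intro: A_V(2))
  ultimately show ?thesis using k frozen_flips_flip_both[OF k(2)] frozen_flips_inv[OF k(2) P C TK]
    by (intro exI[of _ k] exI[of _ T']) simp
qed

text \<open>One more layer costs a sweep of at most n + 1 flips, one flip to peel, and at most 2 * n
  + 2 flips to return the triangle to \<open>w\<close>. The sum 3 * n + 4 is at most 5 * n, and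
  every layer uses up a new vertex.\<close>

lemma reach_full_layering:
  assumes "ppt T" "layered T w v ts" "ppt.Tri T \<inter> KL w v ts = {}" "(last ts, w) \<in> ppt.Tri T"
  shows "\<exists>k T' ts'. k \<le> 5 * card (verts T) * (card (verts T) - length ts) \<and> (flip_both ^^ k) T T' \<and> ppt T' \<and>
    verts T' = verts T \<and> layered T' w v ts' \<and> (v, last ts') \<in> ppt.Tri T' \<and> (last ts', w) \<in> ppt.Tri T'"
  using assms
proof (induction "card (verts T) - length ts" arbitrary: T ts rule: less_induct)
  case less
  let ?n = "card (verts T)"
  obtain k1 T1 where T1: "k1 \<le> ?n + 1" "(flip_both ^^ k1) T T1" "ppt T1" "verts T1 = verts T" "layered T1 w v ts"
    "ppt.Tri T1 \<inter> KL w v ts = {}" "(v, last ts) \<in> ppt.Tri T1"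
    and alt: "(last ts, w) \<in> ppt.Tri T1 \<or> (\<exists>a p. swept T1 (last ts) w a p \<and> rot T1 (last ts) v = a)"
    using layered_sweep[OF less.prems(1-3) layered_enclosed[OF less.prems(1,2)] less.prems(4)] by blast
  have lenb: "length us + 2 \<le> card (verts S)" if "ppt S" "layered S w v us" for S us
  proof -
    interpret ppt S by (rule that(1))
    have d: "distinct (w # v # us)" and KD: "KL w v us \<subseteq> DA" and ne: "us \<noteq> []"
      using that(2) by (simp_all add: layered_def)
    have "A v w" using KD by (auto simp: KL_def)
    moreover have "A w t" if "t \<in> set us" for t using KD that by (auto simp: KL_def)
    ultimately have "set (w # v # us) \<subseteq> verts S" using A_V(1)[of v w] A_V(2)[of v w] A_V(2)[of w] by auto
    then have "card (set (w # v # us)) \<le> card (verts S)" using finV by (intro card_mono)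
    then show ?thesis using distinct_card[OF d] by simp
  qed
  have n: "length ts + 2 \<le> ?n" by (rule lenb[OF less.prems(1,2)])
  have ne: "ts \<noteq> []" using less.prems(2) by (simp add: layered_def)
  show ?case
  proof (cases "(last ts, w) \<in> ppt.Tri T1")
    case True
    have "?n + 1 \<le> 5 * ?n * (?n - length ts)"
    proof -
      have "?n - length ts \<ge> 1" using n by simp
      then have "5 * ?n * 1 \<le> 5 * ?n * (?n - length ts)" by (rule mult_le_mono2)
      then have "5 * ?n \<le> 5 * ?n * (?n - length ts)" by (simp only: mult_1_right)
      then show ?thesis using n by linarith
    qed
    then show ?thesis using T1 True by (intro exI[of _ k1] exI[of _ T1] exI[of _ ts]) simp
  next
    case False
    then obtain a p where st: "swept T1 (last ts) w a p" "rot T1 (last ts) v = a" using alt by blast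
    obtain T2 x where S2: "frozen_flip (KL w v ts) T1 T2" and L2: "layered T2 w v (ts @ [x])"
      and TK2: "ppt.Tri T2 \<inter> KL w v (ts @ [x]) = {}" and alt2: "(x, w) \<in> ppt.Tri T2 \<or> (v, x) \<in> ppt.Tri T2"
      using layered_peel[OF T1(3,5,6) st] by blast
    have P2: "ppt T2" and V2: "verts T2 = verts T" using frozen_flipD(1,4)[OF S2] T1(4) by simp_all
    have f2: "(flip_both ^^ 1) T1 T2" unfolding relpowp_1 by (rule frozen_flip_imp_flip_both[OF S2])
    have "\<exists>k T3. k \<le> 2 * ?n + 2 \<and> (flip_both ^^ k) T2 T3 \<and> ppt T3 \<and> verts T3 = verts T \<and> layered T3 w v (ts @ [x]) \<and>
      ppt.Tri T3 \<inter> KL w v (ts @ [x]) = {} \<and> (x, w) \<in> ppt.Tri T3"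
    proof (cases "(x, w) \<in> ppt.Tri T2")
      case True
      then show ?thesis using P2 V2 L2 TK2 by (intro exI[of _ 0] exI[of _ T2]) simp
    next
      case False
      \<comment> \<open>The triangle lies at \<open>vx\<close> instead of \<open>xw\<close>. A sweep
        around \<open>v\<close> takes it to \<open>wv\<close>, and another around \<open>w\<close>
        takes it to \<open>xw\<close>.\<close>
      then have vx: "(v, x) \<in> ppt.Tri T2" using alt2 by simp
      have R2: "enclosed T2 (KL w v (ts @ [x])) x v w" using enclosed_rotate[OF layered_enclosed[OF P2 L2]] by simp
      obtain k3 T3 where T3: "k3 \<le> card (verts T2) + 1" "(flip_both ^^ k3) T2 T3" "ppt T3" "verts T3 = verts T2"
        "layered T3 w v (ts @ [x])" "ppt.Tri T3 \<inter> KL w v (ts @ [x]) = {}" "(w, v) \<in> ppt.Tri T3"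
        using layered_sweep[OF P2 L2 TK2 R2 vx] by blast
      have R3: "enclosed T3 (KL w v (ts @ [x])) v w x"
        using enclosed_rotate[OF enclosed_rotate[OF layered_enclosed[OF T3(3,5)]]] by simp
      obtain k4 T4 where T4: "k4 \<le> card (verts T3) + 1" "(flip_both ^^ k4) T3 T4" "ppt T4" "verts T4 = verts T3"
        "layered T4 w v (ts @ [x])" "ppt.Tri T4 \<inter> KL w v (ts @ [x]) = {}" "(x, w) \<in> ppt.Tri T4"
        using layered_sweep[OF T3(3,5,6) R3 T3(7)] by blast
      have "(flip_both ^^ (k3 + k4)) T2 T4" using T3(2) T4(2) by (rule relpowp_trans)
      moreover have "k3 + k4 \<le> 2 * ?n + 2" using T3(1,4) T4(1) V2 by simp
      ultimately show ?thesis using T3 T4 V2 by blast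
    qed
    then obtain k3 T3 where T3: "k3 \<le> 2 * ?n + 2" "(flip_both ^^ k3) T2 T3" "ppt T3" "verts T3 = verts T"
      "layered T3 w v (ts @ [x])" "ppt.Tri T3 \<inter> KL w v (ts @ [x]) = {}" "(x, w) \<in> ppt.Tri T3" by blast
    have n3: "length (ts @ [x]) + 2 \<le> ?n" using lenb[OF T3(3,5)] T3(4) by simp
    have "card (verts T3) - length (ts @ [x]) < ?n - length ts" using T3(4) n by simp
    from less.hyps[OF this T3(3,5,6)] T3(7) obtain k T' ts' where
      k: "k \<le> 5 * card (verts T3) * (card (verts T3) - length (ts @ [x]))" "(flip_both ^^ k) T3 T'" "ppt T'"
      "verts T' = verts T3" "layered T' w v ts'" "(v, last ts') \<in> ppt.Tri T'" "(last ts', w) \<in> ppt.Tri T'"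
      by auto
    have "(flip_both ^^ (k1 + 1)) T T2" using T1(2) f2 by (rule relpowp_trans)
    then have "(flip_both ^^ (k1 + 1 + k3)) T T3" using T3(2) by (rule relpowp_trans)
    then have "(flip_both ^^ (k1 + 1 + k3 + k)) T T'" using k(2) by (rule relpowp_trans)
    moreover have "k1 + 1 + k3 + k \<le> 5 * ?n * (?n - length ts)"
    proof -
      have "k1 + 1 + k3 \<le> 5 * ?n" using T1(1) T3(1) n by simp
      moreover have "?n - length ts = Suc (?n - length (ts @ [x]))" using n3 by simp
      ultimately show ?thesis using k(1) T3(4) by simp
    qed
    ultimately show ?thesis using k T3(4) by (intro exI[of _ "k1 + 1 + k3 + k"] exI[of _ T'] exI[of _ ts']) simp
  qed
qed

section \<open>Bringing the triangle to the outer face\<close>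

context edge_flip
begin

abbreviation "K0 \<equiv> DA - (Tri \<union> Fq)"

lemma flip_result:
  assumes "pentagon p0 p1 p2 p3 p4" "\<not> A p0 p2" "p0 \<noteq> p2"
    and "\<exists>d\<in>Fq. reflex T d \<and> snd d = w0" "w0 \<in> {p0, p2, p3, p4}"
  shows "\<exists>T'. frozen_flip K0 T T' \<and> (p0, p1) \<in> ppt.Tri T' \<and> (p1, p2) \<in> ppt.Tri T'"
proof -
  interpret X: diagonal_flip T a b z p q p0 p1 p2 p3 p4 w0
    by unfold_locales (fact assms)+
  have "frozen_flip K0 T X.T2" by (rule X.frozen_flip_T2) blast+
  moreover have "(p0, p1) \<in> ppt.Tri X.T2" "(p1, p2) \<in> ppt.Tri X.T2" by (simp_all add: X.Tri_T2 X.T3_def)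
  ultimately show ?thesis by blast
qed

lemma inside_Fq:
  assumes "(a, b) \<notin> cyc x y t" "(c, d) \<in> Fq"
  shows "inside x y t (fc (c, d))"
proof -
  have "fc (a, b) = Tri" using FF_fc[OF Tri(1), of "(a, b)"] by (simp add: Tri_ab)
  then have "inside x y t (fc (b, a))" using inside_step[of x y t a b] inside_Tri ab assms(1) by simp
  then show ?thesis using FF_fc[OF Fq(1) assms(2)] fc_ba by simp
qed

text \<open>Otherwise the edge \<open>p0 p2\<close> would form, with the ear \<open>p1\<close>, a 3-cycle that has the quadrilateral on
  its inside and its reflex vertex on it.\<close>

lemma reflex_diagonal:
  assumes P: "pentagon p0 p1 p2 p3 p4" and ne: "{p0, p2} \<noteq> {a, b}"
    and w0: "\<exists>d\<in>Fq. reflex T d \<and> snd d = w0" "w0 = p0 \<or> w0 = p2"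
  shows "\<not> A p0 p2"
proof
  assume A02: "A p0 p2"
  have G: "(p0, p1) \<in> Tri \<union> Fq - {(a, b), (b, a)}" "(p1, p2) \<in> Tri \<union> Fq - {(a, b), (b, a)}"
  proof -
    have eq: "{(p0, p1), (p1, p2), (p2, p3), (p3, p4), (p4, p0)} = Tri \<union> Fq - {(a, b), (b, a)}"
      using P unfolding pentagon_def by (elim conjE)
    show "(p0, p1) \<in> Tri \<union> Fq - {(a, b), (b, a)}" "(p1, p2) \<in> Tri \<union> Fq - {(a, b), (b, a)}"
      unfolding eq[symmetric] by simp_all
  qed
  have "Tri \<union> Fq \<subseteq> DA" using FF_sub[OF Tri(1)] FF_sub[OF Fq(1)] by (rule Un_least)
  then have "(p0, p1) \<in> DA" "(p1, p2) \<in> DA" using G by blast+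
  then have A01: "A p0 p1" and A12: "A p1 p2" by simp_all
  have D: "three_cycle p0 p1 p2" using A01 A12 A_sym[OF A02] by (simp add: three_cycle_def)
  have "(a, b) \<notin> cyc p0 p1 p2" using G ne by (auto simp: cyc_def)
  moreover obtain x where x: "(x, w0) \<in> Fq" "reflex T (x, w0)" using w0(1) by auto
  ultimately have "inside p0 p1 p2 (fc (x, w0))" using inside_Fq by blast
  moreover have "A x w0" using x(1) FF_sub[OF Fq(1)] in_DA by blast
  ultimately show False using reflex_not_on_cycle[OF D] x(2) w0(2) by blast
qed

text \<open>The side \<open>pq\<close> lies opposite \<open>ab\<close> and belongs to the ears
  \<open>p\<close> and \<open>q\<close>, cut off by \<open>aq\<close> and \<open>pb\<close>. These
  two diagonals together end at all four vertices of the quadrilateral, so one of them ends at the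
  reflex vertex.\<close>

lemma cross_pq: "\<exists>T'. frozen_flip K0 T T' \<and> (p, q) \<in> ppt.Tri T'"
proof -
  obtain w0 where w0: "\<exists>d\<in>Fq. reflex T d \<and> snd d = w0" "w0 \<in> {a, p, q, b}" by (rule w0_ex)
  then consider "w0 = a \<or> w0 = q" | "w0 = p \<or> w0 = b" by blast
  then show ?thesis
  proof cases
    case 1
    have "{a, q} \<noteq> {a, b}" using neqs by (auto simp: doubleton_eq_iff)
    then have "\<not> A a q" using reflex_diagonal[OF pentagons(2) _ w0(1)] 1 by blast
    then show ?thesis using flip_result[OF pentagons(2) _ _ w0(1)] more_neqs 1 by blast
  next
    case 2
    have "{p, b} \<noteq> {a, b}" using neqs by (auto simp: doubleton_eq_iff)
    then have "\<not> A p b" using reflex_diagonal[OF pentagons(3) _ w0(1)] 2 by blast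
    then show ?thesis using flip_result[OF pentagons(3) _ _ w0(1)] more_neqs 2 by blast
  qed
qed

text \<open>The ears containing \<open>ap\<close> are cut off by \<open>zp\<close> and
  \<open>aq\<close>. If the reflex vertex is \<open>b\<close>, neither diagonal ends there, but at
  least one is free: were both edges present, \<open>q\<close> would lie inside the 3-cycle
  \<open>a z p\<close> and be a neighbour of \<open>a\<close>, while by \<open>arc\<close> only
  \<open>b\<close> is joined to \<open>a\<close> from there.\<close>

lemma cross_ap:
  assumes zp: "z \<noteq> p" and zq: "z \<noteq> q"
  shows "\<exists>T'. frozen_flip K0 T T' \<and> (a, p) \<in> ppt.Tri T'"
proof -
  obtain w0 where w0: "\<exists>d\<in>Fq. reflex T d \<and> snd d = w0" "w0 \<in> {a, p, q, b}" by (rule w0_ex)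
  have ne1: "{a, q} \<noteq> {a, b}" using neqs by (auto simp: doubleton_eq_iff)
  have ne2: "{z, p} \<noteq> {a, b}" using neqs by (auto simp: doubleton_eq_iff)
  from w0(2) consider "w0 = a \<or> w0 = q" | "w0 = p" | "w0 = b" by blast
  then show ?thesis
  proof cases
    case 1
    have "\<not> A a q" using reflex_diagonal[OF pentagons(2) ne1 w0(1)] 1 by blast
    then show ?thesis using flip_result[OF pentagons(2) _ _ w0(1)] more_neqs 1 by blast
  next
    case 2
    have "\<not> A z p" using reflex_diagonal[OF pentagons(1) ne2 w0(1)] 2 by blast
    then show ?thesis using flip_result[OF pentagons(1) _ zp w0(1)] 2 by blast
  next
    case 3
    show ?thesis
    proof (cases "A z p")
      case False
      then show ?thesis using flip_result[OF pentagons(1) _ zp w0(1)] 3 by blast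
    next
      case True
      have D: "three_cycle a z p" using edges True by (simp add: three_cycle_def)
      have nc: "(a, b) \<notin> cyc a z p" using neqs more_neqs by (auto simp: cyc_def)
      have iF: "inside a z p (fc (c, d))" if "(c, d) \<in> Fq" for c d by (rule inside_Fq[OF nc that])
      have "fc (z, a) = Tri" using FF_fc[OF Tri(1), of "(z, a)"] by (simp add: Tri_ab)
      then have i1: "inside a z p (fc (z, a))" by (simp add: inside_Tri)
      have i2: "inside a z p (fc (b, a))" by (rule iF) (simp add: Fq_def)
      have "\<not> A a q"
      proof
        assume aq: "A a q"
        have o: "\<not> inside a z p (fc (q, a))"
          by (rule arc[OF D rots(3,4) ab _ _ i1 i2 aq]) (use neqs more_neqs zq in auto)
        have qD: "q \<notin> {a, z, p}" using neqs more_neqs zq by auto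
        have "inside a z p (fc (p, q))" by (rule iF) (simp add: Fq_def)
        then have "inside a z p (fc (a, q))" by (rule inside_around[OF qD edges(8) _ aq])
        moreover have "(a, q) \<notin> cyc a z p" using qD by (auto simp: cyc_def)
        ultimately show False using inside_step[OF _ aq] o by blast
      qed
      then show ?thesis using flip_result[OF pentagons(2) _ _ w0(1)] more_neqs 3 by blast
    qed
  qed
qed

text \<open>The mirror image of \<open>cross_ap\<close>: \<open>a\<close> and \<open>b\<close>, as
  well as \<open>p\<close> and \<open>q\<close>, exchange their roles. The critical reflex vertex is
  now \<open>a\<close>, and the 3-cycle is \<open>b q z\<close>.\<close>

lemma cross_qb:
  assumes zp: "z \<noteq> p" and zq: "z \<noteq> q"
  shows "\<exists>T'. frozen_flip K0 T T' \<and> (q, b) \<in> ppt.Tri T'"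
proof -
  obtain w0 where w0: "\<exists>d\<in>Fq. reflex T d \<and> snd d = w0" "w0 \<in> {a, p, q, b}" by (rule w0_ex)
  have ne1: "{p, b} \<noteq> {a, b}" using neqs by (auto simp: doubleton_eq_iff)
  have ne2: "{q, z} \<noteq> {a, b}" using neqs by (auto simp: doubleton_eq_iff)
  from w0(2) consider "w0 = p \<or> w0 = b" | "w0 = q" | "w0 = a" by blast
  then show ?thesis
  proof cases
    case 1
    have "\<not> A p b" using reflex_diagonal[OF pentagons(3) ne1 w0(1)] 1 by blast
    then show ?thesis using flip_result[OF pentagons(3) _ _ w0(1)] more_neqs 1 by blast
  next
    case 2
    have "\<not> A q z" using reflex_diagonal[OF pentagons(4) ne2 w0(1)] 2 by blast
    then show ?thesis using flip_result[OF pentagons(4) _ zq[symmetric] w0(1)] 2 by blast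
  next
    case 3
    show ?thesis
    proof (cases "A q z")
      case False
      then show ?thesis using flip_result[OF pentagons(4) _ zq[symmetric] w0(1)] 3 by blast
    next
      case True
      have D: "three_cycle b q z" using edges True by (simp add: three_cycle_def)
      have nc: "(a, b) \<notin> cyc b q z" using neqs more_neqs by (auto simp: cyc_def)
      have iF: "inside b q z (fc (c, d))" if "(c, d) \<in> Fq" for c d by (rule inside_Fq[OF nc that])
      have "fc (a, b) = Tri" using FF_fc[OF Tri(1), of "(a, b)"] by (simp add: Tri_ab)
      then have i2: "inside b q z (fc (a, b))" by (simp add: inside_Tri)
      have i1: "inside b q z (fc (q, b))" by (rule iF) (simp add: Fq_def)
      have "\<not> A p b"
      proof
        assume "A p b"
        then have bp: "A b p" by (rule A_sym)
        have o: "\<not> inside b q z (fc (p, b))"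
          by (rule arc[OF D rots(7,1) edges(1) _ _ i1 i2 bp]) (use neqs more_neqs zp in auto)
        have pD: "p \<notin> {b, q, z}" using neqs more_neqs zp by auto
        have "inside b q z (fc (a, p))" by (rule iF) (simp add: Fq_def)
        then have "inside b q z (fc (b, p))" by (rule inside_around[OF pD edges(6) _ bp])
        moreover have "(b, p) \<notin> cyc b q z" using pD by (auto simp: cyc_def)
        ultimately show False using inside_step[OF _ bp] o by blast
      qed
      then show ?thesis using flip_result[OF pentagons(3) _ _ w0(1)] more_neqs 3 by blast
    qed
  qed
qed

lemma Tri_not_outer: "(c, d) \<in> Tri \<Longrightarrow> (c, d) \<notin> outer T" and Fq_not_outer: "(c, d) \<in> Fq \<Longrightarrow> (c, d) \<notin> outer T"
  using FF_disj[OF Tri(1) outer_FF Tri(2)] FF_disj[OF Fq(1) outer_FF Fq(2)] by blast+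

text \<open>If \<open>z = p\<close> or \<open>z = q\<close>, the triangle and the quadrilateral share two edges, and for one of the
  exits the other one has to be flipped.\<close>

lemma cross:
  assumes g: "(g1, g2) \<in> Fq" "(g2, g1) \<notin> Tri"
  shows "\<exists>T'. frozen_flip K0 T T' \<and> (g1, g2) \<in> ppt.Tri T'"
proof -
  have "(b, a) \<noteq> (g1, g2)" using g(2) by (auto simp: Tri_ab)
  then consider "g1 = a" "g2 = p" | "g1 = p" "g2 = q" | "g1 = q" "g2 = b"
    using g(1) by (auto simp: Fq_def)
  then show ?thesis
  proof cases
    case 1
    have zp: "z \<noteq> p" using g(2) 1 by (auto simp: Tri_ab)
    show ?thesis
    proof (cases "z = q")
      case False
      then show ?thesis using cross_ap[OF zp] 1 by simp
    next
      case True
      \<comment> \<open>The triangle and the quadrilateral also share \<open>bz\<close>. Seen from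
        this edge the exit \<open>ap\<close> is the opposite side, so \<open>cross_pq\<close>
        applies.\<close>
      interpret E: edge_flip T b z a a p
      proof unfold_locales
        show "A b z" by (rule edges(2))
        show "r z b = a" "r a z = b" "r b a = z" "r b z = a" "r a b = p" "r p a = z" "r z p = b"
          using rots True by simp_all
        show "(b, z) \<notin> outer T" by (rule Tri_not_outer) (simp add: Tri_ab)
        show "(z, b) \<notin> outer T" by (rule Fq_not_outer) (simp add: Fq_def True)
      qed
      have "Fq = {(z, b), (b, a), (a, p), (p, z)}" unfolding Fq_def using True by auto
      then have "E.Fq = Fq" using E.Fq_def by simp
      then show ?thesis using E.cross_pq 1 by simp
    qed
  next
    case 2
    then show ?thesis using cross_pq by simp
  next
    case 3
    have zq: "z \<noteq> q" using g(2) 3 by (auto simp: Tri_ab)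
    show ?thesis
    proof (cases "z = p")
      case False
      then show ?thesis using cross_qb[OF _ zq] 3 by simp
    next
      case True
      \<comment> \<open>Likewise the second shared edge \<open>za\<close> has the exit
        \<open>qb\<close> as its opposite side.\<close>
      interpret E: edge_flip T z a b q b
      proof unfold_locales
        show "A z a" by (rule edges(4))
        show "r a z = b" "r b a = z" "r z b = a" "r z a = q" "r q z = b" "r b q = a" "r a b = z"
          using rots True by simp_all
        show "(z, a) \<notin> outer T" by (rule Tri_not_outer) (simp add: Tri_ab)
        show "(a, z) \<notin> outer T" by (rule Fq_not_outer) (simp add: Fq_def True)
      qed
      have "Fq = {(a, z), (z, q), (q, b), (b, a)}" unfolding Fq_def using True by auto
      then have "E.Fq = Fq" using E.Fq_def by simp
      then show ?thesis using E.cross_pq 3 by simp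
    qed
  qed
qed

end

section \<open>Following a dual path to the outer face\<close>

lemma (in ppt) cross_face:
  assumes ab: "A a b" "Tri = fc (a, b)" "F = fc (b, a)" "F \<noteq> outer T" "F \<noteq> Tri"
    and g: "A g1 g2" "F = fc (g1, g2)" "fc (g2, g1) \<noteq> Tri"
  shows "\<exists>T'. frozen_flip (DA - (Tri \<union> F)) T T' \<and> (g1, g2) \<in> ppt.Tri T'"
proof -
  have FF: "F \<in> FF" using ab(3) A_sym[OF ab(1)] by auto
  have "card F = 4" using int_card[OF FF ab(4)] TriI[OF FF ab(4)] ab(5) by blast
  then obtain p q where pq: "r a b = p" "r p a = q" "r q p = b" "r b q = a"
    using face4_rot[OF A_sym[OF ab(1)]] ab(3) by metis
  obtain z where z: "r b a = z" "r z b = a" "r a z = b"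
    using face3_rot[OF ab(1)] Tri(3) ab(2) by metis
  have o: "(a, b) \<notin> outer T" "(b, a) \<notin> outer T"
    using FF_fc[OF outer_FF] ab(2-4) Tri(2) by metis+
  interpret E: edge_flip T a b z p q
    by unfold_locales (simp_all add: ab(1) z pq o)
  have "(g1, g2) \<in> E.Fq" using g(2) ab(3) E.fc_ba fc_self[of "(g1, g2)"] by simp
  moreover have "(g2, g1) \<notin> Tri" using FF_fc[OF Tri(1), of "(g2, g1)"] g(3) by metis
  ultimately show ?thesis using E.cross ab(3) E.fc_ba by simp
qed

text \<open>On a shortest dual path, the part beyond the first quadrilateral \<open>F\<close> avoids
  both \<open>Tri\<close> and \<open>F\<close>, so its faces and crossings survive a flip inside
  their union. Flipping so that the new triangle contains the exit edge of \<open>F\<close> shortens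
  the path by one. At length one the triangle has an edge on the outer face.\<close>

lemma reach_outer:
  assumes "ppt T" "(emap.cr (rot T) (darts (adj T)) ^^ m) (ppt.Tri T) (outer T)"
  shows "\<exists>k T' x y. k \<le> m \<and> (flip_both ^^ k) T T' \<and> ppt T' \<and> verts T' = verts T \<and>
    (x, y) \<in> outer T' \<and> (y, x) \<in> ppt.Tri T'"
  using assms
proof (induction m arbitrary: T rule: less_induct)
  case (less m)
  interpret ppt T by (rule less.prems(1))
  let ?c = "cr DA"
  have path: "(?c ^^ m) Tri (outer T)" by (rule less.prems(2))
  show ?case
  proof (cases "\<exists>j<m. (?c ^^ j) Tri (outer T)")
    case True
    then obtain j where "j < m" "(?c ^^ j) Tri (outer T)" by blast
    then show ?thesis using less.IH[OF _ less.prems(1)] by (meson le_trans less_imp_le)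
  next
    case False
    then have minT: "\<not> (?c ^^ j) Tri (outer T)" if "j < m" for j using that by blast
    consider "m = 0" | "m = 1" | j where "m = Suc (Suc j)" by (metis One_nat_def not0_implies_Suc)
    then show ?thesis
    proof cases
      case 1
      then show ?thesis using path Tri(2) by simp
    next
      case 2
      then have "?c Tri (outer T)" using path by (simp only: relpowp_1)
      then obtain x y where xy: "Tri = fc (x, y)" "outer T = fc (y, x)" unfolding cr_def by blast
      then have "(x, y) \<in> Tri" "(y, x) \<in> outer T" using fc_self by metis+
      then show ?thesis using less.prems(1) by (intro exI[of _ 0] exI[of _ T] exI[of _ y] exI[of _ x]) simp
    next
      case 3
      have Suc_path: "(?c ^^ Suc i) f (outer T)" if "?c f g" "(?c ^^ i) g (outer T)" for i f g
        using that by (rule relpowp_Suc_I2)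
      obtain F where F: "?c Tri F" "(?c ^^ Suc j) F (outer T)"
        using path unfolding 3 by (rule relpowp_Suc_E2)
      obtain H where H: "?c F H" "(?c ^^ j) H (outer T)" using F(2) by (rule relpowp_Suc_E2)
      obtain a b where ab: "A a b" "Tri = fc (a, b)" "F = fc (b, a)" using F(1) unfolding cr_def by auto
      obtain g1 g2 where g: "A g1 g2" "F = fc (g1, g2)" "H = fc (g2, g1)" using H(1) unfolding cr_def by auto
      have minF: "\<not> (?c ^^ i) F (outer T)" if "i \<le> j" for i
        using minT[of "Suc i"] Suc_path[OF F(1)] that 3 by auto
      have F1: "F \<noteq> outer T" using minF[of 0] by auto
      have F2: "F \<noteq> Tri" using minT[of "Suc j"] F(2) 3 by auto
      have H1: "H \<noteq> Tri" using minT[of j] H(2) 3 by auto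
      have H2: "H \<noteq> F" using minF[of j] H(2) by auto
      obtain T' where S: "frozen_flip (DA - (Tri \<union> F)) T T'" and gT': "(g1, g2) \<in> ppt.Tri T'"
        using cross_face[OF ab F1 F2 g(1,2)] g(3) H1 by blast
      interpret T': ppt T' by (rule frozen_flipD(1)[OF S])
      have FF: "F \<in> FF" using ab(3) A_sym[OF ab(1)] by auto
      have same: "adj T' x y \<and> T'.fc (x, y) = fc (x, y)"
        if xy: "A x y" "fc (x, y) \<noteq> Tri" "fc (x, y) \<noteq> F" for x y
      proof -
        have n: "(u, v) \<in> DA - (Tri \<union> F)" if "(u, v) \<in> fc (x, y)" for u v
        proof -
          have "(u, v) \<in> DA" using that fc_sub[of "(x, y)"] xy(1) by auto
          moreover have "fc (u, v) = fc (x, y)" using fc_eq[OF _ that] xy(1) by simp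
          ultimately show ?thesis using FF_fc[OF Tri(1), of "(u, v)"] FF_fc[OF FF, of "(u, v)"] xy(2,3) by auto
        qed
        have "T'.fc (x, y) = fc (x, y)"
        proof (rule face_of_cong)
          fix e assume e: "e \<in> fc (x, y)"
          obtain u v where uv: "e = (u, v)" by (cases e)
          show "fnext T'.r e = fnext r e" using frozen_flipD(7)[OF S n] e by (simp add: uv fnext_def)
        qed
        then show ?thesis using frozen_flipD(6)[OF S n] fc_self by blast
      qed
      have step': "T'.cr T'.DA f h" if "?c f h" "f \<noteq> Tri" "f \<noteq> F" "h \<noteq> Tri" "h \<noteq> F" for f h
      proof -
        obtain x y where xy: "A x y" "f = fc (x, y)" "h = fc (y, x)" using \<open>?c f h\<close> unfolding cr_def by auto
        then show ?thesis unfolding T'.cr_def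
          using same[OF xy(1)] same[OF A_sym[OF xy(1)]] that(2-5) by (intro exI[of _ x] exI[of _ y]) simp
      qed
      have path': "(T'.cr T'.DA ^^ i) f (outer T)" if "(?c ^^ i) f (outer T)" "i \<le> j" for i f
        using that
      proof (induction i arbitrary: f)
        case (Suc i)
        obtain h where h: "?c f h" "(?c ^^ i) h (outer T)" using Suc.prems(1) by (rule relpowp_Suc_E2)
        have "f \<noteq> Tri" "h \<noteq> Tri" using minT[of "Suc i"] minT[of i] Suc.prems h(2) 3 by auto
        moreover have "f \<noteq> F" "h \<noteq> F" using minF[of "Suc i"] minF[of i] Suc.prems h(2) by auto
        ultimately have "T'.cr T'.DA f h" using step' h(1) by blast
        then show ?case using Suc.IH[OF h(2)] Suc.prems(2) by (intro relpowp_Suc_I2) auto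
      qed simp
      have gA: "adj T' g1 g2" using T'.FF_sub[OF T'.Tri(1)] gT' by auto
      have Hs: "T'.fc (g2, g1) = H" using same[OF A_sym[OF g(1)]] g(3) H1 H2 by simp
      have "T'.Tri = T'.fc (g1, g2)" by (rule T'.FF_fc[OF T'.Tri(1) gT'])
      then have "T'.cr T'.DA T'.Tri H" unfolding T'.cr_def using gA Hs
        by (intro exI[of _ g1] exI[of _ g2]) simp
      then have "(T'.cr T'.DA ^^ Suc j) T'.Tri (outer T')"
        using path'[OF H(2)] frozen_flipD(5)[OF S] by (intro relpowp_Suc_I2) auto
      then obtain k T'' x y where k: "k \<le> Suc j" "(flip_both ^^ k) T' T''" "ppt T''" "verts T'' = verts T'"
        "(x, y) \<in> outer T''" "(y, x) \<in> ppt.Tri T''"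
        using less.IH[OF _ frozen_flipD(1)[OF S], of "Suc j"] 3 by auto
      have "(flip_both ^^ Suc k) T T''" using frozen_flip_imp_flip_both[OF S] k(2) by (rule relpowp_Suc_I2)
      then show ?thesis using k frozen_flipD(4)[OF S] 3
        by (intro exI[of _ "Suc k"] exI[of _ T''] exI[of _ x] exI[of _ y]) simp
    qed
  qed
qed

text \<open>A shortest dual path is no longer than the number of adjacent pairs of faces, which is
  bounded by the number of darts. The resulting n * n already matches the bound to be shown.\<close>

lemma reach_outer_bound:
  assumes "ppt T"
  shows "\<exists>k T' x y. k \<le> card (verts T) * card (verts T) \<and> (flip_both ^^ k) T T' \<and> ppt T' \<and> verts T' = verts T \<and>
    (x, y) \<in> outer T' \<and> (y, x) \<in> ppt.Tri T'"
proof -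
  interpret ppt T by (rule assms)
  let ?R = "{(f, g). cr DA f g}"
  have R: "?R \<subseteq> (\<lambda>(x, y). (fc (x, y), fc (y, x))) ` DA"
  proof
    fix e assume "e \<in> ?R"
    then obtain f g where e: "e = (f, g)" "cr DA f g" by blast
    then obtain x y where "(x, y) \<in> DA" "f = fc (x, y)" "g = fc (y, x)" unfolding cr_def by blast
    then show "e \<in> (\<lambda>(x, y). (fc (x, y), fc (y, x))) ` DA" using e by (intro image_eqI[of _ _ "(x, y)"]) auto
  qed
  have finR: "finite ?R" by (rule finite_subset[OF R]) (use finD in simp)
  have "card ?R \<le> card DA" using card_mono[OF _ R] card_image_le[OF finD] finD by (meson finite_imageI le_trans)
  also have "\<dots> \<le> card (verts T \<times> verts T)"
  proof (rule card_mono)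
    show "DA \<subseteq> verts T \<times> verts T" unfolding darts_def by (auto intro: A_V)
  qed (use finV in simp)
  finally have cR: "card ?R \<le> card (verts T) * card (verts T)" by (simp add: card_cartesian_product)
  have "(Tri, outer T) \<in> ?R\<^sup>*"
    using dual_connected[OF Tri(1) outer_FF] by (simp add: rtranclp_rtrancl_eq)
  then obtain m where m: "m \<le> card ?R" "(Tri, outer T) \<in> ?R ^^ m"
    using rtrancl_finite_eq_relpow[OF finR] by auto
  have "((\<lambda>f g. (f, g) \<in> ?R) ^^ m) Tri (outer T)" using m(2) by (simp only: relpowp_relpow_eq)
  then have "(cr DA ^^ m) Tri (outer T)" by simp
  from reach_outer[OF assms this] show ?thesis using m(1) cR by (meson le_trans)
qed

section \<open>The canonical form\<close>

text \<open>The canonical form: the two conditions on the triangle force it to be the whole region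
  inside \<open>w (last ts) v\<close>, so the layers exhaust all vertices.\<close>

definition fan :: "cppt \<Rightarrow> nat \<Rightarrow> nat \<Rightarrow> nat list \<Rightarrow> bool" where
  "fan T w v ts \<longleftrightarrow> layered T w v ts \<and> (v, last ts) \<in> ppt.Tri T \<and> (last ts, w) \<in> ppt.Tri T"

lemma reach_fan:
  assumes "ppt T"
  shows "\<exists>k T' w v ts. k \<le> 6 * (card (verts T) * card (verts T)) \<and> (flip_both ^^ k) T T' \<and> ppt T' \<and> verts T' = verts T \<and>
    fan T' w v ts"
proof -
  obtain k1 T1 w u where T1: "k1 \<le> card (verts T) * card (verts T)" "(flip_both ^^ k1) T T1" "ppt T1"
    "verts T1 = verts T" "(w, u) \<in> outer T1" "(u, w) \<in> ppt.Tri T1"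
    using reach_outer_bound[OF assms] by blast
  interpret ppt T1 by (rule T1(3))
  have wu: "A w u" using FF_sub[OF outer_FF] T1(5) by auto
  have o: "fc (w, u) = outer T1" using FF_fc[OF outer_FF T1(5)] by simp
  then obtain v where v: "r u w = v" "r v u = w" "r w v = u" using face3_rot[OF wu] card_outer by metis
  have out: "outer T1 = {(w, u), (u, v), (v, w)}"
    unfolding o[symmetric] by (rule face_of_3) (simp_all add: fnext_def v)
  have uv: "A u v" and vw: "A v w" using FF_sub[OF outer_FF] out by auto
  have KL: "KL w v [u] = outer T1" unfolding out by (auto simp: KL_def)
  have L: "layered T1 w v [u]" unfolding layered_def KL
    using out v FF_sub[OF outer_FF] A_neq[OF wu] A_neq[OF uv] A_neq[OF vw] by auto
  have "Tri \<inter> KL w v [u] = {}" unfolding KL by (rule FF_disj[OF Tri(1) outer_FF Tri(2)])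
  then obtain k2 T2 ts where T2: "k2 \<le> 5 * card (verts T1) * (card (verts T1) - length [u])" "(flip_both ^^ k2) T1 T2"
    "ppt T2" "verts T2 = verts T1" "layered T2 w v ts" "(v, last ts) \<in> ppt.Tri T2" "(last ts, w) \<in> ppt.Tri T2"
    using reach_full_layering[OF T1(3) L] T1(6) by auto
  have "k2 \<le> 5 * card (verts T) * card (verts T)"
    using T2(1) T1(4) by (metis diff_le_self le_trans mult_le_mono2)
  then have "k1 + k2 \<le> 6 * (card (verts T) * card (verts T))" using T1(1) by simp
  moreover have "(flip_both ^^ (k1 + k2)) T T2" using T1(2) T2(2) by (rule relpowp_trans)
  ultimately show ?thesis using T2(3-7) T1(4) unfolding fan_def by metis
qed

section \<open>Structure of the canonical form\<close>

locale fan_ppt = ppt +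
  fixes w v :: nat and ts :: "nat list"
  assumes fan: "fan T w v ts"
begin

lemma L: "layered T w v ts" using fan by (simp add: fan_def)

lemma ne: "ts \<noteq> []" and dist: "distinct (w # v # ts)"
  and out: "outer T = {(w, ts ! 0), (ts ! 0, v), (v, w)}" and KD: "KL w v ts \<subseteq> DA"
  using L by (simp_all add: layered_def)

lemma Tri_last: "r (last ts) v = w" "r w (last ts) = v" "r v w = last ts"
  "Tri = {(v, last ts), (last ts, w), (w, v)}"
proof -
  let ?u = "last ts"
  have t: "(v, ?u) \<in> Tri" "(?u, w) \<in> Tri" using fan by (simp_all add: fan_def)
  have vu: "A v ?u" using t(1) FF_sub[OF Tri(1)] by auto
  have f: "fc (v, ?u) = Tri" using FF_fc[OF Tri(1) t(1)] by simp
  then obtain c where c: "r ?u v = c" "r c ?u = v" "r v c = ?u" using face3_rot[OF vu] Tri(3) by metis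
  have F: "Tri = {(v, ?u), (?u, c), (c, v)}"
    unfolding f[symmetric] by (rule face_of_3) (simp_all add: fnext_def c)
  have "?u \<noteq> v" using A_neq[OF vu] by simp
  have "?u \<noteq> w" using t(2) FF_sub[OF Tri(1)] A_irr by auto
  have wv: "w \<noteq> v" using dist by simp
  have cw: "c = w" using t(2) \<open>?u \<noteq> v\<close> wv unfolding F by auto
  show "r ?u v = w" "r w ?u = v" "r v w = ?u" using c cw by simp_all
  show "Tri = {(v, ?u), (?u, w), (w, v)}" using F cw by simp
qed

lemma rot_t: "t \<in> set ts \<Longrightarrow> r t w = v" "t \<in> set ts \<Longrightarrow> r t v = w"
proof -
  assume t: "t \<in> set ts"
  obtain i where i: "i < length ts" "t = ts ! i" using t by (metis in_set_conv_nth)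
  show "r t w = v" using i L by (cases i) (simp_all add: layered_def)
  show "r t v = w"
  proof (cases "Suc i < length ts")
    case True then show ?thesis using i L by (simp add: layered_def)
  next
    case False
    then have "i = length ts - 1" using i by simp
    then have "t = last ts" using i ne by (simp add: last_conv_nth)
    then show ?thesis using Tri_last by simp
  qed
qed

lemma rot_w: "r w v = ts ! 0" "Suc i < length ts \<Longrightarrow> r w (ts ! i) = ts ! Suc i" "r w (last ts) = v"
  and rot_v: "r v w = last ts" "Suc i < length ts \<Longrightarrow> r v (ts ! Suc i) = ts ! i" "r v (ts ! 0) = w"
  using L Tri_last by (simp_all add: layered_def)

text \<open>The known darts are closed under reversal and under rotation. Hence every vertex with
  one known dart has all of its darts known, and connectivity reaches every vertex.\<close>

lemma DA_eq: "DA = KL w v ts \<union> Tri"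
proof -
  let ?P = "KL w v ts \<union> Tri"
  note sp = set_butlast_last[OF ne]
  have P: "?P = {(v, w), (w, v)} \<union> {w} \<times> set ts \<union> set ts \<times> {v} \<union> set ts \<times> {w} \<union> {v} \<times> set ts"
    unfolding KL_def Tri_last(4) sp by blast
  have PD: "?P \<subseteq> DA" using KD FF_sub[OF Tri(1)] by blast
  have swp: "(y, x) \<in> ?P" if "(x, y) \<in> ?P" for x y using that unfolding P by auto
  have nxt: "(y, r y x) \<in> ?P" if xy: "(x, y) \<in> ?P" for x y
  proof (cases "(x, y) \<in> Tri")
    case True
    then have "fnext r (x, y) \<in> Tri" by (rule FF_fn[OF Tri(1)])
    then show ?thesis by (simp add: fnext_def)
  next
    case False
    then have "(x, y) \<in> KL w v ts" using xy by simp
    then show ?thesis using enclosedD(2)[OF layered_enclosed[OF ppt_axioms L]] by blast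
  qed
  have around: "(x, y) \<in> ?P" if xy0: "(x, y0) \<in> ?P" and xy: "A x y" for x y0 y
  proof -
    have x0: "A x y0" using xy0 PD by auto
    obtain k where k: "(r x ^^ k) y0 = y" using rot_trans[OF x0 xy] by blast
    have "(x, (r x ^^ j) y0) \<in> ?P" for j
    proof (induction j)
      case (Suc j)
      show ?case using nxt[OF swp[OF Suc]] by simp
    qed (use xy0 in simp)
    then show ?thesis using k by metis
  qed
  have w0: "(w, v) \<in> ?P" by (simp add: Tri_last(4))
  have wV: "w \<in> verts T" using w0 PD A_V(1)[of w v] by auto
  have all: "\<exists>y. (x, y) \<in> ?P" if "A\<^sup>*\<^sup>* w x" for x
    using that
  proof (induction rule: rtranclp_induct)
    case base
    show ?case using w0 by blast
  next
    case (step x x')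
    then obtain y where "(x, y) \<in> ?P" by blast
    then have "(x, x') \<in> ?P" using around step(2) by blast
    then show ?case using swp by blast
  qed
  have "DA \<subseteq> ?P"
  proof
    fix d assume d: "d \<in> DA"
    obtain x y where xy: "d = (x, y)" by (cases d)
    have Axy: "A x y" using d xy by simp
    obtain y0 where "(x, y0) \<in> ?P" using all[OF A_conn[OF wV A_V(1)[OF Axy]]] by blast
    then show "d \<in> ?P" using around Axy xy by blast
  qed
  then show ?thesis using PD by blast
qed

lemma adj_iff: "A x y \<longleftrightarrow> x = v \<and> y = w \<or> x = w \<and> y = v \<or> x \<in> set ts \<and> (y = w \<or> y = v) \<or> y \<in> set ts \<and> (x = w \<or> x = v)"
proof -
  note sp = set_butlast_last[OF ne]
  have "A x y \<longleftrightarrow> (x, y) \<in> KL w v ts \<union> Tri" unfolding DA_eq[symmetric] by simp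
  then show ?thesis unfolding KL_def Tri_last(4) sp by blast
qed

lemma verts_eq: "verts T = set (w # v # ts)"
proof
  have "w \<in> verts T" using A_V(1)[of w v] adj_iff by simp
  show "verts T \<subseteq> set (w # v # ts)"
  proof
    fix x assume x: "x \<in> verts T"
    show "x \<in> set (w # v # ts)"
    proof (cases "x = w")
      case False
      have "A\<^sup>*\<^sup>* x w" by (rule A_conn[OF x \<open>w \<in> verts T\<close>])
      then obtain y where "A x y" using False by (metis converse_rtranclpE)
      then show ?thesis using adj_iff by auto
    qed simp
  qed
  show "set (w # v # ts) \<subseteq> verts T"
    using A_V(1)[of _ w] A_V(1)[of w v] A_V(1)[of v w] adj_iff by auto
qed

text \<open>One reflex angle is known at every vertex, from the outer face or from a layer;
  pointedness excludes all others.\<close>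

lemma reflex_iff: assumes "A x y"
  shows "reflex T (x, y) \<longleftrightarrow> (y = w \<and> x = v) \<or> (y = v \<and> x = ts ! 0) \<or> (y \<in> set ts \<and> x = w)"
proof -
  have o: "reflex T (v, w)" "reflex T (ts ! 0, v)" "reflex T (w, ts ! 0)" using outer_reflex out by simp_all
  have t: "reflex T (w, t)" if t: "t \<in> set ts" for t
  proof -
    obtain i where i: "i < length ts" "t = ts ! i" using t by (metis in_set_conv_nth)
    then show ?thesis using o(3) L by (cases i) (simp_all add: layered_def)
  qed
  have e: "A v w" "A (ts ! 0) v" "\<And>t. t \<in> set ts \<Longrightarrow> A w t" using adj_iff ne by simp_all
  have d: "w \<noteq> v" "w \<notin> set ts" "v \<notin> set ts" using dist by simp_all
  consider "y = w" | "y = v" | "y \<in> set ts" using assms unfolding adj_iff by blast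
  then show ?thesis
  proof cases
    case 1
    then show ?thesis using reflex_unique[OF assms, of v] o(1) e(1) d by metis
  next
    case 2
    then show ?thesis using reflex_unique[OF assms, of "ts ! 0"] o(2) e(2) d by metis
  next
    case 3
    then show ?thesis using reflex_unique[OF assms, of w] t[OF 3] e(3)[OF 3] d by metis
  qed
qed

end

text \<open>Adjacency, rotation, tags and outer face of a fan are given by explicit formulas in
  \<open>w\<close>, \<open>v\<close> and \<open>ts\<close>. Matching the lists position by position
  is therefore an isomorphism as soon as their lengths agree, and the lengths are fixed by the
  number of vertices.\<close>

lemma fan_iso:
  assumes "ppt T" "fan T w v ts" "ppt T'" "fan T' w' v' ts'" "card (verts T) = card (verts T')"
  shows "cppt_iso T T'"
proof -
  interpret X: fan_ppt T w v ts using assms(1,2) by (simp add: fan_ppt_def fan_ppt_axioms_def)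
  interpret Y: fan_ppt T' w' v' ts' using assms(3,4) by (simp add: fan_ppt_def fan_ppt_axioms_def)
  let ?xs = "w # v # ts" and ?ys = "w' # v' # ts'"
  have len: "length ts = length ts'"
    using assms(5) distinct_card[OF X.dist] distinct_card[OF Y.dist] by (simp only: X.verts_eq Y.verts_eq) simp
  define f where "f x = the (map_of (zip ?xs ?ys) x)" for x
  have f_nth: "f (?xs ! i) = ?ys ! i" if "i < length ?xs" for i
    unfolding f_def using map_of_zip_nth[of ?xs ?ys i] X.dist len that by simp
  have fw: "f w = w'" using f_nth[of 0] by simp
  have fv: "f v = v'" using f_nth[of 1] by simp
  have ft: "f (ts ! i) = ts' ! i" if "i < length ts" for i using f_nth[of "Suc (Suc i)"] that by simp
  have bij: "bij_betw f (set ?xs) (set ?ys)"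
  proof (rule bij_betwI')
    fix x y assume "x \<in> set ?xs" "y \<in> set ?xs"
    then obtain i j where ij: "i < length ?xs" "x = ?xs ! i" "j < length ?xs" "y = ?xs ! j"
      by (metis in_set_conv_nth)
    have "f x = f y \<longleftrightarrow> i = j"
      using f_nth[OF ij(1)] f_nth[OF ij(3)] ij nth_eq_iff_index_eq[OF Y.dist, of i j] len by simp
    then show "(f x = f y) = (x = y)" using ij nth_eq_iff_index_eq[OF X.dist, of i j] by simp
  next
    fix x assume "x \<in> set ?xs"
    then obtain i where i: "i < length ?xs" "x = ?xs ! i" by (metis in_set_conv_nth)
    then have "f x = ?ys ! i" using f_nth by simp
    then show "f x \<in> set ?ys" using i(1) len by (metis length_Cons nth_mem)
  next
    fix y assume "y \<in> set ?ys"
    then obtain i where i: "i < length ?ys" "y = ?ys ! i" by (metis in_set_conv_nth)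
    then have "y = f (?xs ! i)" "?xs ! i \<in> set ?xs" using f_nth[of i] len nth_mem[of i ?xs] by simp_all
    then show "\<exists>x\<in>set ?xs. y = f x" by blast
  qed
  have fts: "f t \<in> set ts'" if t: "t \<in> set ts" for t
  proof -
    obtain i where i: "i < length ts" "t = ts ! i" using t by (metis in_set_conv_nth)
    then show ?thesis using ft len by simp
  qed
  have d: "w \<noteq> v" "w \<notin> set ts" "v \<notin> set ts" using X.dist by simp_all
  have d': "w' \<noteq> v'" "w' \<notin> set ts'" "v' \<notin> set ts'" using Y.dist by simp_all
  have last: "f (last ts) = last ts'" using ft[of "length ts - 1"] X.ne Y.ne len by (simp add: last_conv_nth)
  have f0: "f (ts ! 0) = ts' ! 0" using ft[of 0] X.ne by simp
  have inv: "f x = w' \<longleftrightarrow> x = w" "f x = v' \<longleftrightarrow> x = v" "f x \<in> set ts' \<longleftrightarrow> x \<in> set ts"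
    if x: "x \<in> set ?xs" for x
  proof -
    have "x \<in> set ts \<Longrightarrow> f x \<noteq> w' \<and> f x \<noteq> v'" using fts[of x] d' by metis
    then show "f x = w' \<longleftrightarrow> x = w" "f x = v' \<longleftrightarrow> x = v" "f x \<in> set ts' \<longleftrightarrow> x \<in> set ts"
      using x fw fv fts[of x] d d' by auto
  qed
  show ?thesis unfolding cppt_iso_def
  proof (intro exI[of _ f] conjI ballI allI impI)
    show "bij_betw f (verts T) (verts T')" unfolding X.verts_eq Y.verts_eq by (rule bij)
    fix x y assume "x \<in> verts T" "y \<in> verts T"
    then have x: "x \<in> set ?xs" and y: "y \<in> set ?xs" by (simp_all only: X.verts_eq)
    show "adj T' (f x) (f y) = adj T x y"
      unfolding X.adj_iff Y.adj_iff inv[OF x] inv[OF y] ..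
  next
    fix x y assume xy: "adj T x y"
    then consider "x = v" "y = w" | "x = w" "y = v" | "x \<in> set ts" "y = w" | "x \<in> set ts" "y = v"
      | "y \<in> set ts" "x = w" | "y \<in> set ts" "x = v" unfolding X.adj_iff by blast
    then show "rot T' (f x) (f y) = f (rot T x y)"
    proof cases
      case 1
      then show ?thesis using X.rot_v(1) Y.rot_v(1) fv fw last by simp
    next
      case 2
      then show ?thesis using X.rot_w(1) Y.rot_w(1) fv fw f0 by simp
    next
      case 3
      then show ?thesis using X.rot_t(1) Y.rot_t(1) fts fv fw by simp
    next
      case 4
      then show ?thesis using X.rot_t(2) Y.rot_t(2) fts fv fw by simp
    next
      case 5
      then obtain i where i: "i < length ts" "y = ts ! i" by (metis in_set_conv_nth)
      show ?thesis
      proof (cases "Suc i < length ts")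
        case True
        then show ?thesis using 5 i X.rot_w(2) Y.rot_w(2) ft fw len by simp
      next
        case False
        then have "i = length ts - 1" using i by simp
        then have "y = last ts" using i X.ne by (simp add: last_conv_nth)
        then show ?thesis using 5 X.rot_w(3) Y.rot_w(3) last fw fv by simp
      qed
    next
      case 6
      then obtain i where i: "i < length ts" "y = ts ! i" by (metis in_set_conv_nth)
      show ?thesis
      proof (cases i)
        case 0
        then show ?thesis using 6 i X.rot_v(3) Y.rot_v(3) f0 fw fv by simp
      next
        case (Suc j)
        then show ?thesis using 6 i X.rot_v(2)[of j] Y.rot_v(2)[of j] ft fv len by simp
      qed
    qed
  next
    fix x y assume xy: "adj T x y"
    have x: "x \<in> set ?xs" and y: "y \<in> set ?xs" using X.A_V[OF xy] by (simp_all only: X.verts_eq)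
    have xy': "adj T' (f x) (f y)"
      using xy unfolding X.adj_iff Y.adj_iff inv[OF x] inv[OF y] .
    have t0: "f x = ts' ! 0 \<longleftrightarrow> x = ts ! 0"
    proof -
      have "ts ! 0 \<in> set ?xs" using X.ne by simp
      then show ?thesis using bij x f0 unfolding bij_betw_def inj_on_def by metis
    qed
    show "reflex T' (f x, f y) = reflex T (x, y)"
      unfolding X.reflex_iff[OF xy] Y.reflex_iff[OF xy'] inv[OF x] inv[OF y] t0 ..
  next
    show "map_prod f f ` outer T = outer T'" unfolding X.out Y.out using fw fv f0 by simp
  qed
qed

lemma cppt_iso_refl: "cppt_iso T T"
  unfolding cppt_iso_def by (rule exI[of _ id]) (simp add: map_prod.id)

lemma flip_both_flip_steps: "(flip_both ^^ k) T T' \<Longrightarrow> (flip_step ^^ k) T T'"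
proof (erule relpowp_mono[rotated])
  fix x y assume "flip_both x y"
  then show "flip_step x y" unfolding flip_both_def flip_step_def using cppt_iso_refl by blast
qed

lemma flip_both_reverse: "(flip_both ^^ k) T T' \<Longrightarrow> (flip ^^ k) T' T"
proof (induction k arbitrary: T')
  case (Suc k)
  then obtain S where "(flip_both ^^ k) T S" "flip_both S T'" by auto
  then have "flip T' S" "(flip ^^ k) S T" using Suc.IH[of S] by (simp_all add: flip_both_def[of S])
  then show ?case by (rule relpowp_Suc_I2)
qed simp

lemma flip_flip_steps: "(flip ^^ k) T T' \<Longrightarrow> (flip_step ^^ k) T T'"
proof (erule relpowp_mono[rotated])
  fix x y assume "flip x y"
  then show "flip_step x y" unfolding flip_step_def using cppt_iso_refl by blast
qed

theorem theorem2:
  "\<exists>C::real. \<forall>n::nat. n \<ge> 3 \<longrightarrow> (\<forall>T1 T2.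
     four_ppt T1 \<and> four_ppt T2 \<and> card (verts T1) = n \<and> card (verts T2) = n \<and>
     card (outer T1) = 3 \<and> card (outer T2) = 3 \<longrightarrow>
     (\<exists>k T. real k \<le> C * real n ^ 2 \<and> (flip_step ^^ k) T1 T \<and> cppt_iso T T2))"
\<comment> \<open>Twice the constant 6 of \<open>reach_fan\<close>.\<close>
proof (rule exI[of _ 12], intro allI impI)
  fix n :: nat and T1 T2
  assume h: "four_ppt T1 \<and> four_ppt T2 \<and> card (verts T1) = n \<and> card (verts T2) = n \<and>
     card (outer T1) = 3 \<and> card (outer T2) = 3"
  have P: "ppt T1" "ppt T2" using h by (simp_all add: ppt_def)
  obtain k1 S1 w v ts where S1: "k1 \<le> 6 * (n * n)" "(flip_both ^^ k1) T1 S1" "ppt S1" "verts S1 = verts T1" "fan S1 w v ts"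
    using reach_fan[OF P(1)] h by auto
  obtain k2 S2 w' v' ts' where S2: "k2 \<le> 6 * (n * n)" "(flip_both ^^ k2) T2 S2" "ppt S2" "verts S2 = verts T2" "fan S2 w' v' ts'"
    using reach_fan[OF P(2)] h by auto
  have "card (verts S1) = card (verts S2)" using S1(4) S2(4) h by simp
  then have iso: "cppt_iso S1 S2" by (rule fan_iso[OF S1(3,5) S2(3,5)])
  have rev: "(flip ^^ k2) S2 T2" by (rule flip_both_reverse[OF S2(2)])
  \<comment> \<open>Passing from \<open>S1\<close> to \<open>S2\<close> costs no flip: the
    isomorphism is absorbed into the first step of the reversed path. If that path is empty, it
    becomes the final isomorphism of the conclusion instead.\<close>
  have "\<exists>T. (flip_step ^^ k2) S1 T \<and> cppt_iso T T2"
  proof (cases k2)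
    case 0
    then show ?thesis using rev iso by auto
  next
    case (Suc j)
    then obtain S where S: "flip S2 S" "(flip ^^ j) S T2" using rev by (metis relpowp_Suc_E2)
    have "flip_step S1 S" unfolding flip_step_def using iso S(1) cppt_iso_refl by blast
    then have "(flip_step ^^ Suc j) S1 T2" using flip_flip_steps[OF S(2)] by (rule relpowp_Suc_I2)
    then show ?thesis using Suc cppt_iso_refl by blast
  qed
  then obtain T where T: "(flip_step ^^ k2) S1 T" "cppt_iso T T2" by blast
  have "(flip_step ^^ (k1 + k2)) T1 T" using flip_both_flip_steps[OF S1(2)] T(1) by (rule relpowp_trans)
  moreover have "real (k1 + k2) \<le> 12 * real n ^ 2"
  proof -
    have "k1 + k2 \<le> 12 * (n * n)" using S1(1) S2(1) by simp
    then have "real (k1 + k2) \<le> real (12 * (n * n))" by (rule of_nat_mono)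
    then show ?thesis by (simp add: power2_eq_square)
  qed
  ultimately show "\<exists>k T. real k \<le> 12 * real n ^ 2 \<and> (flip_step ^^ k) T1 T \<and> cppt_iso T T2"
    using T(2) by blast
qed

end
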